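(* Let $\ell\ge 2$ and let $\mathcal R$ be an $\ell$-vertex size rule. There exist $t_{\mathrm b}=t_{\mathrm b}^{\mathcal R}\in[\frac{1}{\ell(\ell-1)},1]$ and functions $(\rho_k)_{k\ge1}$ with $\rho_k=\rho_k^{\mathcal R}:[0,t_{\mathrm b})\to[0,1]$ such that the following holds. For every $t\ge t_{\mathrm b}$ we have $S(G_{tn}^{\mathcal R})\overset{\mathrm p}{\to}\infty$ as $n\to\infty$. For every $t<t_{\mathrm b}$ we have $\sum_{k\ge1}\rho_k(t)=1$. Also, for every $t<t_{\mathrm b}$ there exist $a,A,C>0$ (depending only on $\mathcal R,\ell,t$) such that for every $t'\in[0,t]$ we have $\rho_k(t')\le Ae^{-ak}$ for all $k\ge1$. In addition, for $n\ge n_0(\mathcal R,\ell,t)$ the following holds with probability at least $1-n^{-99}$: for every $0\le i\le tn$ we have $$|N_k(G_i^{\mathcal R})-\rho_k(i/n)n|\le(\log n)^C n^{1/2}\quad\text{for all }k\ge1,$$ $$\Big|S(G_i^{\mathcal R})-\sum_{k\ge1}k\rho_k(i/n)\Big|\le(\log n)^C n^{-1/2},$$ and $N_{\ge k}(G_i^{\mathcal R})\le Ae^{-ak}n$ for all $k\ge1$.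
   Context: An $\ell$-vertex size rule $\mathcal R$ (fixed, not depending on $n$) is a map assigning to every list $(c_1,\ldots,c_\ell)$ of positive integers a non-empty set of pairs $\{a,b\}\subset\{1,\ldots,\ell\}$, $a\ne b$. For each $n$ it defines a random sequence $(G_i^{\mathcal R})_{i\ge0}$ of graphs on $[n]=\{1,\ldots,n\}$: $G_0^{\mathcal R}$ is the empty graph (no edges); in step $i+1$, vertices $v_1,\ldots,v_\ell$ are chosen from $[n]$ independently and uniformly at random (independently of previous steps), $c_j$ denotes the size (number of vertices) of the component of $G_i^{\mathcal R}$ containing $v_j$, and $G_{i+1}^{\mathcal R}$ is obtained from $G_i^{\mathcal R}$ by adding the edges $v_av_b$ for all pairs $\{a,b\}$ selected by $\mathcal R$ on input $(c_1,\ldots,c_\ell)$ (a pair with $v_a=v_b$ or an already present edge does not affect the component structure). For an $n$-vertex graph $G$: $N_k(G)$ (resp. $N_{\ge k}(G)$) is the number of vertices of $G$ in components with exactly $k$ (resp. at least $k$) vertices, and $S(G)=\sum_{k\ge1}kN_k(G)/n$ is the susceptibility. $S(G_{tn}^{\mathcal R})\overset{\mathrm p}{\to}\infty$ means that for every $C>0$, $\Pr(S(G_{tn}^{\mathcal R})\le C)\to0$ as $n\to\infty$. Rounding of $tn$ to an integer is ignored. *)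

theory Defs
  imports "HOL-Probability.Probability"
begin

text \<open>A graph on \<open>{1..n}\<close> is given by \<open>n\<close> together with its edge set, each edge being a
  two-element set of vertices.\<close>

type_synonym edges = "nat set set"

definition component :: "nat \<Rightarrow> edges \<Rightarrow> nat \<Rightarrow> nat set" where
  "component n E v = {u \<in> {1..n}. (v, u) \<in> {(x, y). {x, y} \<in> E}\<^sup>*}"

definition N_eq :: "nat \<Rightarrow> edges \<Rightarrow> nat \<Rightarrow> nat" where
  "N_eq n E k = card {v \<in> {1..n}. card (component n E v) = k}"

definition N_ge :: "nat \<Rightarrow> edges \<Rightarrow> nat \<Rightarrow> nat" where
  "N_ge n E k = card {v \<in> {1..n}. k \<le> card (component n E v)}"

text \<open>Components have at most \<open>n\<close> vertices, so the sum over all \<open>k \<ge> 1\<close> stops at \<open>n\<close>.\<close>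

definition susceptibility :: "nat \<Rightarrow> edges \<Rightarrow> real" where
  "susceptibility n E = (\<Sum>k = 1..n. real k * real (N_eq n E k) / real n)"

text \<open>Only the values of a size rule on lists of \<open>l\<close> positive integers matter; the selected
  pairs are two-element subsets of \<open>{1..l}\<close>.\<close>

definition size_rule :: "nat \<Rightarrow> (nat list \<Rightarrow> nat set set) \<Rightarrow> bool" where
  "size_rule l R \<longleftrightarrow>
     (\<forall>cs. length cs = l \<and> (\<forall>c \<in> set cs. 0 < c) \<longrightarrow>
        R cs \<noteq> {} \<and> R cs \<subseteq> {{a, b} | a b. a \<in> {1..l} \<and> b \<in> {1..l} \<and> a \<noteq> b})"

text \<open>One step, \<open>v j\<close> being the \<open>j\<close>-th chosen vertex for \<open>j \<in> {1..l}\<close>. A selected pair with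
  \<open>v a = v b\<close> would be a loop and adds no edge.\<close>

definition add_step ::
    "nat \<Rightarrow> (nat list \<Rightarrow> nat set set) \<Rightarrow> nat \<Rightarrow> (nat \<Rightarrow> nat) \<Rightarrow> edges \<Rightarrow> edges" where
  "add_step l R n v E =
     (let cs = map (\<lambda>j. card (component n E (v j))) [1..<Suc l]
      in E \<union> {{v a, v b} | a b. {a, b} \<in> R cs \<and> v a \<noteq> v b})"

text \<open>The outcome \<open>\<omega> (i, j)\<close> is the \<open>j\<close>-th vertex chosen in step \<open>i + 1\<close>.\<close>

definition choices :: "nat \<Rightarrow> nat \<Rightarrow> (nat \<times> nat \<Rightarrow> nat) measure" where
  "choices l n = (\<Pi>\<^sub>M x \<in> UNIV \<times> {1..l}. measure_pmf (pmf_of_set {1..n}))"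

primrec rule_graph ::
    "nat \<Rightarrow> (nat list \<Rightarrow> nat set set) \<Rightarrow> nat \<Rightarrow> (nat \<times> nat \<Rightarrow> nat) \<Rightarrow> nat \<Rightarrow> edges" where
  "rule_graph l R n \<omega> 0 = {}"
| "rule_graph l R n \<omega> (Suc i) = add_step l R n (\<lambda>j. \<omega> (i, j)) (rule_graph l R n \<omega> i)"

definition tends_to_infinity_in_prob ::
    "(nat \<Rightarrow> 'a measure) \<Rightarrow> (nat \<Rightarrow> 'a \<Rightarrow> real) \<Rightarrow> bool" where
  "tends_to_infinity_in_prob M X \<longleftrightarrow>
     (\<forall>C>0. (\<lambda>n. measure (M n) {\<omega> \<in> space (M n). X n \<omega> \<le> C}) \<longlonglongrightarrow> 0)"

end

theory Submission
  imports Defs "HOL-Real_Asymp.Real_Asymp"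
begin

text \<open>The proof rests on one dichotomy: as long as the susceptibility \<open>S\<close> stays bounded, the process is
tame and nearly deterministic, and it stays tame for a little longer. Hence the set of times at
which \<open>S\<close> is bounded with high probability is an interval \<open>[0, t\<^sub>b)\<close>, open on the right, and at every
other time \<open>S\<close> tends to infinity in probability.

\<^emph>\<open>Tails.\<close> Suppose that \<open>S \<le> C\<close> and that the size of the component of a random vertex has some
exponential moment. At a small rate \<open>x\<close> the exponential moment is then at most \<open>1 + 2Cx\<close>. One step
merges at most \<open>l\<close> components, so by independence the moment \<open>u(x)\<close> grows, per step, by at most
\<open>(l/n) u'(x) (u(x) ^ (l-1) - 1)\<close>. This is a Burgers-type inequality; along its characteristics,
where \<open>x\<close> decreases at speed about \<open>l(l-1)Cx\<close>, the moment is a supermartingale. A window of any length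
\<open>w\<close> with \<open>w l(l-1) C < 1\<close> can thus be crossed, and if \<open>S\<close> is still bounded by the same \<open>C\<close>, the
argument restarts with a smaller \<open>x\<close> (\<open>cmgf_window\<close>, \<open>cmgf_controlled_all\<close>). With \<open>C = 1\<close> the first
window already gives \<open>t\<^sub>b \<ge> 1/(l(l-1))\<close>. For concentration the moments have to be truncated at sizes
of order \<open>log n\<close>; a second potential, a power with exponent of order \<open>log n\<close>, shows that no component
is larger than a constant multiple of \<open>log n\<close> (\<open>no_large_component\<close>). Together these give
exponential tails (\<open>tails_while_subcritical\<close>).

\<^emph>\<open>Concentration.\<close> Up to the rare event that two chosen vertices share a component, the
expected change of \<open>N\<^sub>k\<close> is an explicit function \<open>drift\<close> of the empirical size distribution. By an
Azuma-type inequality \<open>N\<^sub>k\<close> minus its accumulated drift fluctuates by at most \<open>sqrt n\<close> times a power of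
\<open>log n\<close> (\<open>compensated_deviation\<close>).

\<^emph>\<open>Stability.\<close> The drift is not Lipschitz in the \<open>L\<^sup>1\<close> norm, because a component of size \<open>c\<close> is hit at
a rate proportional to \<open>c\<close>. But the dangerous part of its linearisation only moves mass from one size
to a larger one, and an Euler step with short step length is therefore a contraction up to a factor
\<open>1 + O(h C)\<close> (\<open>own_contraction\<close>, \<open>euler_step_stable\<close>). The unbounded factor \<open>c\<close> appears only once, in
front of the noise, where it costs a power of \<open>log n\<close>. So two tame runs, for \<open>n\<close> and for \<open>m\<close> vertices,
are close at equal times; comparing their Euler schemes on the lattice of mesh \<open>1/(nm)\<close> gives
\<open>runs_close\<close>.

\<^emph>\<open>Conclusion.\<close> If \<open>S\<close> at time \<open>t\<close> does not tend to infinity in probability, then there are tame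
runs up to time \<open>t\<close> for infinitely many \<open>n\<close>. A run for any large \<open>m\<close> stays close to one of them, and
so its own susceptibility cannot escape before time \<open>t\<close>: it is bounded with probability
\<open>1 - O(m ^ -100)\<close> (\<open>weak_strong\<close>), and one more window leads beyond \<open>t\<close>. The densities \<open>\<rho>\<^sub>k(t)\<close> are the
limits in probability of \<open>N\<^sub>k/n\<close>, which exist because tame runs form a Cauchy family
(\<open>rho_limit\<close>, \<open>rho_close\<close>). Finally \<open>t\<^sub>b \<le> 1\<close>: while \<open>S\<close> is bounded, all but \<open>O(1)\<close> steps in expectation
reduce the number of components, and after \<open>n\<close> steps too few components would be left
(\<open>bounded_susceptibility_at_1\<close>).\<close>

section \<open>Uniform random histories and a maximal inequality\<close>

text \<open>The probability that a list of \<open>m\<close> independent uniform elements of \<open>V\<close> satisfies \<open>Q\<close>. Splitting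
off the first element turns statements about a random process into inductions over its first step.\<close>

primrec uniform_prob :: "'v set \<Rightarrow> nat \<Rightarrow> ('v list \<Rightarrow> bool) \<Rightarrow> real" where
  "uniform_prob V 0 Q = of_bool (Q [])"
| "uniform_prob V (Suc m) Q = (\<Sum>v\<in>V. uniform_prob V m (\<lambda>h. Q (v # h))) / card V"

abbreviation hists :: "'v set \<Rightarrow> nat \<Rightarrow> 'v list set" where
  "hists V m \<equiv> {h. set h \<subseteq> V \<and> length h = m}"

lemma uniform_prob_nonneg: "0 \<le> uniform_prob V m Q"
  by (induction m arbitrary: Q) (auto intro!: sum_nonneg divide_nonneg_nonneg)

lemma uniform_prob_mono:
  assumes "\<And>h. h \<in> hists V m \<Longrightarrow> Q h \<Longrightarrow> Q' h"
  shows "uniform_prob V m Q \<le> uniform_prob V m Q'"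
  using assms
proof (induction m arbitrary: Q Q')
  case (Suc m)
  have "uniform_prob V m (\<lambda>h. Q (v # h)) \<le> uniform_prob V m (\<lambda>h. Q' (v # h))" if "v \<in> V" for v
    by (rule Suc.IH) (use Suc.prems that in auto)
  then show ?case
    by (auto intro!: sum_mono divide_right_mono)
qed auto

lemma uniform_prob_cong:
  assumes "\<And>h. h \<in> hists V m \<Longrightarrow> Q h \<longleftrightarrow> Q' h"
  shows "uniform_prob V m Q = uniform_prob V m Q'"
  using assms by (intro antisym uniform_prob_mono) auto

lemma uniform_prob_True:
  assumes "finite V" "V \<noteq> {}" shows "uniform_prob V m (\<lambda>_. True) = 1"
  using assms by (induction m) (auto simp: card_eq_0_iff)

lemma uniform_prob_le_1:
  assumes "finite V" "V \<noteq> {}" shows "uniform_prob V m Q \<le> 1"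
  using uniform_prob_mono[of V m Q "\<lambda>_. True"] uniform_prob_True[OF assms, of m] by simp

lemma uniform_prob_False: "uniform_prob V m (\<lambda>_. False) = 0"
  by (induction m) auto

lemma uniform_prob_disj: "uniform_prob V m (\<lambda>h. Q h \<or> Q' h) \<le> uniform_prob V m Q + uniform_prob V m Q'"
proof (induction m arbitrary: Q Q')
  case (Suc m)
  have "(\<Sum>v\<in>V. uniform_prob V m (\<lambda>h. Q (v # h) \<or> Q' (v # h)))
      \<le> (\<Sum>v\<in>V. uniform_prob V m (\<lambda>h. Q (v # h)) + uniform_prob V m (\<lambda>h. Q' (v # h)))"
    by (intro sum_mono Suc.IH)
  then show ?case
    by (simp add: sum.distrib add_divide_distrib[symmetric] divide_right_mono)
qed auto

lemma uniform_prob_not: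
  assumes "finite V" "V \<noteq> {}"
  shows "uniform_prob V m (\<lambda>h. \<not> Q h) = 1 - uniform_prob V m Q"
proof (induction m arbitrary: Q)
  case (Suc m)
  have "real (card V) \<noteq> 0" using assms by auto
  then show ?case
    by (simp add: Suc.IH sum_subtractf diff_divide_distrib)
qed auto

lemma uniform_prob_bex:
  assumes "finite I"
  shows "uniform_prob V m (\<lambda>h. \<exists>i\<in>I. Q i h) \<le> (\<Sum>i\<in>I. uniform_prob V m (Q i))"
  using assms
proof (induction I rule: finite_induct)
  case empty then show ?case by (simp add: uniform_prob_False)
next
  case (insert i I)
  have "uniform_prob V m (\<lambda>h. \<exists>j\<in>insert i I. Q j h) \<le> uniform_prob V m (Q i) + uniform_prob V m (\<lambda>h. \<exists>j\<in>I. Q j h)"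
    using uniform_prob_disj[of V m "Q i" "\<lambda>h. \<exists>j\<in>I. Q j h"] by simp
  with insert show ?case by simp
qed

lemma uniform_prob_pos_ex:
  assumes "0 < uniform_prob V m Q" shows "\<exists>h\<in>hists V m. Q h"
proof (rule ccontr)
  assume "\<not> ?thesis"
  then have "uniform_prob V m Q = uniform_prob V m (\<lambda>_. False)" by (intro uniform_prob_cong) auto
  with assms show False by (simp add: uniform_prob_False)
qed

lemma uniform_prob_take: 
  assumes "finite V" "V \<noteq> {}"
  shows "uniform_prob V (a + b) (\<lambda>h. Q (take a h)) = uniform_prob V a Q"
proof (induction a arbitrary: Q)
  case 0
  then show ?case using uniform_prob_True[OF assms, of b] uniform_prob_False[of V b] by (cases "Q []") auto
next
  case (Suc a)
  show ?case using Suc.IH[of "\<lambda>h. Q (_ # h)"] by simp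
qed

text \<open>After any prefix the remaining draws are again uniform, so a bound that holds after every
possible prefix holds for the whole list.\<close>

lemma uniform_prob_restart:
  assumes "finite V" "V \<noteq> {}"
    and "\<And>h0. h0 \<in> hists V a \<Longrightarrow> uniform_prob V b (\<lambda>h. Q (h0 @ h)) \<le> \<delta>"
  shows "uniform_prob V (a + b) Q \<le> \<delta>"
  using assms(3)
proof (induction a arbitrary: Q)
  case 0 then show ?case by simp
next
  case (Suc a)
  have "uniform_prob V (a + b) (\<lambda>h. Q (v # h)) \<le> \<delta>" if "v \<in> V" for v
  proof (rule Suc.IH)
    fix h0 assume "h0 \<in> hists V a"
    then show "uniform_prob V b (\<lambda>h. Q (v # h0 @ h)) \<le> \<delta>"
      using Suc.prems[of "v # h0"] that by simp
  qed
  then have "(\<Sum>v\<in>V. uniform_prob V (a + b) (\<lambda>h. Q (v # h))) \<le> (\<Sum>v\<in>V. \<delta>)"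
    by (rule sum_mono)
  moreover have "0 < real (card V)" using assms by (simp add: card_gt_0_iff)
  ultimately show ?case by (simp add: pos_divide_le_eq mult.commute)
qed

lemma uniform_prob_eq_card:
  assumes "finite V"
  shows "uniform_prob V m Q = real (card {h \<in> hists V m. Q h}) / real (card V) ^ m"
proof (induction m arbitrary: Q)
  case 0
  have "{h \<in> hists V 0. Q h} = (if Q [] then {[]} else {})" by auto
  then show ?case by auto
next
  case (Suc m)
  have fin: "finite (hists V k)" for k by (rule finite_lists_length_eq[OF assms])
  have eq: "{h \<in> hists V (Suc m). Q h} = (\<Union>v\<in>V. (#) v ` {h \<in> hists V m. Q (v # h)})"
    by (auto simp: length_Suc_conv image_iff)
  have "card {h \<in> hists V (Suc m). Q h} = (\<Sum>v\<in>V. card ((#) v ` {h \<in> hists V m. Q (v # h)}))"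
    unfolding eq by (rule card_UN_disjoint) (use assms in \<open>auto intro!: finite_imageI intro: finite_subset[OF _ fin[of m]]\<close>)
  also have "\<dots> = (\<Sum>v\<in>V. card {h \<in> hists V m. Q (v # h)})"
    by (intro sum.cong refl card_image) (auto simp: inj_on_def)
  finally show ?case
    by (simp add: Suc.IH sum_divide_distrib mult.commute)
qed

text \<open>Doob's maximal inequality for a potential that grows on average by at most a factor \<open>\<gamma>\<close> per step,
up to the first history that is not good. The induction over the remaining steps averages over the
next draw; the starting history \<open>h0\<close> has to be arbitrary for it, which also allows restarts at later
times.\<close>

lemma maximal_inequality:
  fixes W :: "'v list \<Rightarrow> real"
  assumes V: "finite V" "V \<noteq> {}"
    and nonneg: "\<And>h. set h \<subseteq> V \<Longrightarrow> 0 \<le> W h"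
    and \<gamma>: "1 \<le> \<gamma>" and \<Lambda>: "0 < \<Lambda>"
    and step: "\<And>h. set h \<subseteq> V \<Longrightarrow> length h < length h0 + m \<Longrightarrow> good h \<Longrightarrow> (\<Sum>v\<in>V. W (h @ [v])) / card V \<le> \<gamma> * W h"
    and h0: "set h0 \<subseteq> V"
  shows "uniform_prob V m (\<lambda>h. \<exists>i\<le>m. (\<forall>j<i. good (h0 @ take j h)) \<and> \<Lambda> \<le> W (h0 @ take i h))
    \<le> \<gamma> ^ m * W h0 / \<Lambda>"
  using h0 step
proof (induction m arbitrary: h0)
  case 0
  show ?case using nonneg[OF 0(1)] \<Lambda> by (auto simp: field_simps)
next
  case (Suc m)
  let ?Q = "\<lambda>m h0 h. \<exists>i\<le>m. (\<forall>j<i. good (h0 @ take j h)) \<and> \<Lambda> \<le> W (h0 @ take i h)"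
  consider (big) "\<Lambda> \<le> W h0" | (bad) "W h0 < \<Lambda>" "\<not> good h0" | (good) "W h0 < \<Lambda>" "good h0"
    by linarith
  then show ?case
  proof cases
    case big
    have "1 \<le> \<gamma> ^ Suc m * (W h0 / \<Lambda>)"
      using mult_mono[of 1 "\<gamma> ^ Suc m" 1 "W h0 / \<Lambda>"] one_le_power[OF \<gamma>, of "Suc m"] big \<Lambda> \<gamma>
      by (simp add: field_simps)
    then show ?thesis using uniform_prob_le_1[OF V, of "Suc m" "?Q (Suc m) h0"] by simp
  next
    case bad
    have "uniform_prob V (Suc m) (?Q (Suc m) h0) = uniform_prob V (Suc m) (\<lambda>_. False)"
    proof (intro uniform_prob_cong iffI)
      fix h assume "?Q (Suc m) h0 h"
      then obtain i where i: "\<forall>j<i. good (h0 @ take j h)" "\<Lambda> \<le> W (h0 @ take i h)" by blast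
      show False
      proof (cases i)
        case 0 then show False using i bad by simp
      next
        case (Suc k) then show False using i(1)[rule_format, of 0] bad by simp
      qed
    qed auto
    then show ?thesis using nonneg[OF Suc.prems(1)] \<gamma> \<Lambda> by (simp only: uniform_prob_False) simp
  next
    case good
    have "uniform_prob V m (\<lambda>h. ?Q (Suc m) h0 (v # h)) \<le> \<gamma> ^ m * W (h0 @ [v]) / \<Lambda>" if v: "v \<in> V" for v
    proof -
      have "uniform_prob V m (\<lambda>h. ?Q (Suc m) h0 (v # h)) \<le> uniform_prob V m (?Q m (h0 @ [v]))"
      proof (intro uniform_prob_mono)
        fix h assume "?Q (Suc m) h0 (v # h)"
        then obtain i where i: "i \<le> Suc m" "\<forall>j<i. good (h0 @ take j (v # h))" "\<Lambda> \<le> W (h0 @ take i (v # h))"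
          by blast
        then obtain k where k: "i = Suc k" using good by (cases i) auto
        have "good (h0 @ [v] @ take j h)" if "j < k" for j
          using i(2)[rule_format, of "Suc j"] k that by simp
        then show "?Q m (h0 @ [v]) h" using i k by (intro exI[of _ k]) auto
      qed
      also have "\<dots> \<le> \<gamma> ^ m * W (h0 @ [v]) / \<Lambda>"
        by (rule Suc.IH) (use Suc.prems v in auto)
      finally show ?thesis .
    qed
    then have "uniform_prob V (Suc m) (?Q (Suc m) h0) \<le> (\<Sum>v\<in>V. \<gamma> ^ m * W (h0 @ [v]) / \<Lambda>) / card V"
      by (auto intro!: divide_right_mono sum_mono)
    also have "\<dots> = \<gamma> ^ m / \<Lambda> * ((\<Sum>v\<in>V. W (h0 @ [v])) / card V)"
      by (simp add: sum_distrib_left sum_divide_distrib[symmetric] mult.assoc)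
    also have "\<dots> \<le> \<gamma> ^ m / \<Lambda> * (\<gamma> * W h0)"
      by (intro mult_left_mono Suc.prems(2)) (use good Suc.prems \<gamma> \<Lambda> in auto)
    finally show ?thesis by (simp add: mult_ac)
  qed
qed

lemma exp_le_quadratic:
  fixes y :: real assumes "\<bar>y\<bar> \<le> 1" shows "exp y \<le> 1 + y + y\<^sup>2"
proof (cases "0 \<le> y")
  case True then show ?thesis using exp_bound[of y] assms by simp
next
  case False
  then show ?thesis using exp_ge_add_one_self[of y] assms 
  proof -
    have "exp (-y) \<ge> 1 + (-y) + (-y)\<^sup>2/2" using exp_lower_Taylor_quadratic[of "-y"] False by simp
    then have "inverse (exp (- y)) \<le> inverse (1 - y + y\<^sup>2/2)"
      using False by (intro le_imp_inverse_le) (auto intro: add_pos_nonneg)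
    then have "exp y \<le> 1 / (1 - y + y\<^sup>2/2)"
      by (simp add: exp_minus inverse_eq_divide)
    also have "\<dots> \<le> 1 + y + y\<^sup>2"
    proof -
      have "(1 + y + y\<^sup>2) * (1 - y + y\<^sup>2/2) = 1 + y\<^sup>2/2 - y^3/2 + y^4/2"
        by (simp add: field_simps power2_eq_square power3_eq_cube power4_eq_xxxx)
      moreover have "0 \<le> y\<^sup>2/2 - y^3/2 + y^4/2"
      proof -
        have "y ^ 3 \<le> 0" using False by (simp add: power3_eq_cube mult_nonneg_nonpos)
        moreover have "0 \<le> y ^ 4" by simp
        ultimately show ?thesis using zero_le_power2[of y] by linarith
      qed
      moreover have "0 < 1 - y + y\<^sup>2/2" using False by (simp add: add_pos_nonneg)
      ultimately show ?thesis by (simp add: pos_divide_le_eq)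
    qed
    finally show ?thesis .
  qed
qed

text \<open>The maximal inequality applied to \<open>exp (\<theta> * f)\<close>. The bound \<open>\<theta> * \<beta> \<le> 1\<close> keeps all exponents in the
range where \<open>exp y \<le> 1 + y + y\<^sup>2\<close>, and the linear term averages to at most \<open>0\<close>.\<close>

lemma azuma_inequality:
  fixes f :: "'v list \<Rightarrow> real"
  assumes V: "finite V" "V \<noteq> {}"
    and drift: "\<And>h. set h \<subseteq> V \<Longrightarrow> length h < length h0 + m \<Longrightarrow> good h \<Longrightarrow> (\<Sum>v\<in>V. f (h @ [v])) / card V \<le> f h"
    and jump: "\<And>h v. set h \<subseteq> V \<Longrightarrow> length h < length h0 + m \<Longrightarrow> good h \<Longrightarrow> v \<in> V \<Longrightarrow> \<bar>f (h @ [v]) - f h\<bar> \<le> \<beta>"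
    and \<theta>: "0 \<le> \<theta>" "\<theta> * \<beta> \<le> 1" and \<beta>: "0 \<le> \<beta>"
    and h0: "set h0 \<subseteq> V"
  shows "uniform_prob V m (\<lambda>h. \<exists>i\<le>m. (\<forall>j<i. good (h0 @ take j h)) \<and> f h0 + \<delta> \<le> f (h0 @ take i h))
    \<le> exp (real m * (\<theta> * \<beta>)\<^sup>2 - \<theta> * \<delta>)"
proof -
  \<comment> \<open>Starting from \<open>W h0 = 1\<close>, the event requires \<open>W \<ge> exp (\<theta> * \<delta>)\<close>.\<close>
  let ?W = "\<lambda>h. exp (\<theta> * (f h - f h0))"
  have card: "0 < real (card V)" using V by (simp add: card_gt_0_iff)
  have step: "(\<Sum>v\<in>V. ?W (h @ [v])) / card V \<le> exp ((\<theta> * \<beta>)\<^sup>2) * ?W h"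
    if h: "set h \<subseteq> V" "length h < length h0 + m" "good h" for h
  proof -
    have "?W (h @ [v]) \<le> ?W h * (1 + \<theta> * (f (h @ [v]) - f h) + (\<theta> * \<beta>)\<^sup>2)" if "v \<in> V" for v
    proof -
      let ?y = "\<theta> * (f (h @ [v]) - f h)"
      have y: "\<bar>?y\<bar> \<le> \<theta> * \<beta>" using jump[OF h that] \<theta> by (simp add: abs_mult mult_left_mono)
      then have "exp ?y \<le> 1 + ?y + ?y\<^sup>2" using \<theta> by (intro exp_le_quadratic) linarith
      also have "?y\<^sup>2 \<le> (\<theta> * \<beta>)\<^sup>2" using y by (rule abs_le_square_iff[THEN iffD1, OF order_trans]) simp
      finally have "exp ?y \<le> 1 + ?y + (\<theta> * \<beta>)\<^sup>2" by simp
      then have "?W h * exp ?y \<le> ?W h * (1 + ?y + (\<theta> * \<beta>)\<^sup>2)" by (intro mult_left_mono) auto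
      moreover have "?W (h @ [v]) = ?W h * exp ?y" by (simp add: exp_add[symmetric] algebra_simps)
      ultimately show ?thesis by simp
    qed
    then have "(\<Sum>v\<in>V. ?W (h @ [v])) / card V
        \<le> (\<Sum>v\<in>V. ?W h * (1 + \<theta> * (f (h @ [v]) - f h) + (\<theta> * \<beta>)\<^sup>2)) / card V"
      by (intro divide_right_mono sum_mono) auto
    also have "\<dots> = ?W h * (1 + \<theta> * ((\<Sum>v\<in>V. f (h @ [v])) / card V - f h) + (\<theta> * \<beta>)\<^sup>2)"
      using card by (simp only: sum_distrib_left[symmetric] sum.distrib sum_subtractf sum_constant) (simp add: field_simps)
    also have "\<dots> \<le> ?W h * (1 + (\<theta> * \<beta>)\<^sup>2)"
      using drift[OF h] \<theta> by (intro mult_left_mono) (auto simp: mult_le_0_iff)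
    also have "\<dots> \<le> ?W h * exp ((\<theta> * \<beta>)\<^sup>2)"
      by (intro mult_left_mono exp_ge_add_one_self) auto
    finally show ?thesis by (simp add: mult.commute)
  qed
  have "uniform_prob V m (\<lambda>h. \<exists>i\<le>m. (\<forall>j<i. good (h0 @ take j h)) \<and> f h0 + \<delta> \<le> f (h0 @ take i h))
      \<le> uniform_prob V m (\<lambda>h. \<exists>i\<le>m. (\<forall>j<i. good (h0 @ take j h)) \<and> exp (\<theta> * \<delta>) \<le> ?W (h0 @ take i h))"
    using \<theta> by (intro uniform_prob_mono) (auto intro!: mult_left_mono)
  also have "\<dots> \<le> exp ((\<theta> * \<beta>)\<^sup>2) ^ m * ?W h0 / exp (\<theta> * \<delta>)"
    by (rule maximal_inequality[OF V]) (use step h0 in auto)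
  also have "\<dots> = exp (real m * (\<theta> * \<beta>)\<^sup>2 - \<theta> * \<delta>)"
    by (simp add: exp_of_nat_mult exp_diff)
  finally show ?thesis .
qed

section \<open>Components and one step of the process\<close>

definition adjacency :: "edges \<Rightarrow> (nat \<times> nat) set" where
  "adjacency E = {(x, y). {x, y} \<in> E}"

abbreviation csize :: "nat \<Rightarrow> edges \<Rightarrow> nat \<Rightarrow> nat" where
  "csize n E u \<equiv> card (component n E u)"

text \<open>The set \<open>component n E v\<close> only records vertices of \<open>{1..n}\<close>, whereas paths could leave \<open>{1..n}\<close>. For
edge sets inside \<open>{1..n}\<close> components are closed under edges.\<close>

definition edges_on :: "nat \<Rightarrow> edges \<Rightarrow> bool" where
  "edges_on n E \<longleftrightarrow> (\<forall>e\<in>E. e \<subseteq> {1..n})"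

lemma component_eq: "component n E v = {u \<in> {1..n}. (v, u) \<in> (adjacency E)\<^sup>*}"
  by (simp add: component_def adjacency_def)

lemma finite_component [simp]: "finite (component n E v)"
  by (simp add: component_def)

lemma component_subset: "component n E v \<subseteq> {1..n}"
  by (auto simp: component_def)

lemma self_in_component [simp]: "u \<in> {1..n} \<Longrightarrow> u \<in> component n E u"
  by (simp add: component_def)

lemma csize_pos [simp]: "u \<in> {1..n} \<Longrightarrow> 0 < csize n E u"
  unfolding card_gt_0_iff using self_in_component[of u n E] finite_component by blast

lemma csize_ge_1: "u \<in> {1..n} \<Longrightarrow> 1 \<le> csize n E u"
  using csize_pos[of u n E] by linarith

lemma csize_le: "csize n E u \<le> n"
  using card_mono[OF _ component_subset, of n E u] by simp

lemma sym_adjacency: "sym ((adjacency E)\<^sup>*)"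
  by (rule sym_rtrancl) (auto simp: sym_def adjacency_def insert_commute)

lemma component_closed:
  assumes "x \<in> W" and "\<And>x y. x \<in> W \<Longrightarrow> {x, y} \<in> E \<Longrightarrow> y \<in> W"
  shows "component n E x \<subseteq> W"
proof -
  have "(x, y) \<in> (adjacency E)\<^sup>* \<Longrightarrow> y \<in> W" for y
    by (induction rule: rtrancl_induct) (use assms in \<open>auto simp: adjacency_def\<close>)
  then show ?thesis by (auto simp: component_eq)
qed

lemma component_cong: "u \<in> component n E v \<Longrightarrow> component n E u = component n E v"
proof -
  assume "u \<in> component n E v"
  then have uv: "(v, u) \<in> (adjacency E)\<^sup>*" by (simp add: component_eq)
  then have vu: "(u, v) \<in> (adjacency E)\<^sup>*" using symD[OF sym_adjacency] by blast
  show ?thesis using rtrancl_trans[OF uv] rtrancl_trans[OF vu] by (auto simp: component_eq)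
qed

lemma component_sym: "v \<in> {1..n} \<Longrightarrow> u \<in> component n E v \<Longrightarrow> v \<in> component n E u"
  using component_cong[of u n E v] by simp

lemma component_edge:
  assumes "edges_on n E" "x \<in> component n E v" "{x, y} \<in> E" shows "y \<in> component n E v"
proof -
  have "y \<in> {1..n}" using assms(1,3) by (auto simp: edges_on_def)
  moreover have "(x, y) \<in> adjacency E" using assms by (simp add: adjacency_def)
  ultimately show ?thesis using assms(2) by (auto simp: component_eq intro: rtrancl_into_rtrancl)
qed

lemma component_mono: "E \<subseteq> E' \<Longrightarrow> component n E v \<subseteq> component n E' v"
proof -
  assume "E \<subseteq> E'"
  then have "(adjacency E)\<^sup>* \<subseteq> (adjacency E')\<^sup>*" by (intro rtrancl_mono) (auto simp: adjacency_def)
  then show ?thesis by (auto simp: component_eq)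
qed

lemma csize_mono: "E \<subseteq> E' \<Longrightarrow> csize n E v \<le> csize n E' v"
  by (intro card_mono component_mono) auto

lemma csize_empty [simp]: "u \<in> {1..n} \<Longrightarrow> csize n {} u = 1"
proof -
  assume "u \<in> {1..n}"
  then have "component n {} u = {u}" by (auto simp: component_eq adjacency_def)
  then show ?thesis by simp
qed

lemma N_eq_sum: "real (N_eq n E k) = (\<Sum>u\<in>{1..n}. of_bool (csize n E u = k))"
  by (simp add: N_eq_def sum.If_cases of_bool_def Int_def)

lemma N_ge_sum: "real (N_ge n E k) = (\<Sum>u\<in>{1..n}. of_bool (k \<le> csize n E u))"
  by (simp add: N_ge_def sum.If_cases of_bool_def Int_def)

lemma sum_N_eq:
  "(\<Sum>k\<in>{1..n}. \<phi> k * real (N_eq n E k)) = (\<Sum>u\<in>{1..n}. \<phi> (csize n E u))" for \<phi> :: "nat \<Rightarrow> real"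
proof -
  have "(\<Sum>k\<in>{1..n}. \<phi> k * real (N_eq n E k)) = (\<Sum>u\<in>{1..n}. \<Sum>k\<in>{1..n}. \<phi> k * of_bool (csize n E u = k))"
    unfolding N_eq_sum sum_distrib_left by (rule sum.swap)
  also have "\<dots> = (\<Sum>u\<in>{1..n}. \<phi> (csize n E u))"
  proof (rule sum.cong[OF refl])
    fix u assume u: "u \<in> {1..n}"
    have "(\<Sum>k\<in>{1..n}. \<phi> k * of_bool (csize n E u = k)) = (\<Sum>k\<in>{1..n}. if k = csize n E u then \<phi> k else 0)"
      by (intro sum.cong) auto
    also have "\<dots> = \<phi> (csize n E u)"
      using csize_ge_1[OF u, of E] csize_le[of n E u] by simp
    finally show "(\<Sum>k\<in>{1..n}. \<phi> k * of_bool (csize n E u = k)) = \<phi> (csize n E u)" .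
  qed
  finally show ?thesis .
qed

text \<open>The susceptibility is the mean size of the component of a uniformly chosen vertex; this is how it
enters all estimates.\<close>

lemma susceptibility_eq: "susceptibility n E = (\<Sum>u\<in>{1..n}. real (csize n E u)) / n"
  using sum_N_eq[of real n E] by (simp add: susceptibility_def sum_divide_distrib[symmetric])

text \<open>Layer-cake formula: it turns tail bounds into bounds for the susceptibility.\<close>

lemma sum_N_ge: "(\<Sum>u\<in>{1..n}. real (csize n E u)) = (\<Sum>k\<in>{1..n}. real (N_ge n E k))"
proof -
  have "(\<Sum>k\<in>{1..n}. real (N_ge n E k)) = (\<Sum>u\<in>{1..n}. \<Sum>k\<in>{1..n}. of_bool (k \<le> csize n E u))"
    unfolding N_ge_sum by (rule sum.swap)
  also have "\<dots> = (\<Sum>u\<in>{1..n}. real (csize n E u))"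
  proof (rule sum.cong[OF refl])
    fix u assume u: "u \<in> {1..n}"
    have "{1..n} \<inter> {k. k \<le> csize n E u} = {1..csize n E u}" using csize_le[of n E u] by auto
    then show "(\<Sum>k\<in>{1..n}. of_bool (k \<le> csize n E u)) = real (csize n E u)"
      by (simp add: of_bool_def sum.If_cases)
  qed
  finally show ?thesis by simp
qed

lemma susceptibility_mono: "E \<subseteq> E' \<Longrightarrow> susceptibility n E \<le> susceptibility n E'"
  unfolding susceptibility_eq by (intro divide_right_mono sum_mono of_nat_mono csize_mono) auto

lemma susceptibility_empty: "0 < n \<Longrightarrow> susceptibility n {} = 1"
  unfolding susceptibility_eq by simp

lemma sum_UNION_le:
  fixes g :: "'b \<Rightarrow> real"
  assumes "finite I" "\<And>i. i \<in> I \<Longrightarrow> finite (A i)" "\<And>u. u \<in> (\<Union>i\<in>I. A i) \<Longrightarrow> 0 \<le> g u"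
  shows "sum g (\<Union>i\<in>I. A i) \<le> (\<Sum>i\<in>I. sum g (A i))"
  using assms
proof (induction I rule: finite_induct)
  case (insert i I)
  have "sum g (A i \<union> (\<Union>i\<in>I. A i)) \<le> sum g (A i) + sum g (\<Union>i\<in>I. A i)"
  proof -
    have "sum g (A i \<union> (\<Union>i\<in>I. A i)) + sum g (A i \<inter> (\<Union>i\<in>I. A i)) = sum g (A i) + sum g (\<Union>i\<in>I. A i)"
      by (rule sum.union_inter) (use insert in auto)
    moreover have "0 \<le> sum g (A i \<inter> (\<Union>i\<in>I. A i))" by (rule sum_nonneg) (use insert in auto)
    ultimately show ?thesis by linarith
  qed
  moreover have "sum g (\<Union>i\<in>I. A i) \<le> (\<Sum>i\<in>I. sum g (A i))" using insert by auto
  ultimately show ?case using insert by simp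
qed simp

locale size_rule_process =
  fixes l :: nat and R :: "nat list \<Rightarrow> nat set set"
  assumes l2: "2 \<le> l" and size_rule: "size_rule l R"
begin

definition tuples :: "nat \<Rightarrow> (nat \<Rightarrow> nat) set" where
  "tuples n = {1..l} \<rightarrow>\<^sub>E {1..n}"

abbreviation step :: "nat \<Rightarrow> (nat \<Rightarrow> nat) \<Rightarrow> edges \<Rightarrow> edges" where
  "step n v E \<equiv> add_step l R n v E"

definition graph :: "nat \<Rightarrow> (nat \<Rightarrow> nat) list \<Rightarrow> edges" where
  "graph n h = foldl (\<lambda>E v. step n v E) {} h"

definition chosen :: "(nat \<Rightarrow> nat) \<Rightarrow> nat set set" where
  "chosen c = R (map c [1..<Suc l])"

text \<open>The indices that the chosen pairs connect to \<open>j\<close>, for components of sizes \<open>c\<close>. If the \<open>l\<close> vertices lie in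
distinct components, then \<open>v j\<close> ends in the union of the components of the \<open>v i\<close> with \<open>i \<in> group c j\<close>,
so that the effect of a step on the component sizes is a function of \<open>c\<close> alone.\<close>

definition group :: "(nat \<Rightarrow> nat) \<Rightarrow> nat \<Rightarrow> nat set" where
  "group c j = component l (chosen c) j"

definition new_size :: "(nat \<Rightarrow> nat) \<Rightarrow> nat \<Rightarrow> nat" where
  "new_size c j = (\<Sum>i\<in>group c j. c i)"

definition touched :: "nat \<Rightarrow> edges \<Rightarrow> (nat \<Rightarrow> nat) \<Rightarrow> nat set" where
  "touched n E v = (\<Union>j\<in>{1..l}. component n E (v j))"

definition total :: "nat \<Rightarrow> edges \<Rightarrow> (nat \<Rightarrow> nat) \<Rightarrow> nat" where
  "total n E v = (\<Sum>j\<in>{1..l}. csize n E (v j))"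

definition separated :: "nat \<Rightarrow> edges \<Rightarrow> (nat \<Rightarrow> nat) \<Rightarrow> bool" where
  "separated n E v \<longleftrightarrow> (\<forall>i\<in>{1..l}. \<forall>j\<in>{1..l}. i \<noteq> j \<longrightarrow> v i \<notin> component n E (v j))"

text \<open>The change of \<open>N\<^sub>k\<close> in a step that picks \<open>l\<close> distinct components of sizes \<open>c\<close>: the \<open>c j\<close> vertices of
the \<open>j\<close>-th component move from size \<open>c j\<close> to size \<open>new_size c j\<close>.\<close>

definition size_change :: "(nat \<Rightarrow> nat) \<Rightarrow> nat \<Rightarrow> real" where
  "size_change c k = (\<Sum>j\<in>{1..l}. real (c j) * (of_bool (new_size c j = k) - of_bool (c j = k)))"

lemma tuplesD: "v \<in> tuples n \<Longrightarrow> j \<in> {1..l} \<Longrightarrow> v j \<in> {1..n}"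
  unfolding tuples_def by (rule PiE_mem)

lemma finite_tuples [simp]: "finite (tuples n)" 
  by (simp add: tuples_def finite_PiE)

lemma card_tuples: "card (tuples n) = n ^ l"
  by (simp add: tuples_def card_PiE)

lemma tuples_nonempty: "0 < n \<Longrightarrow> tuples n \<noteq> {}"
  by (auto simp: tuples_def PiE_eq_empty_iff)

lemma chosenD:
  assumes "\<And>j. j \<in> {1..l} \<Longrightarrow> 0 < c j"
  shows "chosen c \<noteq> {}" "e \<in> chosen c \<Longrightarrow> \<exists>a b. e = {a, b} \<and> a \<in> {1..l} \<and> b \<in> {1..l} \<and> a \<noteq> b"
proof -
  have "length (map c [1..<Suc l]) = l" "\<forall>x\<in>set (map c [1..<Suc l]). 0 < x"
    using assms by auto
  then have *: "chosen c \<noteq> {} \<and> chosen c \<subseteq> {{a, b} | a b. a \<in> {1..l} \<and> b \<in> {1..l} \<and> a \<noteq> b}"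
    using size_rule unfolding size_rule_def chosen_def by blast
  then show "chosen c \<noteq> {}" by blast
  assume "e \<in> chosen c"
  with * show "\<exists>a b. e = {a, b} \<and> a \<in> {1..l} \<and> b \<in> {1..l} \<and> a \<noteq> b" by blast
qed

lemma edges_on_chosen:
  assumes "\<And>j. j \<in> {1..l} \<Longrightarrow> 0 < c j" shows "edges_on l (chosen c)"
proof -
  have "e \<subseteq> {1..l}" if "e \<in> chosen c" for e
    using chosenD(2)[OF assms that] by auto
  then show ?thesis unfolding edges_on_def by blast
qed

lemma step_eq: "step n v E = E \<union> {{v a, v b} | a b. {a, b} \<in> chosen (csize n E \<circ> v) \<and> v a \<noteq> v b}"
  by (simp add: add_step_def chosen_def o_def Let_def)

lemma graph_Nil [simp]: "graph n [] = {}" by (simp add: graph_def)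

lemma graph_snoc [simp]: "graph n (h @ [v]) = step n v (graph n h)" by (simp add: graph_def)

lemma step_mono: "E \<subseteq> step n v E" by (auto simp: step_eq)

lemma graph_append_mono: "graph n h \<subseteq> graph n (h @ h')"
proof (induction h' rule: rev_induct)
  case (snoc v h')
  then show ?case using step_mono[of "graph n (h @ h')" n v] graph_snoc[of n "h @ h'" v] by simp
qed simp

lemma graph_take_mono: "i \<le> j \<Longrightarrow> graph n (take i h) \<subseteq> graph n (take j h)"
  using graph_append_mono[of n "take i (take j h)" "drop i (take j h)"] append_take_drop_id[of i "take j h"]
  by (simp add: min_absorb1 del: append_take_drop_id)

context
  fixes n :: nat and E :: edges and v :: "nat \<Rightarrow> nat"
  assumes E: "edges_on n E" and v: "v \<in> tuples n"
begin

lemma sizes_pos: "j \<in> {1..l} \<Longrightarrow> 0 < (csize n E \<circ> v) j"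
  using tuplesD[OF v] by simp

lemma chosen_subset: "{a, b} \<in> chosen (csize n E \<circ> v) \<Longrightarrow> a \<in> {1..l} \<and> b \<in> {1..l}"
  using edges_on_chosen[of "csize n E \<circ> v", OF sizes_pos] unfolding edges_on_def by blast

lemma new_edge:
  assumes "{x, y} \<in> step n v E"
  shows "{x, y} \<in> E \<or> (\<exists>a\<in>{1..l}. \<exists>b\<in>{1..l}. {a, b} \<in> chosen (csize n E \<circ> v) \<and> x = v a \<and> y = v b)"
proof (cases "{x, y} \<in> E")
  case False
  then obtain a b where ab: "{x, y} = {v a, v b}" "{a, b} \<in> chosen (csize n E \<circ> v)"
    using assms unfolding step_eq by blast
  have mem: "a \<in> {1..l}" "b \<in> {1..l}" using chosen_subset[OF ab(2)] by auto
  have "x = v a \<and> y = v b \<or> x = v b \<and> y = v a" using ab(1) by (auto simp: doubleton_eq_iff)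
  moreover have "{b, a} \<in> chosen (csize n E \<circ> v)" using ab(2) by (simp add: insert_commute)
  ultimately show ?thesis using mem ab(2) by blast
qed blast

lemma edges_on_step: "edges_on n (step n v E)"
  unfolding edges_on_def
proof
  fix e assume e: "e \<in> step n v E"
  show "e \<subseteq> {1..n}"
  proof (cases "e \<in> E")
    case True then show ?thesis using E by (auto simp: edges_on_def)
  next
    case False
    then obtain a b where ab: "e = {v a, v b}" "{a, b} \<in> chosen (csize n E \<circ> v)"
      using e unfolding step_eq by blast
    show ?thesis using chosen_subset[OF ab(2)] tuplesD[OF v] ab(1) by auto
  qed
qed

lemma component_untouched:
  assumes u: "u \<in> {1..n}" "u \<notin> touched n E v"
  shows "component n (step n v E) u = component n E u"
proof (rule antisym)
  have no: "v a \<notin> component n E u" if "a \<in> {1..l}" for a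
  proof
    assume "v a \<in> component n E u"
    then have "u \<in> component n E (v a)" by (rule component_sym[OF u(1)])
    then show False using u(2) that unfolding touched_def by blast
  qed
  show "component n (step n v E) u \<subseteq> component n E u"
  proof (rule component_closed)
    show "u \<in> component n E u" using u by simp
    fix x y assume x: "x \<in> component n E u" and e: "{x, y} \<in> step n v E"
    show "y \<in> component n E u"
      using new_edge[OF e]
    proof
      assume "{x, y} \<in> E" then show ?thesis by (rule component_edge[OF E x])
    qed (use no x in auto)
  qed
  show "component n E u \<subseteq> component n (step n v E) u" by (rule component_mono[OF step_mono])
qed

lemma component_touched:
  assumes u: "u \<in> touched n E v"
  shows "component n (step n v E) u \<subseteq> touched n E v"
proof (rule component_closed[OF u])
  fix x y assume x: "x \<in> touched n E v" and e: "{x, y} \<in> step n v E"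
  have "v b \<in> touched n E v" if "b \<in> {1..l}" for b
    using that tuplesD[OF v that] unfolding touched_def by (auto intro!: bexI[of _ b])
  moreover have "y \<in> touched n E v" if "{x, y} \<in> E"
  proof -
    from x obtain j where j: "j \<in> {1..l}" "x \<in> component n E (v j)" unfolding touched_def by blast
    have "y \<in> component n E (v j)" by (rule component_edge[OF E j(2) that])
    then show ?thesis using j(1) unfolding touched_def by blast
  qed
  ultimately show "y \<in> touched n E v" using new_edge[OF e] by auto
qed

lemma card_touched: "card (touched n E v) \<le> total n E v"
  unfolding touched_def total_def by (rule card_UN_le) simp

lemma finite_touched: "finite (touched n E v)" by (auto simp: touched_def)

lemma touched_subset: "touched n E v \<subseteq> {1..n}"
  using component_subset by (auto simp: touched_def)

lemma csize_step_le: "u \<in> touched n E v \<Longrightarrow> csize n (step n v E) u \<le> total n E v"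
  by (rule order.trans[OF card_mono[OF finite_touched component_touched] card_touched])

lemma csize_touched_le: "u \<in> touched n E v \<Longrightarrow> csize n E u \<le> total n E v"
  by (rule order.trans[OF csize_mono[OF step_mono] csize_step_le])

lemma sum_touched_le:
  fixes g :: "nat \<Rightarrow> real"
  assumes "\<And>u. u \<in> touched n E v \<Longrightarrow> 0 \<le> g (csize n E u)"
  shows "(\<Sum>u\<in>touched n E v. g (csize n E u)) \<le> (\<Sum>j\<in>{1..l}. real (csize n E (v j)) * g (csize n E (v j)))"
proof -
  have "(\<Sum>u\<in>touched n E v. g (csize n E u)) \<le> (\<Sum>j\<in>{1..l}. \<Sum>u\<in>component n E (v j). g (csize n E u))"
    unfolding touched_def
    by (rule sum_UNION_le) (use assms in \<open>auto simp: touched_def\<close>)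
  also have "\<dots> = (\<Sum>j\<in>{1..l}. real (csize n E (v j)) * g (csize n E (v j)))"
  proof (rule sum.cong[OF refl])
    fix j
    have "(\<Sum>u\<in>component n E (v j). g (csize n E u)) = (\<Sum>u\<in>component n E (v j). g (csize n E (v j)))"
      by (rule sum.cong[OF refl]) (simp only: component_cong)
    then show "(\<Sum>u\<in>component n E (v j). g (csize n E u)) = real (csize n E (v j)) * g (csize n E (v j))"
      by simp
  qed
  finally show ?thesis .
qed

lemma sum_split_touched:
  "(\<Sum>u\<in>{1..n}. g (csize n (step n v E) u)) - (\<Sum>u\<in>{1..n}. g (csize n E u))
    = (\<Sum>u\<in>touched n E v. g (csize n (step n v E) u) - g (csize n E u))" for g :: "nat \<Rightarrow> real"
  unfolding sum_subtractf[symmetric]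
  by (rule sum.mono_neutral_right) (use touched_subset component_untouched in auto)

text \<open>A touched vertex ends in a component of size at most \<open>total n E v\<close>. The touched vertices are
covered by the \<open>l\<close> chosen components, and since all increments are nonnegative it does no harm to
count a vertex several times when some of these components coincide.\<close>

lemma potential_increase:
  fixes \<phi> :: "nat \<Rightarrow> real"
  assumes "mono \<phi>"
  shows "(\<Sum>u\<in>{1..n}. \<phi> (csize n (step n v E) u)) - (\<Sum>u\<in>{1..n}. \<phi> (csize n E u))
    \<le> (\<Sum>j\<in>{1..l}. real (csize n E (v j)) * (\<phi> (total n E v) - \<phi> (csize n E (v j))))"
proof -
  have "(\<Sum>u\<in>touched n E v. \<phi> (csize n (step n v E) u) - \<phi> (csize n E u))
      \<le> (\<Sum>u\<in>touched n E v. \<phi> (total n E v) - \<phi> (csize n E u))"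
    by (intro sum_mono diff_right_mono monoD[OF assms] csize_step_le)
  also have "\<dots> \<le> (\<Sum>j\<in>{1..l}. real (csize n E (v j)) * (\<phi> (total n E v) - \<phi> (csize n E (v j))))"
    by (rule sum_touched_le) (simp add: monoD[OF assms] csize_touched_le)
  finally show ?thesis unfolding sum_split_touched .
qed

lemma N_eq_change_le:
  "\<bar>real (N_eq n (step n v E) k) - real (N_eq n E k)\<bar> \<le> real (total n E v)"
proof -
  have "\<bar>real (N_eq n (step n v E) k) - real (N_eq n E k)\<bar> 
    = \<bar>\<Sum>u\<in>touched n E v. of_bool (csize n (step n v E) u = k) - of_bool (csize n E u = k)\<bar>"
    unfolding N_eq_sum using sum_split_touched[of "\<lambda>c. of_bool (c = k)"] by simp
  also have "\<dots> \<le> (\<Sum>u\<in>touched n E v. 1)"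
    by (rule order.trans[OF sum_abs]) (intro sum_mono, auto simp: of_bool_def)
  also have "\<dots> \<le> real (total n E v)" using card_touched by simp
  finally show ?thesis .
qed

lemma separated_index:
  assumes "separated n E v" "i \<in> {1..l}" "j \<in> {1..l}" "u \<in> component n E (v i)" "u \<in> component n E (v j)"
  shows "i = j"
proof (rule ccontr)
  assume "i \<noteq> j"
  then have "v i \<notin> component n E (v j)" using assms by (auto simp: separated_def)
  moreover have "component n E (v i) = component n E (v j)"
    by (rule trans[OF component_cong[OF assms(4), symmetric] component_cong[OF assms(5)]])
  ultimately show False using self_in_component[OF tuplesD[OF v assms(2)], of E] by simp
qed

text \<open>The right-hand side is closed under the new edges because, for a separated tuple, a chosen vertex
\<open>v a\<close> in the component of \<open>v i\<close> can only be \<open>v i\<close> itself, with \<open>a = i\<close>.\<close>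

lemma component_step_separated:
  assumes sep: "separated n E v" and j: "j \<in> {1..l}" and u: "u \<in> component n E (v j)"
  shows "component n (step n v E) u = (\<Union>i\<in>group (csize n E \<circ> v) j. component n E (v i))"
    (is "_ = ?W")
proof (rule antisym)
  let ?c = "csize n E \<circ> v"
  have eo: "edges_on l (chosen ?c)" by (rule edges_on_chosen) (rule sizes_pos)
  have gr: "group ?c j \<subseteq> {1..l}" unfolding group_def by (rule component_subset)
  show "component n (step n v E) u \<subseteq> ?W"
  proof (rule component_closed)
    show "u \<in> ?W" using u j by (auto simp: group_def intro!: bexI[of _ j])
    fix x y assume x: "x \<in> ?W" and e: "{x, y} \<in> step n v E"
    then obtain i where i: "i \<in> group ?c j" "x \<in> component n E (v i)" by blast
    from new_edge[OF e] show "y \<in> ?W"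
    proof
      assume "{x, y} \<in> E"
      then have "y \<in> component n E (v i)" by (rule component_edge[OF E i(2)])
      then show ?thesis using i by blast
    next
      assume "\<exists>a\<in>{1..l}. \<exists>b\<in>{1..l}. {a, b} \<in> chosen ?c \<and> x = v a \<and> y = v b"
      then obtain a b where ab: "a \<in> {1..l}" "b \<in> {1..l}" "{a, b} \<in> chosen ?c" "x = v a" "y = v b" by blast
      have "a = i" using separated_index[OF sep ab(1) _ _ i(2)] ab(4) i gr tuplesD[OF v ab(1)] by auto
      then have "b \<in> group ?c j"
        using component_edge[OF eo, of i j b] i(1) ab(3) unfolding group_def by simp
      then show ?thesis using ab(2,5) tuplesD[OF v ab(2)] by (auto intro!: bexI[of _ b])
    qed
  qed
  have link: "v i \<in> component n (step n v E) (v j)" if "i \<in> group ?c j" for i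
  proof -
    have "(j, i) \<in> (adjacency (chosen ?c))\<^sup>*" using that by (simp add: group_def component_eq)
    then have "(v j, v i) \<in> (adjacency (step n v E))\<^sup>*"
    proof (induction rule: rtrancl_induct)
      case (step a b)
      have "v a = v b \<or> (v a, v b) \<in> adjacency (step n v E)"
        using step(2) by (auto simp: adjacency_def step_eq)
      then show ?case using step(3) by (auto intro: rtrancl_into_rtrancl)
    qed auto
    then show ?thesis using that gr tuplesD[OF v] by (auto simp: component_eq)
  qed
  have uj: "component n (step n v E) u = component n (step n v E) (v j)"
    by (rule component_cong) (rule subsetD[OF component_mono[OF step_mono] u])
  show "?W \<subseteq> component n (step n v E) u"
  proof
    fix w assume "w \<in> ?W"
    then obtain i where i: "i \<in> group ?c j" "w \<in> component n E (v i)" by blast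
    have "w \<in> component n (step n v E) (v i)" using component_mono[OF step_mono] i(2) by blast
    then show "w \<in> component n (step n v E) u" using component_cong[OF link[OF i(1)]] uj by simp
  qed
qed

lemma csize_step_separated:
  assumes sep: "separated n E v" and j: "j \<in> {1..l}" and u: "u \<in> component n E (v j)"
  shows "csize n (step n v E) u = new_size (csize n E \<circ> v) j"
proof -
  have gr: "group (csize n E \<circ> v) j \<subseteq> {1..l}" unfolding group_def by (rule component_subset)
  have "card (\<Union>i\<in>group (csize n E \<circ> v) j. component n E (v i))
    = (\<Sum>i\<in>group (csize n E \<circ> v) j. csize n E (v i))"
  proof (rule card_UN_disjoint)
    show "\<forall>i\<in>group (csize n E \<circ> v) j. \<forall>j'\<in>group (csize n E \<circ> v) j. i \<noteq> j' \<longrightarrow>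
        component n E (v i) \<inter> component n E (v j') = {}"
      using gr separated_index[OF sep] by blast
  qed (auto simp: group_def)
  then show ?thesis by (simp add: component_step_separated[OF assms] new_size_def)
qed

lemma N_eq_change_separated:
  assumes sep: "separated n E v"
  shows "real (N_eq n (step n v E) k) - real (N_eq n E k) = size_change (csize n E \<circ> v) k"
proof -
  have "real (N_eq n (step n v E) k) - real (N_eq n E k)
    = (\<Sum>u\<in>touched n E v. of_bool (csize n (step n v E) u = k) - of_bool (csize n E u = k))"
    unfolding N_eq_sum using sum_split_touched[of "\<lambda>c. of_bool (c = k)"] by simp
  also have "\<dots> = (\<Sum>j\<in>{1..l}. \<Sum>u\<in>component n E (v j).
      of_bool (csize n (step n v E) u = k) - of_bool (csize n E u = k))"
    unfolding touched_def
    by (rule sum.UNION_disjoint) (use separated_index[OF sep] in auto)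
  also have "\<dots> = size_change (csize n E \<circ> v) k"
    unfolding size_change_def
  proof (rule sum.cong[OF refl])
    fix j assume j: "j \<in> {1..l}"
    let ?c = "csize n E \<circ> v"
    have "(\<Sum>u\<in>component n E (v j). of_bool (csize n (step n v E) u = k) - of_bool (csize n E u = k))
      = (\<Sum>u\<in>component n E (v j). of_bool (new_size ?c j = k) - of_bool (?c j = k) :: real)"
    proof (rule sum.cong[OF refl])
      fix u assume u: "u \<in> component n E (v j)"
      show "of_bool (csize n (step n v E) u = k) - of_bool (csize n E u = k)
        = (of_bool (new_size ?c j = k) - of_bool (?c j = k) :: real)"
        unfolding csize_step_separated[OF sep j u] component_cong[OF u] by simp
    qed
    then show "(\<Sum>u\<in>component n E (v j). of_bool (csize n (step n v E) u = k) - of_bool (csize n E u = k))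
      = real (?c j) * (of_bool (new_size ?c j = k) - of_bool (?c j = k))" by simp
  qed
  finally show ?thesis .
qed

end

end

section \<open>Averages over vertices and tuples\<close>

context size_rule_process
begin

text \<open>Expectation over the \<open>l\<close> vertices chosen in one step; \<open>vavg\<close> is the expectation over a single
uniform vertex.\<close>

definition tavg :: "nat \<Rightarrow> ((nat \<Rightarrow> nat) \<Rightarrow> real) \<Rightarrow> real" where
  "tavg n F = (\<Sum>v\<in>tuples n. F v) / card (tuples n)"

definition vavg :: "nat \<Rightarrow> (nat \<Rightarrow> real) \<Rightarrow> real" where
  "vavg n g = (\<Sum>u\<in>{1..n}. g u) / n"

lemma tavg_mono: "(\<And>v. v \<in> tuples n \<Longrightarrow> F v \<le> G v) \<Longrightarrow> tavg n F \<le> tavg n G"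
  unfolding tavg_def by (intro divide_right_mono sum_mono) auto

lemma tavg_add: "tavg n (\<lambda>v. F v + G v) = tavg n F + tavg n G"
  by (simp add: tavg_def sum.distrib add_divide_distrib)

lemma tavg_diff: "tavg n (\<lambda>v. F v - G v) = tavg n F - tavg n G"
  by (simp add: tavg_def sum_subtractf diff_divide_distrib)

lemma tavg_cmult: "tavg n (\<lambda>v. a * F v) = a * tavg n F"
  by (simp add: tavg_def sum_distrib_left)

lemma tavg_const: "0 < n \<Longrightarrow> tavg n (\<lambda>_. a) = a"
  using tuples_nonempty[of n] by (simp add: tavg_def)

lemma tavg_sum: "tavg n (\<lambda>v. \<Sum>i\<in>I. F i v) = (\<Sum>i\<in>I. tavg n (F i))"
  unfolding tavg_def by (simp add: sum.swap[of _ I] sum_divide_distrib)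

lemma vavg_mono: "(\<And>u. u \<in> {1..n} \<Longrightarrow> f u \<le> g u) \<Longrightarrow> vavg n f \<le> vavg n g"
  unfolding vavg_def by (intro divide_right_mono sum_mono) auto

lemma vavg_nonneg: "(\<And>u. u \<in> {1..n} \<Longrightarrow> 0 \<le> f u) \<Longrightarrow> 0 \<le> vavg n f"
  unfolding vavg_def by (intro divide_nonneg_nonneg sum_nonneg) auto

lemma vavg_cmult: "vavg n (\<lambda>u. a * f u) = a * vavg n f"
  by (simp add: vavg_def sum_distrib_left)

lemma vavg_const: "0 < n \<Longrightarrow> vavg n (\<lambda>_. a) = a"
  by (simp add: vavg_def)

lemma susceptibility_vavg: "susceptibility n E = vavg n (\<lambda>u. real (csize n E u))"
  by (simp add: susceptibility_eq vavg_def)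

text \<open>Independence of the \<open>l\<close> choices.\<close>

lemma tavg_prod: "tavg n (\<lambda>v. \<Prod>j\<in>{1..l}. g j (v j)) = (\<Prod>j\<in>{1..l}. vavg n (g j))"
proof -
  have "(\<Prod>j\<in>{1..l}. \<Sum>u\<in>{1..n}. g j u) = (\<Sum>v\<in>tuples n. \<Prod>j\<in>{1..l}. g j (v j))"
    unfolding tuples_def by (rule prod_sum_PiE) auto
  then show ?thesis by (simp add: tavg_def vavg_def card_tuples prod_dividef)
qed

lemma tavg_one:
  assumes "0 < n" "j \<in> {1..l}"
  shows "tavg n (\<lambda>v. g (v j)) = vavg n g"
proof -
  have "(\<lambda>v. g (v j)) = (\<lambda>v. \<Prod>i\<in>{1..l}. (if i = j then g else (\<lambda>_. 1)) (v i))"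
    using assms by (auto simp: prod.remove[of _ j] intro!: ext)
  then have "tavg n (\<lambda>v. g (v j)) = (\<Prod>i\<in>{1..l}. vavg n (if i = j then g else (\<lambda>_. 1)))"
    using tavg_prod[of n "\<lambda>i. if i = j then g else (\<lambda>_. 1)"] by simp
  also have "\<dots> = vavg n g * (\<Prod>i\<in>{1..l}-{j}. vavg n (if i = j then g else (\<lambda>_. 1)))"
    using assms by (subst prod.remove[of _ j]) auto
  also have "(\<Prod>i\<in>{1..l}-{j}. vavg n (if i = j then g else (\<lambda>_. 1))) = 1"
    by (rule prod.neutral) (use assms in \<open>auto simp: vavg_const\<close>)
  finally show ?thesis by simp
qed

lemma tavg_one_others:
  assumes "j \<in> {1..l}"
  shows "tavg n (\<lambda>v. g (v j) * (\<Prod>i\<in>{1..l}-{j}. f (v i))) = vavg n g * vavg n f ^ (l - 1)"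
proof -
  have "(\<lambda>v. g (v j) * (\<Prod>i\<in>{1..l}-{j}. f (v i))) = (\<lambda>v. \<Prod>i\<in>{1..l}. (if i = j then g else f) (v i))"
    using assms by (auto simp: prod.remove[of _ j] intro!: ext prod.cong)
  then have "tavg n (\<lambda>v. g (v j) * (\<Prod>i\<in>{1..l}-{j}. f (v i))) = (\<Prod>i\<in>{1..l}. vavg n (if i = j then g else f))"
    using tavg_prod[of n "\<lambda>i. if i = j then g else f"] by simp
  also have "\<dots> = vavg n g * (\<Prod>i\<in>{1..l}-{j}. vavg n (if i = j then g else f))"
    using assms by (subst prod.remove[of _ j]) auto
  also have "(\<Prod>i\<in>{1..l}-{j}. vavg n (if i = j then g else f)) = (\<Prod>i\<in>{1..l}-{j}. vavg n f)"
    by (rule prod.cong) auto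
  finally show ?thesis using assms by simp
qed

lemma tavg_two:
  assumes "0 < n" "j \<in> {1..l}" "i \<in> {1..l}" "i \<noteq> j"
  shows "tavg n (\<lambda>v. g (v j) * f (v i)) = vavg n g * vavg n f"
proof -
  let ?G = "\<lambda>k. if k = j then g else if k = i then f else (\<lambda>_. 1)"
  have split: "(\<Prod>k\<in>{1..l}. P k) = P j * (P i * (\<Prod>k\<in>{1..l}-{j}-{i}. P k))" for P :: "nat \<Rightarrow> real"
    using assms by (subst prod.remove[of _ j], simp, simp, subst prod.remove[of _ i]) auto
  have "(\<Prod>k\<in>{1..l}-{j}-{i}. ?G k (v k)) = 1" for v
    by (rule prod.neutral) auto
  then have "(\<lambda>v. g (v j) * f (v i)) = (\<lambda>v. \<Prod>k\<in>{1..l}. ?G k (v k))"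
    using assms(4) by (simp only: split) auto
  then have "tavg n (\<lambda>v. g (v j) * f (v i)) = (\<Prod>k\<in>{1..l}. vavg n (?G k))"
    using tavg_prod[of n ?G] by simp
  also have "(\<Prod>k\<in>{1..l}-{j}-{i}. vavg n (?G k)) = 1"
    by (rule prod.neutral) (use assms(1) in \<open>auto simp: vavg_const\<close>)
  then have "(\<Prod>k\<in>{1..l}. vavg n (?G k)) = vavg n g * vavg n f"
    using assms(4) by (simp only: split) auto
  finally show ?thesis .
qed

lemma tavg_same_component:
  assumes "0 < n" "j \<in> {1..l}" "i \<in> {1..l}" "i \<noteq> j"
  shows "tavg n (\<lambda>v. of_bool (v i \<in> component n E (v j))) = susceptibility n E / n"
proof -
  have "tavg n (\<lambda>v. of_bool (v i \<in> component n E (v j)))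
    = tavg n (\<lambda>v. \<Sum>u\<in>{1..n}. of_bool (v j = u) * of_bool (v i \<in> component n E u))"
    unfolding tavg_def
  proof (intro arg_cong2[of _ _ _ _ "(/)"] sum.cong refl)
    fix v assume "v \<in> tuples n"
    then have vj: "v j \<in> {1..n}" using tuplesD assms by blast
    have "(\<Sum>u\<in>{1..n}. of_bool (v j = u) * of_bool (v i \<in> component n E u))
        = (\<Sum>u\<in>{1..n}. if u = v j then of_bool (v i \<in> component n E u) else (0::real))"
      by (intro sum.cong) auto
    then show "of_bool (v i \<in> component n E (v j))
      = (\<Sum>u\<in>{1..n}. of_bool (v j = u) * of_bool (v i \<in> component n E u) :: real)"
      using vj by simp
  qed
  also have "\<dots> = (\<Sum>u\<in>{1..n}. vavg n (\<lambda>w. of_bool (w = u)) * vavg n (\<lambda>w. of_bool (w \<in> component n E u)))"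
    unfolding tavg_sum by (intro sum.cong refl tavg_two assms)
  also have "\<dots> = (\<Sum>u\<in>{1..n}. (1 / n) * (real (csize n E u) / n))"
  proof (intro sum.cong refl arg_cong2[of _ _ _ _ "(*)"])
    fix u assume u: "u \<in> {1..n}"
    have "{1..n} \<inter> {w. w = u} = {u}" "{1..n} \<inter> component n E u = component n E u"
      using u component_subset by auto
    then show "vavg n (\<lambda>w. of_bool (w = u)) = 1 / n"
      "vavg n (\<lambda>w. of_bool (w \<in> component n E u)) = real (csize n E u) / n"
      by (simp_all only: vavg_def of_bool_def sum.If_cases[OF finite_atLeastAtMost] Collect_mem_eq) simp_all
  qed
  also have "\<dots> = susceptibility n E / n"
    by (simp add: susceptibility_eq sum_distrib_left[symmetric] sum_divide_distrib[symmetric])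
  finally show ?thesis .
qed

text \<open>Two given choices fall into the same component with probability \<open>S/n\<close>.\<close>

lemma tavg_not_separated:
  assumes "0 < n"
  shows "tavg n (\<lambda>v. of_bool (\<not> separated n E v)) \<le> real l ^ 2 * susceptibility n E / n"
proof -
  have S: "0 \<le> susceptibility n E" by (simp add: susceptibility_eq sum_nonneg)
  have "of_bool (\<not> separated n E v)
      \<le> (\<Sum>i\<in>{1..l}. \<Sum>j\<in>{1..l}. if i = j then 0 else of_bool (v i \<in> component n E (v j)) :: real)" for v
  proof (cases "separated n E v")
    case False
    then obtain i j where ij: "i \<in> {1..l}" "j \<in> {1..l}" "i \<noteq> j" "v i \<in> component n E (v j)"
      unfolding separated_def by blast
    have "(1::real) = (if i = j then 0 else of_bool (v i \<in> component n E (v j)))" using ij by simp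
    also have "\<dots> \<le> (\<Sum>j\<in>{1..l}. if i = j then 0 else of_bool (v i \<in> component n E (v j)))"
      by (rule member_le_sum) (use ij in auto)
    also have "\<dots> \<le> (\<Sum>i\<in>{1..l}. \<Sum>j\<in>{1..l}. if i = j then 0 else of_bool (v i \<in> component n E (v j)))"
      by (rule member_le_sum[where f = "\<lambda>i. \<Sum>j\<in>{1..l}. if i = j then 0 else of_bool (v i \<in> component n E (v j))"])
        (use ij in \<open>auto intro!: sum_nonneg\<close>)
    finally show ?thesis using False by simp
  qed (auto intro!: sum_nonneg)
  then have "tavg n (\<lambda>v. of_bool (\<not> separated n E v))
      \<le> (\<Sum>i\<in>{1..l}. \<Sum>j\<in>{1..l}. tavg n (\<lambda>v. if i = j then 0 else of_bool (v i \<in> component n E (v j))))"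
    unfolding tavg_sum[symmetric] by (rule tavg_mono)
  also have "\<dots> \<le> (\<Sum>i\<in>{1..l}. \<Sum>j\<in>{1..l}. susceptibility n E / n)"
  proof (intro sum_mono)
    fix i j assume "i \<in> {1..l}" "j \<in> {1..l}"
    then show "tavg n (\<lambda>v. if i = j then 0 else of_bool (v i \<in> component n E (v j))) \<le> susceptibility n E / n"
      using tavg_same_component[OF assms, of j i E] tavg_const[OF assms, of 0] S by (cases "i = j") auto
  qed
  finally show ?thesis by (simp add: power2_eq_square)
qed

lemma edges_on_graph: "set h \<subseteq> tuples n \<Longrightarrow> edges_on n (graph n h)"
proof (induction h rule: rev_induct)
  case Nil then show ?case by (simp add: edges_on_def)
next
  case (snoc v h) then show ?case by (simp add: edges_on_step)
qed

text \<open>Component sizes are truncated here in exponential moments. At rates \<open>x \<le> 1\<close> the weight of a vertex is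
then at most \<open>n powr (1/8)\<close>, and a single step changes the sum of all weights by at most
\<open>n powr (1/4)\<close> for large \<open>n\<close>, which is little enough for Azuma's inequality.\<close>

definition cap :: "nat \<Rightarrow> real" where "cap n = ln n / 8"

definition capped :: "nat \<Rightarrow> nat \<Rightarrow> real" where "capped n c = min (real c) (cap n)"

definition cexp :: "nat \<Rightarrow> real \<Rightarrow> nat \<Rightarrow> real" where
  "cexp n x c = exp (x * capped n c)"

text \<open>Truncated exponential moment of the size of the component of a random vertex.\<close>

definition cmgf :: "nat \<Rightarrow> real \<Rightarrow> edges \<Rightarrow> real" where
  "cmgf n x E = vavg n (\<lambda>u. cexp n x (csize n E u))"

lemma cap_nonneg: "0 \<le> cap n" by (cases "n = 0") (auto simp: cap_def)

lemma capped_nonneg [simp]: "0 \<le> capped n c"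
  using cap_nonneg by (simp add: capped_def)

lemma capped_le: "capped n c \<le> cap n" "capped n c \<le> real c"
  by (auto simp: capped_def)

lemma cexp_ge_1: "0 \<le> x \<Longrightarrow> 1 \<le> cexp n x c" by (simp add: cexp_def)

lemma cexp_pos [simp]: "0 < cexp n x c" by (simp add: cexp_def)

lemma cexp_mono_x: "x \<le> y \<Longrightarrow> cexp n x c \<le> cexp n y c"
  by (simp add: cexp_def mult_right_mono)

lemma mono_cexp: "0 \<le> x \<Longrightarrow> mono (cexp n x)"
  unfolding cexp_def capped_def by (intro monoI) (auto intro!: mult_left_mono)

lemma cmgf_mono_x: "x \<le> y \<Longrightarrow> cmgf n x E \<le> cmgf n y E"
  unfolding cmgf_def by (intro vavg_mono cexp_mono_x)

lemma cmgf_ge_1: "0 < n \<Longrightarrow> 0 \<le> x \<Longrightarrow> 1 \<le> cmgf n x E"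
  using vavg_mono[of n "\<lambda>_. 1" "\<lambda>u. cexp n x (csize n E u)"] cexp_ge_1
  by (simp add: cmgf_def vavg_const)

lemma capped_sum_le: "capped n (\<Sum>j\<in>I. c j) \<le> (\<Sum>j\<in>I. capped n (c j))" if "finite I"
  using that
proof (induction I rule: finite_induct)
  case empty then show ?case using cap_nonneg[of n] by (simp add: capped_def)
next
  case (insert i I)
  have "capped n (c i + (\<Sum>j\<in>I. c j)) \<le> capped n (c i) + capped n (\<Sum>j\<in>I. c j)"
    using cap_nonneg[of n] unfolding capped_def min_def of_nat_add
    by (auto simp del: of_nat_sum)
  then show ?case using insert by simp
qed

lemma cexp_total_le:
  assumes "0 \<le> x"
  shows "cexp n x (total n E v) \<le> (\<Prod>j\<in>{1..l}. cexp n x (csize n E (v j)))"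
proof -
  have "cexp n x (total n E v) \<le> exp (x * (\<Sum>j\<in>{1..l}. capped n (csize n E (v j))))"
    unfolding cexp_def total_def using assms by (auto intro!: mult_left_mono capped_sum_le)
  also have "\<dots> = (\<Prod>j\<in>{1..l}. cexp n x (csize n E (v j)))"
    by (simp add: cexp_def exp_sum sum_distrib_left)
  finally show ?thesis .
qed

lemma total_ge: "j \<in> {1..l} \<Longrightarrow> csize n E (v j) \<le> total n E v"
  unfolding total_def by (rule member_le_sum) auto

lemma cexp_growth_term:
  assumes "0 \<le> x" "j \<in> {1..l}"
  shows "real (csize n E (v j)) * (cexp n x (total n E v) - cexp n x (csize n E (v j)))
    \<le> capped n (csize n E (v j)) * (cexp n x (total n E v) - cexp n x (csize n E (v j)))"
proof (cases "real (csize n E (v j)) \<le> cap n")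
  case True then show ?thesis by (simp add: capped_def)
next
  case False
  then have "cexp n x (total n E v) = cexp n x (csize n E (v j))"
    using total_ge[OF assms(2), of n E v] by (simp add: cexp_def capped_def)
  then show ?thesis by simp
qed

text \<open>At a fixed rate \<open>x'\<close> a chosen vertex sees its weight multiplied by at most the product of the weights
of the other \<open>l - 1\<close> chosen vertices, because the truncation is subadditive. By independence the sum of
the weights grows on average by at most \<open>D * l * (u ^ (l - 1) - 1)\<close>, where \<open>u\<close> is the moment and
\<open>D\<close> the mean of size times weight. Raising the rate from \<open>x'\<close> to \<open>x\<close> adds at least \<open>n * (x - x') * D\<close>,
again a multiple of \<open>D\<close>, so that a small decrease of the rate compensates the growth.\<close>

lemma cmgf_drift:
  assumes n: "0 < n" and E: "edges_on n E" and x: "0 \<le> x'" "x' \<le> x"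
    and small: "real l * (cmgf n x' E ^ (l - 1) - 1) \<le> real n * (x - x')"
  shows "tavg n (\<lambda>v. real n * cmgf n x' (step n v E)) \<le> real n * cmgf n x E"
proof -
  let ?c = "csize n E"
  let ?D = "vavg n (\<lambda>u. capped n (?c u) * cexp n x' (?c u))"
  have D: "0 \<le> ?D" by (intro vavg_nonneg) (auto intro!: mult_nonneg_nonneg less_imp_le[OF cexp_pos])
  have nU: "real n * cmgf n y F = (\<Sum>u\<in>{1..n}. cexp n y (csize n F u))" for y F
    using n by (simp add: cmgf_def vavg_def)
  have "tavg n (\<lambda>v. real n * cmgf n x' (step n v E)) \<le> tavg n (\<lambda>v. real n * cmgf n x' E +
     (\<Sum>j\<in>{1..l}. capped n (?c (v j)) * cexp n x' (?c (v j)) * (\<Prod>i\<in>{1..l}-{j}. cexp n x' (?c (v i)))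
        - capped n (?c (v j)) * cexp n x' (?c (v j))))"
  proof (rule tavg_mono)
    fix v assume v: "v \<in> tuples n"
    have "real n * cmgf n x' (step n v E) - real n * cmgf n x' E
       \<le> (\<Sum>j\<in>{1..l}. real (?c (v j)) * (cexp n x' (total n E v) - cexp n x' (?c (v j))))"
      unfolding nU by (rule potential_increase[OF E v mono_cexp[OF x(1)]])
    also have "\<dots> \<le> (\<Sum>j\<in>{1..l}. capped n (?c (v j)) * (cexp n x' (total n E v) - cexp n x' (?c (v j))))"
      by (intro sum_mono cexp_growth_term x)
    also have "\<dots> \<le> (\<Sum>j\<in>{1..l}. capped n (?c (v j)) * ((\<Prod>i\<in>{1..l}. cexp n x' (?c (v i))) - cexp n x' (?c (v j))))"
      by (intro sum_mono mult_left_mono diff_right_mono cexp_total_le x) auto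
    also have "\<dots> = (\<Sum>j\<in>{1..l}. capped n (?c (v j)) * cexp n x' (?c (v j)) * (\<Prod>i\<in>{1..l}-{j}. cexp n x' (?c (v i)))
        - capped n (?c (v j)) * cexp n x' (?c (v j)))"
    proof (intro sum.cong refl)
      fix j assume j: "j \<in> {1..l}"
      have "(\<Prod>i\<in>{1..l}. cexp n x' (?c (v i))) = cexp n x' (?c (v j)) * (\<Prod>i\<in>{1..l}-{j}. cexp n x' (?c (v i)))"
        using j by (intro prod.remove) auto
      then show "capped n (?c (v j)) * ((\<Prod>i\<in>{1..l}. cexp n x' (?c (v i))) - cexp n x' (?c (v j)))
        = capped n (?c (v j)) * cexp n x' (?c (v j)) * (\<Prod>i\<in>{1..l}-{j}. cexp n x' (?c (v i)))
        - capped n (?c (v j)) * cexp n x' (?c (v j))"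
        by (simp add: algebra_simps)
    qed
    finally show "real n * cmgf n x' (step n v E) \<le> real n * cmgf n x' E + \<dots>" by linarith
  qed
  also have "\<dots> = real n * cmgf n x' E + (\<Sum>j\<in>{1..l}. ?D * cmgf n x' E ^ (l - 1) - ?D)"
  proof -
    have "tavg n (\<lambda>v. capped n (?c (v j)) * cexp n x' (?c (v j)) * (\<Prod>i\<in>{1..l}-{j}. cexp n x' (?c (v i)))
        - capped n (?c (v j)) * cexp n x' (?c (v j))) = ?D * cmgf n x' E ^ (l - 1) - ?D" if j: "j \<in> {1..l}" for j
      unfolding tavg_diff cmgf_def
      by (subst tavg_one_others[OF j, of n "\<lambda>u. capped n (?c u) * cexp n x' (?c u)" "\<lambda>u. cexp n x' (?c u)"],
          subst tavg_one[OF n j, of "\<lambda>u. capped n (?c u) * cexp n x' (?c u)"]) simp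
    then show ?thesis unfolding tavg_add tavg_sum tavg_const[OF n] by simp
  qed
  also have "\<dots> = real n * cmgf n x' E + ?D * (real l * (cmgf n x' E ^ (l - 1) - 1))"
    by (simp add: algebra_simps)
  also have "\<dots> \<le> real n * cmgf n x' E + ?D * (real n * (x - x'))"
    by (intro add_left_mono mult_left_mono small D)
  also have "\<dots> = (\<Sum>u\<in>{1..n}. cexp n x' (?c u) * (1 + (x - x') * capped n (?c u)))"
  proof -
    have "?D * real n = (\<Sum>u\<in>{1..n}. capped n (?c u) * cexp n x' (?c u))" using n by (simp add: vavg_def)
    then have "?D * (real n * (x - x')) = (\<Sum>u\<in>{1..n}. capped n (?c u) * cexp n x' (?c u)) * (x - x')"
      by (simp only: mult.assoc[symmetric])
    also have "\<dots> = (\<Sum>u\<in>{1..n}. cexp n x' (?c u) * ((x - x') * capped n (?c u)))"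
      unfolding sum_distrib_right by (intro sum.cong refl) (simp add: mult_ac)
    finally show ?thesis unfolding nU by (simp only: sum.distrib[symmetric] distrib_left mult_1_right)
  qed
  also have "\<dots> \<le> (\<Sum>u\<in>{1..n}. cexp n x (?c u))"
  proof (rule sum_mono)
    fix u
    have "cexp n x' (?c u) * (1 + (x - x') * capped n (?c u)) \<le> cexp n x' (?c u) * exp ((x - x') * capped n (?c u))"
      by (intro mult_left_mono exp_ge_add_one_self less_imp_le[OF cexp_pos])
    also have "\<dots> = cexp n x (?c u)" by (simp add: cexp_def exp_add[symmetric] algebra_simps)
    finally show "cexp n x' (?c u) * (1 + (x - x') * capped n (?c u)) \<le> cexp n x (?c u)" .
  qed
  finally show ?thesis unfolding nU .
qed

lemma cmgf_jump:
  assumes n: "0 < n" and E: "edges_on n E" and x: "0 \<le> x'" "x' \<le> x" "x \<le> 1"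
    and \<lambda>: "real n * (x - x') \<le> 1" and v: "v \<in> tuples n"
  shows "\<bar>real n * cmgf n x' (step n v E) - real n * cmgf n x E\<bar> \<le> (real l + 1) * cap n * exp (cap n)"
proof -
  let ?c = "csize n E" and ?e = "exp (cap n)"
  have nU: "real n * cmgf n y F = (\<Sum>u\<in>{1..n}. cexp n y (csize n F u))" for y F
    using n by (simp add: cmgf_def vavg_def)
  have e: "cexp n y c \<le> ?e" if "0 \<le> y" "y \<le> 1" for y c
    using mult_mono[of y 1 "capped n c" "cap n"] that capped_le(1)[of n c] by (simp add: cexp_def)
  have up: "real n * cmgf n x' (step n v E) - real n * cmgf n x' E \<le> real l * cap n * ?e"
  proof -
    have "real n * cmgf n x' (step n v E) - real n * cmgf n x' E
       \<le> (\<Sum>j\<in>{1..l}. real (?c (v j)) * (cexp n x' (total n E v) - cexp n x' (?c (v j))))"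
      unfolding nU by (rule potential_increase[OF E v mono_cexp[OF x(1)]])
    also have "\<dots> \<le> (\<Sum>j\<in>{1..l}. capped n (?c (v j)) * (cexp n x' (total n E v) - cexp n x' (?c (v j))))"
      by (intro sum_mono cexp_growth_term x)
    also have "\<dots> \<le> (\<Sum>j\<in>{1..l}. cap n * ?e)"
    proof (rule sum_mono)
      fix j assume j: "j \<in> {1..l}"
      have "cexp n x' (?c (v j)) \<le> cexp n x' (total n E v)"
        by (rule monoD[OF mono_cexp[OF x(1)] total_ge[OF j]])
      moreover have "cexp n x' (total n E v) - cexp n x' (?c (v j)) \<le> ?e"
        using e[of x' "total n E v"] x cexp_pos[of n x' "?c (v j)"] by linarith
      ultimately show "capped n (?c (v j)) * (cexp n x' (total n E v) - cexp n x' (?c (v j))) \<le> cap n * ?e"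
        by (intro mult_mono capped_le cap_nonneg) auto
    qed
    finally show ?thesis by simp
  qed
  have low: "0 \<le> real n * cmgf n x' (step n v E) - real n * cmgf n x' E"
    unfolding nU by (auto intro!: sum_mono monoD[OF mono_cexp[OF x(1)]] csize_mono step_mono)
  have "real n * cmgf n x E - real n * cmgf n x' E = (\<Sum>u\<in>{1..n}. cexp n x (?c u) - cexp n x' (?c u))"
    by (simp add: nU sum_subtractf)
  also have "\<dots> \<le> (\<Sum>u\<in>{1..n}. (x - x') * (cap n * ?e))"
  proof (rule sum_mono)
    fix u
    have "1 + (x' - x) * capped n (?c u) \<le> exp ((x' - x) * capped n (?c u))" by (rule exp_ge_add_one_self)
    then have "cexp n x (?c u) * (1 + (x' - x) * capped n (?c u)) \<le> cexp n x (?c u) * exp ((x' - x) * capped n (?c u))"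
      by (intro mult_left_mono less_imp_le[OF cexp_pos])
    also have "\<dots> = cexp n x' (?c u)" by (simp add: cexp_def exp_add[symmetric] algebra_simps)
    finally have "cexp n x (?c u) - cexp n x' (?c u) \<le> (x - x') * (capped n (?c u) * cexp n x (?c u))"
      by (simp add: algebra_simps)
    also have "\<dots> \<le> (x - x') * (cap n * ?e)"
      using x by (intro mult_left_mono mult_mono capped_le e cap_nonneg) (auto intro: less_imp_le[OF cexp_pos])
    finally show "cexp n x (?c u) - cexp n x' (?c u) \<le> (x - x') * (cap n * ?e)" .
  qed
  also have "\<dots> = (real n * (x - x')) * (cap n * ?e)" by simp
  also have "\<dots> \<le> 1 * (cap n * ?e)" by (intro mult_right_mono \<lambda>) (simp add: cap_nonneg)
  finally have dx: "real n * cmgf n x E - real n * cmgf n x' E \<le> cap n * ?e" by simp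
  have dx0: "0 \<le> real n * cmgf n x E - real n * cmgf n x' E"
    using cmgf_mono_x[OF x(2), of n E] by (simp add: mult_left_mono)
  have "0 \<le> cap n * ?e" "0 \<le> real l * cap n * ?e" using cap_nonneg by auto
  then show ?thesis using up low dx dx0 by (simp add: algebra_simps abs_le_iff)
qed

end

section \<open>Truncated exponential moments over short time windows\<close>

lemma exp_le_quadratic_exp:
  fixes y :: real assumes "0 \<le> y" shows "exp y \<le> 1 + y + y\<^sup>2 * exp y"
proof (cases "1 \<le> y")
  case True
  then have "1 * exp y \<le> y\<^sup>2 * exp y" by (intro mult_right_mono) auto
  then show ?thesis using assms by linarith
next
  case False
  have "1 - y \<le> exp (- y)" using exp_ge_add_one_self[of "- y"] by simp
  then have "exp y * (1 - y) \<le> exp y * exp (- y)" by (intro mult_left_mono) auto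
  then have "exp y * (1 - y) \<le> 1" by (simp add: exp_minus)
  then have "(1 + y) * (exp y * (1 - y)) \<le> (1 + y) * 1" using assms by (intro mult_left_mono) auto
  then show ?thesis by (simp add: algebra_simps power2_eq_square)
qed

lemma power_le_linear:
  fixes y :: real assumes "0 \<le> y" shows "(1 + y) ^ p - 1 \<le> real p * y * (1 + y) ^ p"
proof (induction p)
  case (Suc p)
  have "(1 + y) ^ Suc p - 1 = (1 + y) * ((1 + y) ^ p - 1) + y" by (simp add: algebra_simps)
  also have "\<dots> \<le> (1 + y) * (real p * y * (1 + y) ^ p) + y * (1 + y) ^ Suc p"
    using assms Suc one_le_power[of "1 + y" "Suc p"]
    by (intro add_mono mult_left_mono) (auto intro: mult_left_mono[of 1 _ y, simplified])
  also have "\<dots> = real (Suc p) * y * (1 + y) ^ Suc p" by (simp add: algebra_simps)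
  finally show ?case .
qed simp

context size_rule_process
begin

text \<open>To first order the moment at a small rate \<open>x\<close> is \<open>1 + x * S\<close>; the moment at rate \<open>x0\<close> controls the
second order term. In this way the bound on \<open>S\<close> replaces whatever constant \<open>A\<close> was lost before.\<close>

lemma cmgf_restart:
  assumes n: "0 < n" and x0: "0 < x0" and x: "0 \<le> x" "2 * x \<le> x0"
    and S: "susceptibility n E \<le> C" and U: "cmgf n x0 E \<le> A"
  shows "cmgf n x E \<le> 1 + x * C + 8 * A * x\<^sup>2 / x0\<^sup>2"
proof -
  let ?c = "csize n E"
  have "cexp n x c \<le> 1 + x * real c + 8 * x\<^sup>2 / x0\<^sup>2 * cexp n x0 c" for c
  proof -
    let ?m = "capped n c" and ?z = "x0 * capped n c / 2"
    have z: "0 \<le> ?z" using x0 by simp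
    have "?z\<^sup>2 \<le> 2 * exp ?z"
      using exp_lower_Taylor_quadratic[OF z] z by simp
    then have m2: "?m\<^sup>2 \<le> 8 / x0\<^sup>2 * exp ?z" using x0 by (simp add: field_simps power2_eq_square)
    have xm: "x * ?m \<le> ?z" using x mult_right_mono[of "2 * x" x0 ?m] by simp
    have "cexp n x c \<le> 1 + x * ?m + (x * ?m)\<^sup>2 * exp (x * ?m)"
      unfolding cexp_def by (rule exp_le_quadratic_exp) (use x in simp)
    also have "(x * ?m)\<^sup>2 * exp (x * ?m) \<le> x\<^sup>2 * (8 / x0\<^sup>2 * exp ?z) * exp ?z"
      unfolding power_mult_distrib by (intro mult_mono mult_left_mono m2) (use xm in auto)
    also have "\<dots> = 8 * x\<^sup>2 / x0\<^sup>2 * cexp n x0 c"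
      by (simp add: cexp_def exp_add[symmetric] mult.assoc)
    also have "x * ?m \<le> x * real c" by (intro mult_left_mono capped_le x)
    finally show ?thesis by simp
  qed
  then have "cmgf n x E \<le> vavg n (\<lambda>u. 1 + x * real (?c u) + 8 * x\<^sup>2 / x0\<^sup>2 * cexp n x0 (?c u))"
    unfolding cmgf_def by (intro vavg_mono)
  also have "\<dots> = 1 + x * susceptibility n E + 8 * x\<^sup>2 / x0\<^sup>2 * cmgf n x0 E"
  proof -
    have "vavg n (\<lambda>u. F u + G u) = vavg n F + vavg n G" for F G
      by (simp add: vavg_def sum.distrib add_divide_distrib)
    then show ?thesis using n by (simp only: cmgf_def susceptibility_vavg vavg_cmult vavg_const)
  qed
  also have "\<dots> \<le> 1 + x * C + 8 * x\<^sup>2 / x0\<^sup>2 * A"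
    by (intro add_mono mult_left_mono S U x) auto
  finally show ?thesis by (simp add: mult_ac)
qed

text \<open>Here \<open>p\<close> stands for \<open>l - 1\<close>. The factor \<open>q\<close>, slightly above \<open>1\<close>, is the relative slack in all
estimates: the moment starts below \<open>1 + q * C * x\<close> and is followed while it is at most
\<open>1 + q\<^sup>2 * C * x\<close>, and the rate decreases at speed \<open>l * p * q ^ 3 * C * x\<close> per unit of time. Over time
\<open>w\<close> it loses at most \<open>x / q\<close> and so remains positive.\<close>

lemma window_constants:
  fixes w C A x0 :: real and p :: nat
  assumes w: "0 \<le> w" "w * real l * real p * C < 1" and C: "1 \<le> C" and A: "1 \<le> A" and x0: "0 < x0" "x0 \<le> 1"
  shows "\<exists>q>1. \<exists>x>0. 2 * x \<le> x0 \<and> real l * real p * q ^ 3 * C * x \<le> 1 \<and> q * (w * real l * real p * q ^ 3 * C) \<le> 1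
     \<and> (1 + q\<^sup>2 * C * x) ^ p \<le> q \<and> 8 * A * x / x0\<^sup>2 \<le> (q - 1) * C"
proof -
  let ?g = "w * real l * real p * C"
  have "((\<lambda>q::real. q ^ 4 * ?g) \<longlongrightarrow> 1 ^ 4 * ?g) (at_right 1)" by (intro tendsto_intros)
  then have "\<forall>\<^sub>F q::real in at_right 1. q ^ 4 * ?g < 1" using w by (intro order_tendstoD(2)) auto
  moreover have "\<forall>\<^sub>F q::real in at_right 1. 1 < q" by (simp add: eventually_at_filter)
  ultimately have "\<forall>\<^sub>F q::real in at_right 1. 1 < q \<and> q ^ 4 * ?g < 1" by eventually_elim auto
  then obtain q :: real where q: "1 < q" "q ^ 4 * ?g < 1"
    using eventually_happens'[of "at_right (1::real)"] by (auto simp: trivial_limit_at_right_real)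
  have "((\<lambda>x::real. (1 + q\<^sup>2 * C * x) ^ p) \<longlongrightarrow> (1 + q\<^sup>2 * C * 0) ^ p) (at_right 0)" by (intro tendsto_intros)
  then have e1: "\<forall>\<^sub>F x::real in at_right 0. (1 + q\<^sup>2 * C * x) ^ p < q" using q by (intro order_tendstoD(2)) auto
  have "((\<lambda>x::real. 8 * A * x / x0\<^sup>2) \<longlongrightarrow> 8 * A * 0 / x0\<^sup>2) (at_right 0)" using x0 by (intro tendsto_intros) auto
  then have e2: "\<forall>\<^sub>F x::real in at_right 0. 8 * A * x / x0\<^sup>2 < (q - 1) * C" using q C by (intro order_tendstoD(2)) auto
  have "((\<lambda>x::real. real l * real p * q ^ 3 * C * x) \<longlongrightarrow> real l * real p * q ^ 3 * C * 0) (at_right 0)" by (intro tendsto_intros)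
  then have e3: "\<forall>\<^sub>F x::real in at_right 0. real l * real p * q ^ 3 * C * x < 1" by (intro order_tendstoD(2)) auto
  have "((\<lambda>x::real. 2 * x) \<longlongrightarrow> 2 * 0) (at_right 0)" by (intro tendsto_intros)
  then have e4: "\<forall>\<^sub>F x::real in at_right 0. 2 * x < x0" using x0 by (intro order_tendstoD(2)) auto
  have e5: "\<forall>\<^sub>F x::real in at_right 0. 0 < x" by (simp add: eventually_at_filter)
  have "\<forall>\<^sub>F x::real in at_right 0. 0 < x \<and> 2 * x \<le> x0 \<and> real l * real p * q ^ 3 * C * x \<le> 1 
      \<and> (1 + q\<^sup>2 * C * x) ^ p \<le> q \<and> 8 * A * x / x0\<^sup>2 \<le> (q - 1) * C"
    using e1 e2 e3 e4 e5 by eventually_elim auto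
  then obtain x :: real where "0 < x \<and> 2 * x \<le> x0 \<and> real l * real p * q ^ 3 * C * x \<le> 1 
      \<and> (1 + q\<^sup>2 * C * x) ^ p \<le> q \<and> 8 * A * x / x0\<^sup>2 \<le> (q - 1) * C"
    using eventually_happens'[of "at_right (0::real)"] by (auto simp: trivial_limit_at_right_real)
  moreover have "q * (w * real l * real p * q ^ 3 * C) \<le> 1"
    using q by (simp add: power_numeral_reduce mult_ac)
  ultimately show ?thesis using q by blast
qed

text \<open>Crossing one time window. Nothing but the state at its beginning is used, and the constants depend
on \<open>C\<close> only through \<open>w * l * (l - 1) * C < 1\<close>; for \<open>C = 1\<close> this is the condition that yields the lower
bound \<open>1 / (l * (l - 1))\<close> for the critical time.\<close>

lemma cmgf_window:
  assumes w: "0 \<le> w" "w * real l * (real l - 1) * C < 1" and C: "1 \<le> C" and A: "1 \<le> A"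
    and x0: "0 < x0" "x0 \<le> 1"
  shows "\<exists>x1. 0 < x1 \<and> x1 \<le> x0 \<and> (\<exists>A1. \<forall>\<^sub>F n in sequentially. \<forall>m h0. set h0 \<subseteq> tuples n \<longrightarrow> real m \<le> w * real n \<longrightarrow>
    susceptibility n (graph n h0) \<le> C \<longrightarrow> cmgf n x0 (graph n h0) \<le> A \<longrightarrow>
    uniform_prob (tuples n) m (\<lambda>h. \<exists>i\<le>m. A1 < cmgf n x1 (graph n (h0 @ take i h))) \<le> real n powr (-102))"
proof -
  define p where "p = l - 1"
  have pl: "real p = real l - 1" using l2 by (simp add: p_def of_nat_diff)
  obtain q x where q: "1 < q" and x: "0 < x" "2 * x \<le> x0" and lam1: "real l * real p * q ^ 3 * C * x \<le> 1"
    and qw: "q * (w * real l * real p * q ^ 3 * C) \<le> 1" and pq: "(1 + q\<^sup>2 * C * x) ^ p \<le> q"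
    and A8: "8 * A * x / x0\<^sup>2 \<le> (q - 1) * C"
    using window_constants[of w p C A x0] assms pl by auto
  define \<kappa> where "\<kappa> = real l * real p * q ^ 3 * C * x"
  define y where "y = q\<^sup>2 * C * x"
  define gap where "gap = (q\<^sup>2 - q) * C * x"
  \<comment> \<open>A lower bound for the rate throughout the window.\<close>
  define x1 where "x1 = x - x / q"
  have y0: "0 \<le> y" using q C x by (simp add: y_def)
  have gap0: "0 < gap" using q C x by (auto simp: gap_def power2_eq_square intro!: mult_pos_pos)
  have \<kappa>0: "0 \<le> \<kappa>" using q C x by (simp add: \<kappa>_def)
  have x1: "0 < x1" using q x by (simp add: x1_def field_simps)
  have "0 \<le> x / q" using q x by simp
  then have x1_le: "x1 \<le> x0" using x by (simp add: x1_def)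
  have x_le1: "x \<le> 1" using x x0 by linarith
  have w\<kappa>: "w * \<kappa> \<le> x / q"
  proof -
    have "q * (w * \<kappa>) = q * (w * real l * real p * q ^ 3 * C) * x" by (simp add: \<kappa>_def mult_ac)
    also have "\<dots> \<le> 1 * x" using qw x by (intro mult_right_mono) auto
    finally show ?thesis using q by (simp add: field_simps)
  qed
  have key: "real l * ((1 + y) ^ p - 1) \<le> \<kappa>"
  proof -
    have "(1 + y) ^ p - 1 \<le> real p * y * (1 + y) ^ p" by (rule power_le_linear[OF y0])
    also have "\<dots> \<le> real p * y * q" using pq y0 by (intro mult_left_mono) (auto simp: y_def)
    finally have "real l * ((1 + y) ^ p - 1) \<le> real l * (real p * y * q)" by (intro mult_left_mono) auto
    then show ?thesis by (simp add: \<kappa>_def y_def power_numeral_reduce mult_ac)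
  qed
  have ev1: "\<forall>\<^sub>F n in sequentially. (real l + 1) * (ln (real n) / 8) * exp (ln (real n) / 8) \<le> real n powr (1/4)"
    by real_asymp
  have ev2: "\<forall>\<^sub>F n in sequentially. exp (w - gap * real n powr (1/4)) \<le> real n powr (-102)"
    using gap0 by real_asymp
  have "\<forall>\<^sub>F n in sequentially. \<forall>m h0. set h0 \<subseteq> tuples n \<longrightarrow> real m \<le> w * real n \<longrightarrow>
    susceptibility n (graph n h0) \<le> C \<longrightarrow> cmgf n x0 (graph n h0) \<le> A \<longrightarrow>
    uniform_prob (tuples n) m (\<lambda>h. \<exists>i\<le>m. 1 + y < cmgf n x1 (graph n (h0 @ take i h))) \<le> real n powr (-102)"
    using ev1 ev2 eventually_gt_at_top[of 0]
  proof eventually_elim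
    case (elim n)
    then have n: "0 < n" by simp
    show ?case
    proof (intro allI impI)
      fix m h0 assume h0: "set h0 \<subseteq> tuples n" and m: "real m \<le> w * real n"
        and S: "susceptibility n (graph n h0) \<le> C" and U: "cmgf n x0 (graph n h0) \<le> A"
      \<comment> \<open>The rate after \<open>k\<close> steps, moving along the characteristic.\<close>
      define X where "X k = x - \<kappa> / real n * real k" for k :: nat
      define age where "age h = length h - length h0" for h :: "(nat \<Rightarrow> nat) list"
      define f where "f h = real n * cmgf n (X (age h)) (graph n h)" for h
      define good where "good h \<longleftrightarrow> length h0 \<le> length h \<and> f h \<le> real n * (1 + y)" for h
      have X: "x1 \<le> X k" "X k \<le> x" if "k \<le> m" for k
      proof -
        have "\<kappa> / real n * real k \<le> \<kappa> / real n * (w * real n)"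
          using that m \<kappa>0 by (intro mult_left_mono) auto
        also have "\<dots> = w * \<kappa>" using n by simp
        finally show "x1 \<le> X k" using w\<kappa> by (simp add: X_def x1_def)
        show "X k \<le> x" using \<kappa>0 by (simp add: X_def)
      qed
      have Xdiff: "real n * (X k - X (Suc k)) = \<kappa>" for k
        using n by (simp add: X_def field_simps)
      have Xdec: "X (Suc k) \<le> X k" for k using \<kappa>0 n by (simp add: X_def divide_right_mono mult_left_mono)
      have f0: "f h0 \<le> real n * (1 + q * C * x)"
      proof -
        have "cmgf n x (graph n h0) \<le> 1 + x * C + 8 * A * x\<^sup>2 / x0\<^sup>2"
          by (rule cmgf_restart[OF n x0(1) _ _ S U]) (use x in auto)
        also have "8 * A * x\<^sup>2 / x0\<^sup>2 \<le> (q - 1) * C * x"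
          using mult_right_mono[OF A8, of x] x by (simp add: power2_eq_square mult_ac)
        finally have "cmgf n x (graph n h0) \<le> 1 + q * C * x" by (simp add: algebra_simps)
        then show ?thesis by (simp add: f_def age_def X_def mult_left_mono)
      qed
      have age_snoc: "age (h @ [v]) = Suc (age h)" if "length h0 \<le> length h" for h v
        using that by (simp add: age_def Suc_diff_le)
      have drift: "(\<Sum>v\<in>tuples n. f (h @ [v])) / card (tuples n) \<le> f h"
        if h: "set h \<subseteq> tuples n" "length h < length h0 + m" "good h" for h
      proof -
        have len: "length h0 \<le> length h" and fh: "f h \<le> real n * (1 + y)" using h(3) by (auto simp: good_def)
        have agem: "Suc (age h) \<le> m" using h(2) len by (simp add: age_def)
        have Xp: "0 \<le> X (Suc (age h))" using X(1)[OF agem] x1 by linarith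
        have "cmgf n (X (Suc (age h))) (graph n h) \<le> cmgf n (X (age h)) (graph n h)"
          by (rule cmgf_mono_x[OF Xdec])
        also have "\<dots> \<le> 1 + y" using fh n by (simp add: f_def)
        finally have "cmgf n (X (Suc (age h))) (graph n h) ^ (l - 1) \<le> (1 + y) ^ (l - 1)"
          using cmgf_ge_1[OF n Xp, of "graph n h"] by (intro power_mono) auto
        then have "real l * (cmgf n (X (Suc (age h))) (graph n h) ^ (l - 1) - 1) \<le> real l * ((1 + y) ^ (l - 1) - 1)"
          by (intro mult_left_mono) auto
        also have "\<dots> \<le> real n * (X (age h) - X (Suc (age h)))" using key by (simp add: Xdiff p_def)
        finally have "tavg n (\<lambda>v. real n * cmgf n (X (Suc (age h))) (step n v (graph n h)))
          \<le> real n * cmgf n (X (age h)) (graph n h)"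
          by (intro cmgf_drift[OF n edges_on_graph[OF h(1)] Xp Xdec])
        then show ?thesis using len by (simp add: tavg_def f_def age_snoc)
      qed
      have jump: "\<bar>f (h @ [v]) - f h\<bar> \<le> real n powr (1/4)"
        if h: "set h \<subseteq> tuples n" "length h < length h0 + m" "good h" and v: "v \<in> tuples n" for h v
      proof -
        have len: "length h0 \<le> length h" using h(3) by (auto simp: good_def)
        have agem: "Suc (age h) \<le> m" using h(2) len by (simp add: age_def)
        have Xp: "0 \<le> X (Suc (age h))" using X(1)[OF agem] x1 by linarith
        have "\<bar>real n * cmgf n (X (Suc (age h))) (step n v (graph n h)) - real n * cmgf n (X (age h)) (graph n h)\<bar>
          \<le> (real l + 1) * cap n * exp (cap n)"
          by (rule cmgf_jump[OF n edges_on_graph[OF h(1)] Xp Xdec _ _ v])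
            (use X(2)[of "age h"] agem x_le1 lam1 in \<open>auto simp: Xdiff \<kappa>_def\<close>)
        also have "\<dots> \<le> real n powr (1/4)" using elim(1) by (simp add: cap_def)
        finally show ?thesis using len by (simp add: f_def age_snoc)
      qed
      have "uniform_prob (tuples n) m (\<lambda>h. \<exists>i\<le>m. 1 + y < cmgf n x1 (graph n (h0 @ take i h)))
        \<le> uniform_prob (tuples n) m (\<lambda>h. \<exists>i\<le>m. (\<forall>j<i. good (h0 @ take j h)) \<and> f h0 + real n * gap \<le> f (h0 @ take i h))"
      proof (rule uniform_prob_mono)
        fix h assume h: "h \<in> hists (tuples n) m" and "\<exists>i\<le>m. 1 + y < cmgf n x1 (graph n (h0 @ take i h))"
        then obtain i where i: "i \<le> m" "1 + y < cmgf n x1 (graph n (h0 @ take i h))" by blast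
        have "\<not> f (h0 @ take i h) \<le> real n * (1 + y)"
        proof -
          have "age (h0 @ take i h) = i" using h i by (simp add: age_def)
          moreover have "1 + y < cmgf n (X i) (graph n (h0 @ take i h))"
            using i(2) cmgf_mono_x[OF X(1)[OF i(1)], of n "graph n (h0 @ take i h)"] by linarith
          ultimately show ?thesis using n by (simp add: f_def)
        qed
        then obtain k where k: "\<not> f (h0 @ take k h) \<le> real n * (1 + y)" "k \<le> i"
          and least: "\<And>j. j < k \<Longrightarrow> f (h0 @ take j h) \<le> real n * (1 + y)"
          using ex_least_nat_le[of "\<lambda>k. \<not> f (h0 @ take k h) \<le> real n * (1 + y)" i] by auto
        have "f h0 + real n * gap \<le> real n * (1 + y)"
          using f0 by (simp add: gap_def y_def algebra_simps)
        then have "f h0 + real n * gap \<le> f (h0 @ take k h)" using k(1) by linarith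
        moreover have "good (h0 @ take j h)" if "j < k" for j
          using least[OF that] by (simp add: good_def)
        ultimately show "\<exists>i\<le>m. (\<forall>j<i. good (h0 @ take j h)) \<and> f h0 + real n * gap \<le> f (h0 @ take i h)"
          using k(2) i(1) by (intro exI[of _ k]) auto
      qed
      \<comment> \<open>With jumps of size \<open>n powr (1/4)\<close> the choice \<open>\<theta> = n powr (-3/4)\<close> makes the quadratic term
         bounded, while the linear term is still a positive power of \<open>n\<close>.\<close>
      also have "\<dots> \<le> exp (real m * (real n powr (-3/4) * real n powr (1/4))\<^sup>2 - real n powr (-3/4) * (real n * gap))"
        by (rule azuma_inequality[OF _ tuples_nonempty[OF n] drift jump _ _ _ h0])
          (use n powr_mono[of "-1/2" 0 "real n"] in \<open>auto simp: powr_add[symmetric]\<close>)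
      also have "real m * (real n powr (-3/4) * real n powr (1/4))\<^sup>2 - real n powr (-3/4) * (real n * gap)
        \<le> w - gap * real n powr (1/4)"
      proof -
        have "(real n powr (-3/4) * real n powr (1/4))\<^sup>2 = real n powr (-3/4 + 1/4 + (-3/4 + 1/4))"
          by (simp only: powr_add power2_eq_square)
        then have "(real n powr (-3/4) * real n powr (1/4))\<^sup>2 = 1 / real n"
          using n by (simp add: powr_minus_divide)
        moreover have "real n powr (-3/4) * real n = real n powr (1/4)"
          using n powr_add[of "real n" "-3/4" 1] by simp
        moreover have "real m * (1 / real n) \<le> w" using m n by (simp add: field_simps)
        ultimately show ?thesis by (simp add: mult.assoc[symmetric] mult.commute[of gap])
      qed
      also have "exp (w - gap * real n powr (1/4)) \<le> real n powr (-102)" by (rule elim(2))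
      finally show "uniform_prob (tuples n) m (\<lambda>h. \<exists>i\<le>m. 1 + y < cmgf n x1 (graph n (h0 @ take i h))) \<le> real n powr (-102)"
        by simp
    qed
  qed
  then show ?thesis using x1 x1_le by blast
qed

text \<open>The susceptibility is required to be bounded only up to time \<open>t\<close>, although \<open>i\<close> may be a later
step: this is what allows conclusions beyond \<open>t\<close>.\<close>

definition subcritical_before :: "nat \<Rightarrow> real \<Rightarrow> real \<Rightarrow> (nat \<Rightarrow> nat) list \<Rightarrow> nat \<Rightarrow> bool" where
  "subcritical_before n t C h i \<longleftrightarrow> (\<forall>j<i. real j \<le> t * real n \<longrightarrow> susceptibility n (graph n (take j h)) \<le> C)"

text \<open>It is unlikely that the truncated moment, at some fixed rate, gets large before time \<open>\<tau>\<close> while the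
process is subcritical.\<close>

definition cmgf_controlled :: "real \<Rightarrow> real \<Rightarrow> real \<Rightarrow> bool" where
  "cmgf_controlled t C \<tau> \<longleftrightarrow> (\<exists>x A Q. 0 < x \<and> x \<le> 1 \<and> 1 \<le> A \<and>
    (\<forall>\<^sub>F n in sequentially. uniform_prob (tuples n) (nat \<lfloor>\<tau> * real n\<rfloor>)
       (\<lambda>h. \<exists>i\<le>nat \<lfloor>\<tau> * real n\<rfloor>. subcritical_before n t C h i \<and> A < cmgf n x (graph n (take i h)))
     \<le> Q * real n powr (-102)))"

lemma cmgf_controlled_0: "cmgf_controlled t C 0"
proof -
  have "uniform_prob (tuples n) 0 (\<lambda>h. \<exists>i\<le>0. subcritical_before n t C h i \<and> exp 1 < cmgf n 1 (graph n (take i h))) \<le> 0 * real n powr (-102)"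
    if "0 < n" for n
  proof -
    have "cmgf n 1 {} \<le> vavg n (\<lambda>u. exp 1)"
      unfolding cmgf_def by (rule vavg_mono) (use capped_le(2)[of n 1] in \<open>auto simp: cexp_def\<close>)
    then show ?thesis using that by (simp add: vavg_const)
  qed
  then have "\<forall>\<^sub>F n in sequentially. uniform_prob (tuples n) (nat \<lfloor>0 * real n\<rfloor>)
       (\<lambda>h. \<exists>i\<le>nat \<lfloor>0 * real n\<rfloor>. subcritical_before n t C h i \<and> exp 1 < cmgf n 1 (graph n (take i h)))
     \<le> 0 * real n powr (-102)"
    using eventually_mono[OF eventually_gt_at_top[of "0::nat"]] by (simp only: mult_zero_left floor_zero nat_zero_as_int)
  moreover have "(1::real) \<le> exp 1" by simp
  ultimately show ?thesis unfolding cmgf_controlled_def by (intro exI[of _ 1] exI[of _ "exp 1"] exI[of _ 0]) auto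
qed

text \<open>A violation either occurs already before the new window begins, or the window starts
with bounded susceptibility and bounded moment, so that \<open>cmgf_window\<close> applies to the restarted
process.\<close>

lemma cmgf_controlled_step:
  assumes ctrl: "cmgf_controlled t C \<tau>" and \<tau>: "0 \<le> \<tau>" "\<tau> \<le> t" and C: "1 \<le> C"
    and w: "0 \<le> w" "w * real l * (real l - 1) * C < 1"
  shows "cmgf_controlled t C (\<tau> + w)"
proof -
  obtain x0 A Q where x0: "0 < x0" "x0 \<le> 1" "1 \<le> A"
    and ev0: "\<forall>\<^sub>F n in sequentially. uniform_prob (tuples n) (nat \<lfloor>\<tau> * real n\<rfloor>)
       (\<lambda>h. \<exists>i\<le>nat \<lfloor>\<tau> * real n\<rfloor>. subcritical_before n t C h i \<and> A < cmgf n x0 (graph n (take i h)))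
     \<le> Q * real n powr (-102)"
    using ctrl unfolding cmgf_controlled_def by blast
  obtain w' where w': "w < w'" "w' * real l * (real l - 1) * C < 1"
  proof -
    have pos: "0 < real l * (real l - 1) * C" using l2 C by auto
    define d where "d = (1 - w * real l * (real l - 1) * C) / (2 * (real l * (real l - 1) * C))"
    have "0 < d" using w pos by (simp add: d_def)
    moreover have "(w + d) * real l * (real l - 1) * C = w * real l * (real l - 1) * C + d * (real l * (real l - 1) * C)"
      by (simp add: algebra_simps)
    moreover have "d * (real l * (real l - 1) * C) = (1 - w * real l * (real l - 1) * C) / 2"
    proof -
      have "P * 0 < P * 1 \<Longrightarrow> (1 - g) / (2 * P) * P = (1 - g) / 2" for P g :: real by simp
      from this[of "real l * (real l - 1) * C"] show ?thesis using pos unfolding d_def by simp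
    qed
    ultimately have "(w + d) * real l * (real l - 1) * C
        = w * real l * (real l - 1) * C + (1 - w * real l * (real l - 1) * C) / 2" by simp
    also have "\<dots> < 1" using w(2) by (simp add: field_simps)
    finally show ?thesis using \<open>0 < d\<close> that[of "w + d"] by simp
  qed
  obtain x1 A1 where x1: "0 < x1" "x1 \<le> x0"
    and ev1: "\<forall>\<^sub>F n in sequentially. \<forall>m h0. set h0 \<subseteq> tuples n \<longrightarrow> real m \<le> w' * real n \<longrightarrow>
    susceptibility n (graph n h0) \<le> C \<longrightarrow> cmgf n x0 (graph n h0) \<le> A \<longrightarrow>
    uniform_prob (tuples n) m (\<lambda>h. \<exists>i\<le>m. A1 < cmgf n x1 (graph n (h0 @ take i h))) \<le> real n powr (-102)"
    using cmgf_window[of w' C A x0] w w' C x0 by auto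
  have ev2: "\<forall>\<^sub>F n in sequentially. 1 \<le> (w' - w) * real n" using w' by real_asymp
  have "\<forall>\<^sub>F n in sequentially. uniform_prob (tuples n) (nat \<lfloor>(\<tau> + w) * real n\<rfloor>)
       (\<lambda>h. \<exists>i\<le>nat \<lfloor>(\<tau> + w) * real n\<rfloor>. subcritical_before n t C h i \<and> max A A1 < cmgf n x1 (graph n (take i h)))
     \<le> (Q + 1) * real n powr (-102)"
    using ev0 ev1 ev2 eventually_gt_at_top[of 0]
  proof eventually_elim
    case (elim n)
    then have n: "0 < n" by simp
    define a where "a = nat \<lfloor>\<tau> * real n\<rfloor>"
    define b where "b = nat \<lfloor>(\<tau> + w) * real n\<rfloor> - a"
    have ab: "nat \<lfloor>(\<tau> + w) * real n\<rfloor> = a + b"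
      using w by (auto simp: a_def b_def intro!: nat_mono floor_mono mult_right_mono le_add_diff_inverse[symmetric])
    have a_t: "real a \<le> t * real n"
    proof -
      have "real a \<le> \<tau> * real n" using \<tau> by (simp add: a_def)
      also have "\<dots> \<le> t * real n" using \<tau> by (intro mult_right_mono) auto
      finally show ?thesis .
    qed
    have bw: "real b \<le> w' * real n"
    proof -
      have "real (a + b) \<le> (\<tau> + w) * real n" unfolding ab[symmetric] using \<tau> w by simp
      moreover have "\<tau> * real n - 1 \<le> real a" using \<tau> by (simp add: a_def)
      ultimately show ?thesis using elim(3) by (simp add: algebra_simps)
    qed
    let ?V = "tuples n"
    let ?B = "\<lambda>i h. subcritical_before n t C h i \<and> max A A1 < cmgf n x1 (graph n (take i h))"
    let ?Q1 = "\<lambda>h. \<exists>i\<le>a. subcritical_before n t C h i \<and> A < cmgf n x0 (graph n (take i h))"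
    let ?Q2 = "\<lambda>h. susceptibility n (graph n (take a h)) \<le> C \<and> cmgf n x0 (graph n (take a h)) \<le> A \<and>
       (\<exists>i\<le>b. A1 < cmgf n x1 (graph n (take a h @ take i (drop a h))))"
    have "uniform_prob ?V (a + b) (\<lambda>h. \<exists>i\<le>a + b. ?B i h) \<le> uniform_prob ?V (a + b) (\<lambda>h. ?Q1 (take a h) \<or> ?Q2 h)"
    proof (rule uniform_prob_mono)
      fix h assume h: "h \<in> hists ?V (a + b)" and "\<exists>i\<le>a + b. ?B i h"
      then obtain i where i: "i \<le> a + b" "?B i h" by blast
      have A: "A < cmgf n x0 (graph n (take i h))"
        using i(2) cmgf_mono_x[OF x1(2), of n "graph n (take i h)"] by simp
      have before: "subcritical_before n t C (take a h) k" if "subcritical_before n t C h k" "k \<le> a" for k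
        using that unfolding subcritical_before_def by (auto simp: min_absorb1)
      show "?Q1 (take a h) \<or> ?Q2 h"
      proof (cases "i \<le> a")
        case True
        then have "?Q1 (take a h)" using i(2) A before[of i] by (intro exI[of _ i]) (auto simp: min_absorb1)
        then show ?thesis ..
      next
        case False
        then have S: "susceptibility n (graph n (take a h)) \<le> C"
          using i(2) a_t unfolding subcritical_before_def by auto
        show ?thesis
        proof (cases "cmgf n x0 (graph n (take a h)) \<le> A")
          case True
          have "take a h @ take (i - a) (drop a h) = take i h"
            using False take_add[of a "i - a" h] by simp
          then have "?Q2 h" using i S True False by (intro conjI exI[of _ "i - a"]) auto
          then show ?thesis ..
        next
          case nA: False
          have "subcritical_before n t C h a" using i(2) False unfolding subcritical_before_def by auto
          then have "?Q1 (take a h)" using nA before[of a] by (intro exI[of _ a]) auto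
          then show ?thesis ..
        qed
      qed
    qed
    also have "\<dots> \<le> uniform_prob ?V (a + b) (\<lambda>h. ?Q1 (take a h)) + uniform_prob ?V (a + b) ?Q2" by (rule uniform_prob_disj)
    also have "uniform_prob ?V (a + b) (\<lambda>h. ?Q1 (take a h)) = uniform_prob ?V a ?Q1"
      by (rule uniform_prob_take[OF finite_tuples tuples_nonempty[OF n]])
    also have "uniform_prob ?V a ?Q1 \<le> Q * real n powr (-102)" using elim(1) by (simp add: a_def)
    also have "uniform_prob ?V (a + b) ?Q2 \<le> real n powr (-102)"
    proof (rule uniform_prob_restart[OF finite_tuples tuples_nonempty[OF n]])
      fix h0 assume h0: "h0 \<in> hists ?V a"
      show "uniform_prob ?V b (\<lambda>h. ?Q2 (h0 @ h)) \<le> real n powr (-102)"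
      proof (cases "susceptibility n (graph n h0) \<le> C \<and> cmgf n x0 (graph n h0) \<le> A")
        case True
        have "uniform_prob ?V b (\<lambda>h. ?Q2 (h0 @ h)) \<le> uniform_prob ?V b (\<lambda>h. \<exists>i\<le>b. A1 < cmgf n x1 (graph n (h0 @ take i h)))"
          using h0 by (intro uniform_prob_mono) auto
        also have "\<dots> \<le> real n powr (-102)" using elim(2) h0 bw True by auto
        finally show ?thesis .
      next
        case False
        then have "uniform_prob ?V b (\<lambda>h. ?Q2 (h0 @ h)) = uniform_prob ?V b (\<lambda>_. False)" using h0 by (intro uniform_prob_cong) auto
        then show ?thesis by (simp add: uniform_prob_False)
      qed
    qed
    finally show ?case unfolding ab by (simp add: distrib_right)
  qed
  moreover have "0 < x1 \<and> x1 \<le> 1 \<and> 1 \<le> max A A1" using x1 x0 by auto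
  ultimately show ?thesis unfolding cmgf_controlled_def by blast
qed

text \<open>The windows used up to time \<open>t\<close> all have the same length; the last one starts exactly at \<open>t\<close>.\<close>

lemma cmgf_controlled_all:
  assumes t: "0 \<le> t" and C: "1 \<le> C" and w: "0 \<le> w" "w * real l * (real l - 1) * C < 1"
  shows "cmgf_controlled t C (t + w)"
proof -
  define M where "M = nat \<lceil>t * (real l * (real l - 1) * C)\<rceil> + 1"
  have M: "0 < M" "t * (real l * (real l - 1) * C) < real M" by (auto simp: M_def) linarith
  define w0 where "w0 = t / real M"
  have w0: "0 \<le> w0" "w0 * real l * (real l - 1) * C < 1" using t M by (auto simp: w0_def field_simps)
  have "cmgf_controlled t C (real r * w0)" if "r \<le> M" for r
    using that
  proof (induction r)
    case 0 then show ?case using cmgf_controlled_0 by simp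
  next
    case (Suc r)
    have "real r * w0 \<le> real M * w0" using Suc.prems w0 by (intro mult_right_mono) auto
    also have "\<dots> = t" using M by (simp add: w0_def)
    finally have "cmgf_controlled t C (real r * w0 + w0)"
      using Suc w0 C by (intro cmgf_controlled_step) auto
    then show ?case by (simp add: algebra_simps)
  qed
  from this[of M] have "cmgf_controlled t C t" using M by (simp add: w0_def)
  then show ?thesis using t C w by (intro cmgf_controlled_step) auto
qed

end

section \<open>Largest component and exponential tails\<close>

context size_rule_process
begin

text \<open>A weight that is constant up to size \<open>K\<close> and then grows like a power. It is used with \<open>\<beta>\<close> and \<open>K\<close> both of
order \<open>log n\<close>. Then increasing a size \<open>c \<ge> K\<close> by a small amount \<open>s\<close> costs a factor of at most
\<open>exp (\<beta> * s / K)\<close>, as for an exponential weight, but a merger of \<open>l\<close> large components only costs a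
factor \<open>l powr \<beta>\<close>, a small power of \<open>n\<close>. Under an exponential weight it would multiply their
weights.\<close>

definition hpow :: "real \<Rightarrow> real \<Rightarrow> nat \<Rightarrow> real" where
  "hpow K \<beta> c = (max (real c) K / K) powr \<beta>"

lemma hpow_pos: "0 < K \<Longrightarrow> 0 < hpow K \<beta> c" by (auto simp: hpow_def)

lemma mono_hpow: "0 < K \<Longrightarrow> 0 \<le> \<beta> \<Longrightarrow> mono (hpow K \<beta>)"
  unfolding hpow_def by (intro monoI powr_mono2 divide_right_mono) auto

lemma hpow_add_le:
  assumes K: "0 < K" and \<beta>: "0 \<le> \<beta>"
  shows "hpow K \<beta> (c + d) \<le> hpow K \<beta> c * exp (\<beta> * real d / max (real c) K)"
proof -
  let ?m = "max (real c) K"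
  have m: "0 < ?m" using K by simp
  have "max (real (c + d)) K / K \<le> ?m / K * (1 + real d / ?m)"
  proof -
    have "max (real (c + d)) K \<le> ?m + real d" by auto
    also have "\<dots> = ?m * (1 + real d / ?m)" using m by (simp add: field_simps)
    finally show ?thesis using K by (simp add: divide_right_mono)
  qed
  also have "\<dots> \<le> ?m / K * exp (real d / ?m)"
    using K m by (intro mult_left_mono exp_ge_add_one_self) auto
  finally have "hpow K \<beta> (c + d) \<le> (?m / K * exp (real d / ?m)) powr \<beta>"
    unfolding hpow_def using K \<beta> by (intro powr_mono2) auto
  also have "\<dots> = hpow K \<beta> c * exp (\<beta> * real d / ?m)"
  proof -
    have "(?m / K * exp (real d / ?m)) powr \<beta> = (?m / K) powr \<beta> * exp (real d / ?m) powr \<beta>"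
      by (rule powr_mult)
    also have "exp (real d / ?m) powr \<beta> = exp (\<beta> * real d / ?m)" by (simp add: powr_def)
    finally show ?thesis by (simp add: hpow_def)
  qed
  finally show ?thesis .
qed

lemma hpow_scale_le:
  assumes K: "0 < K" and \<beta>: "0 \<le> \<beta>" and a: "1 \<le> a" "real d \<le> a * real c"
  shows "hpow K \<beta> d \<le> a powr \<beta> * hpow K \<beta> c"
proof -
  have "max (real d) K \<le> a * max (real c) K"
  proof -
    have "a * real c \<le> a * max (real c) K" using a by (intro mult_left_mono) auto
    moreover have "1 * K \<le> a * max (real c) K" using a K by (intro mult_mono) auto
    ultimately show ?thesis using a by linarith
  qed
  then have "max (real d) K / K \<le> a * (max (real c) K / K)" using K by (simp add: divide_right_mono)
  then have "hpow K \<beta> d \<le> (a * (max (real c) K / K)) powr \<beta>"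
    unfolding hpow_def using K \<beta> by (intro powr_mono2) auto
  also have "\<dots> = a powr \<beta> * hpow K \<beta> c" unfolding hpow_def by (rule powr_mult)
  finally show ?thesis .
qed

text \<open>Let \<open>c i\<close> be the largest of the sizes. If another one exceeds \<open>K\<close>, two large components collide: the
weight of every touched vertex is crudely bounded by \<open>l powr \<beta>\<close> times that of \<open>v i\<close>, and the second sum
retains the indicator of this rare event. Otherwise the component of \<open>v i\<close> grows by small amounts only, which
gives the first sum.\<close>

lemma hpow_growth:
  fixes c :: "nat \<Rightarrow> nat" and T :: nat
  assumes K: "0 < K" and \<beta>: "0 < \<beta>" and M: "\<And>j. j \<in> {1..l} \<Longrightarrow> real (c j) \<le> M"
    and T: "T = (\<Sum>j\<in>{1..l}. c j)" and y: "y = \<beta> / K"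
  shows "(\<Sum>j\<in>{1..l}. real (c j) * (hpow K \<beta> T - hpow K \<beta> (c j)))
    \<le> (\<Sum>i\<in>{1..l}. (1 + \<beta>) / y * (hpow K \<beta> (c i) * (\<Prod>j\<in>{1..l}-{i}. exp (2 * y * min (real (c j)) K))))
      + (\<Sum>i\<in>{1..l}. \<Sum>j\<in>{1..l}-{i}. real l * M * real l powr \<beta> * (hpow K \<beta> (c i) * of_bool (K < real (c j))))"
    (is "?L \<le> ?A + ?B")
proof -
  let ?h = "hpow K \<beta>"
  have y0: "0 < y" using K \<beta> y by simp
  have h0: "0 \<le> ?h d" for d using hpow_pos[OF K, of \<beta> d] by simp
  have M0: "0 \<le> M" using M[of 1] l2 by auto
  have A0: "0 \<le> (1 + \<beta>) / y * (?h (c i) * (\<Prod>j\<in>{1..l}-{i}. exp (2 * y * min (real (c j)) K)))" for i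
    using \<beta> y0 h0 by (intro mult_nonneg_nonneg prod_nonneg) auto
  have B0: "0 \<le> real l * M * real l powr \<beta> * (?h (c i) * of_bool (K < real (c j)))" for i j
    using M0 h0 by (intro mult_nonneg_nonneg) auto
  have Asum: "0 \<le> ?A" by (intro sum_nonneg A0)
  have Bsum: "0 \<le> ?B" by (intro sum_nonneg B0)
  have "finite (c ` {1..l})" "c ` {1..l} \<noteq> {}" using l2 by auto
  from Max_in[OF this] obtain i where i: "i \<in> {1..l}" "c i = Max (c ` {1..l})" by auto
  have mx: "c j \<le> c i" if "j \<in> {1..l}" for j using that i(2) by simp
  define O' where "O' = (\<Sum>j\<in>{1..l}-{i}. c j)"
  have TO: "T = c i + O'" unfolding T O'_def using i by (subst sum.remove[of _ i]) auto
  show ?thesis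
  proof (cases "\<exists>j\<in>{1..l}-{i}. K < real (c j)")
    case True
    then obtain j where j: "j \<in> {1..l}-{i}" "K < real (c j)" by blast
    have Tl: "T \<le> l * c i" unfolding T using sum_bounded_above[of "{1..l}" c "c i"] mx by simp
    have "?L \<le> (\<Sum>j\<in>{1..l}. real (c j) * ?h T)"
      using h0 by (intro sum_mono mult_left_mono) auto
    also have "\<dots> = real T * ?h T" by (simp add: T sum_distrib_right)
    also have "\<dots> \<le> (real l * M) * (real l powr \<beta> * ?h (c i))"
    proof (rule mult_mono)
      have "real T \<le> real l * real (c i)" using Tl by (metis of_nat_le_iff of_nat_mult)
      also have "\<dots> \<le> real l * M" using M[OF i(1)] by (intro mult_left_mono) auto
      finally show "real T \<le> real l * M" .
      show "?h T \<le> real l powr \<beta> * ?h (c i)"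
        using Tl l2 \<beta> by (intro hpow_scale_le K) (auto simp flip: of_nat_mult)
    qed (use M0 h0 in auto)
    also have "\<dots> = real l * M * real l powr \<beta> * (?h (c i) * of_bool (K < real (c j)))"
      using j by simp
    also have "\<dots> \<le> (\<Sum>j\<in>{1..l}-{i}. real l * M * real l powr \<beta> * (?h (c i) * of_bool (K < real (c j))))"
      by (rule member_le_sum[OF j(1), where f = "\<lambda>j. real l * M * real l powr \<beta> * (?h (c i) * of_bool (K < real (c j)))"])
        (use B0 in auto)
    also have "\<dots> \<le> ?B"
      by (rule member_le_sum[OF i(1), where f = "\<lambda>i. \<Sum>j\<in>{1..l}-{i}. real l * M * real l powr \<beta> * (?h (c i) * of_bool (K < real (c j)))"])
        (use B0 in \<open>auto intro!: sum_nonneg\<close>)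
    finally show ?thesis using Asum by linarith
  next
    case False
    then have small: "real (c j) \<le> K" if "j \<in> {1..l}-{i}" for j using that by (meson not_le)
    let ?m = "max (real (c i)) K"
    have m: "0 < ?m" "K \<le> ?m" "real (c i) \<le> ?m" using K by auto
    have e: "\<beta> * real O' / ?m \<le> y * real O'"
    proof -
      have "\<beta> * real O' / ?m \<le> \<beta> * real O' / K" using m K \<beta> by (intro divide_left_mono) auto
      then show ?thesis by (simp add: y)
    qed
    let ?e = "exp (y * real O')"
    have hT: "?h T \<le> ?h (c i) * exp (\<beta> * real O' / ?m)" unfolding TO using K \<beta> by (intro hpow_add_le) auto
    also have "\<dots> \<le> ?h (c i) * ?e" using e h0 by (intro mult_left_mono) auto
    finally have hT': "?h T \<le> ?h (c i) * ?e" .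
    have "?L = real (c i) * (?h T - ?h (c i)) + (\<Sum>j\<in>{1..l}-{i}. real (c j) * (?h T - ?h (c j)))"
      using i by (subst sum.remove[of _ i]) auto
    also have "(\<Sum>j\<in>{1..l}-{i}. real (c j) * (?h T - ?h (c j))) \<le> (\<Sum>j\<in>{1..l}-{i}. real (c j) * ?h T)"
      using h0 by (intro sum_mono mult_left_mono) auto
    also have "\<dots> = real O' * ?h T" by (simp add: O'_def sum_distrib_right)
    also have "\<dots> \<le> real O' * (?h (c i) * ?e)" by (intro mult_left_mono hT') auto
    also have "real (c i) * (?h T - ?h (c i)) \<le> ?h (c i) * (\<beta> * real O' * ?e)"
    proof -
      let ?z = "\<beta> * real O' / ?m"
      have z: "0 \<le> ?z" using \<beta> m by auto
      have "exp ?z - 1 \<le> ?z * exp ?z"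
      proof -
        have "1 - ?z \<le> exp (- ?z)" using exp_ge_add_one_self[of "- ?z"] by simp
        then have "exp ?z * (1 - ?z) \<le> exp ?z * exp (- ?z)" by (intro mult_left_mono) auto
        then show ?thesis by (simp add: exp_minus algebra_simps)
      qed
      then have "?h (c i) * (exp ?z - 1) \<le> ?h (c i) * (?z * exp ?z)" using h0 by (intro mult_left_mono)
      then have "?h T - ?h (c i) \<le> ?h (c i) * (?z * exp ?z)" using hT by (simp add: algebra_simps)
      then have "real (c i) * (?h T - ?h (c i)) \<le> real (c i) * (?h (c i) * (?z * exp ?z))"
        by (intro mult_left_mono) auto
      also have "\<dots> = ?h (c i) * ((real (c i) * ?z) * exp ?z)" by simp
      also have "\<dots> \<le> ?h (c i) * ((\<beta> * real O') * ?e)"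
      proof (rule mult_left_mono[OF mult_mono h0])
        have "real (c i) * ?z \<le> ?m * ?z" using m z by (intro mult_right_mono) auto
        also have "\<dots> = \<beta> * real O'" using m by simp
        finally show "real (c i) * ?z \<le> \<beta> * real O'" .
      qed (use e \<beta> in auto)
      finally show ?thesis by simp
    qed
    also have "?h (c i) * (\<beta> * real O' * ?e) + real O' * (?h (c i) * ?e) = ?h (c i) * ((1 + \<beta>) * (real O' * ?e))"
      by (simp add: algebra_simps)
    also have "\<dots> \<le> ?h (c i) * ((1 + \<beta>) * (1 / y * exp (2 * y * real O')))"
    proof (intro mult_left_mono h0)
      have "y * real O' \<le> ?e" using exp_ge_add_one_self[of "y * real O'"] by linarith
      then have "real O' \<le> ?e / y" using y0 by (simp add: field_simps)
      then have "real O' * ?e \<le> ?e / y * ?e" by (intro mult_right_mono) auto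
      also have "\<dots> = 1 / y * exp (2 * y * real O')" by (simp add: exp_add[symmetric])
      finally show "real O' * ?e \<le> 1 / y * exp (2 * y * real O')" .
    qed (use \<beta> in auto)
    also have "exp (2 * y * real O') = (\<Prod>j\<in>{1..l}-{i}. exp (2 * y * min (real (c j)) K))"
    proof -
      have "exp (2 * y * real O') = (\<Prod>j\<in>{1..l}-{i}. exp (2 * y * real (c j)))"
        by (simp add: O'_def exp_sum[symmetric] sum_distrib_left)
      also have "\<dots> = (\<Prod>j\<in>{1..l}-{i}. exp (2 * y * min (real (c j)) K))"
        using small by (intro prod.cong refl) (simp add: min_absorb1)
      finally show ?thesis .
    qed
    also have "?h (c i) * ((1 + \<beta>) * (1 / y * (\<Prod>j\<in>{1..l}-{i}. exp (2 * y * min (real (c j)) K))))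
      = (1 + \<beta>) / y * (?h (c i) * (\<Prod>j\<in>{1..l}-{i}. exp (2 * y * min (real (c j)) K)))" by simp
    also have "\<dots> \<le> ?A"
      by (rule member_le_sum[OF i(1), where f = "\<lambda>i. (1 + \<beta>) / y * (?h (c i) * (\<Prod>j\<in>{1..l}-{i}. exp (2 * y * min (real (c j)) K)))"])
        (use A0 in auto)
    finally show ?thesis using Bsum by linarith
  qed
qed

text \<open>By Markov's inequality only a fraction \<open>n powr (- x / 8)\<close> of the vertices, up to a constant, lies in
components above the truncation; this makes collisions of two such components rare.\<close>

lemma fraction_big_le:
  assumes n: "0 < n" and x: "0 \<le> x" and U: "cmgf n x E \<le> A"
  shows "vavg n (\<lambda>u. of_bool (cap n < real (csize n E u))) \<le> A * exp (- x * cap n)"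
proof -
  have "exp (x * cap n) * of_bool (cap n < real c) \<le> cexp n x c" for c
    using x by (auto simp: cexp_def capped_def)
  then have "vavg n (\<lambda>u. exp (x * cap n) * of_bool (cap n < real (csize n E u))) \<le> cmgf n x E"
    unfolding cmgf_def by (intro vavg_mono)
  then have "exp (x * cap n) * vavg n (\<lambda>u. of_bool (cap n < real (csize n E u))) \<le> A"
    unfolding vavg_cmult using U by linarith
  then show ?thesis by (simp add: exp_minus field_simps)
qed

lemma hpow_drift:
  assumes n: "0 < n" and E: "edges_on n E" and x: "0 < x" and U: "cmgf n x E \<le> A"
    and K: "0 < cap n" and \<beta>: "0 < \<beta>" and y: "2 * (\<beta> / cap n) \<le> x"
    and M: "\<And>u. u \<in> {1..n} \<Longrightarrow> real (csize n E u) \<le> M"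
  shows "tavg n (\<lambda>v. real n * vavg n (\<lambda>u. hpow (cap n) \<beta> (csize n (step n v E) u)))
    \<le> (1 + (real l * ((1 + \<beta>) / (\<beta> / cap n)) * A ^ (l - 1)
         + real l ^ 3 * M * real l powr \<beta> * (A * exp (- x * cap n))) / n)
       * (real n * vavg n (\<lambda>u. hpow (cap n) \<beta> (csize n E u)))"
proof -
  let ?K = "cap n" and ?c = "csize n E"
  let ?h = "hpow ?K \<beta>"
  define y' where "y' = \<beta> / ?K"
  define H where "H = vavg n (\<lambda>u. ?h (?c u))"
  define F where "F = vavg n (\<lambda>u. of_bool (?K < real (?c u)) :: real)"
  have h0: "0 \<le> ?h d" for d using hpow_pos[OF K, of \<beta> d] by simp
  have H0: "0 \<le> H" unfolding H_def by (intro vavg_nonneg h0)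
  have M0: "0 \<le> M" using M[of 1] n by auto
  have y'0: "0 < y'" using K \<beta> by (simp add: y'_def)
  have "tavg n (\<lambda>v. real n * vavg n (\<lambda>u. ?h (csize n (step n v E) u))) \<le> tavg n (\<lambda>v. real n * H +
    ((\<Sum>i\<in>{1..l}. (1 + \<beta>) / y' * (?h (?c (v i)) * (\<Prod>j\<in>{1..l}-{i}. exp (2 * y' * min (real (?c (v j))) ?K))))
      + (\<Sum>i\<in>{1..l}. \<Sum>j\<in>{1..l}-{i}. real l * M * real l powr \<beta> * (?h (?c (v i)) * of_bool (?K < real (?c (v j)))))))"
  proof (rule tavg_mono)
    fix v assume v: "v \<in> tuples n"
    have "(\<Sum>u\<in>{1..n}. ?h (csize n (step n v E) u)) - (\<Sum>u\<in>{1..n}. ?h (?c u))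
       \<le> (\<Sum>j\<in>{1..l}. real (?c (v j)) * (?h (total n E v) - ?h (?c (v j))))"
      using K \<beta> by (intro potential_increase[OF E v mono_hpow]) auto
    also have "\<dots> \<le> ((\<Sum>i\<in>{1..l}. (1 + \<beta>) / y' * (?h (?c (v i)) * (\<Prod>j\<in>{1..l}-{i}. exp (2 * y' * min (real (?c (v j))) ?K))))
      + (\<Sum>i\<in>{1..l}. \<Sum>j\<in>{1..l}-{i}. real l * M * real l powr \<beta> * (?h (?c (v i)) * of_bool (?K < real (?c (v j))))))"
      by (rule hpow_growth[OF K \<beta>]) (use M tuplesD[OF v] in \<open>auto simp: total_def y'_def\<close>)
    finally show "real n * vavg n (\<lambda>u. ?h (csize n (step n v E) u)) \<le> real n * H + \<dots>"
      using n unfolding H_def vavg_def by simp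
  qed
  also have "\<dots> = real n * H + ((\<Sum>i\<in>{1..l}. (1 + \<beta>) / y' * (H * cmgf n (2 * y') E ^ (l - 1)))
      + (\<Sum>i\<in>{1..l}. \<Sum>j\<in>{1..l}-{i}. real l * M * real l powr \<beta> * (H * F)))"
  proof -
    have "tavg n (\<lambda>v. ?h (?c (v i)) * (\<Prod>j\<in>{1..l}-{i}. exp (2 * y' * min (real (?c (v j))) ?K)))
      = H * cmgf n (2 * y') E ^ (l - 1)" if "i \<in> {1..l}" for i
      using tavg_one_others[OF that, of n "\<lambda>u. ?h (?c u)" "\<lambda>u. exp (2 * y' * min (real (?c u)) ?K)"]
      by (simp add: H_def cmgf_def cexp_def capped_def)
    moreover have "tavg n (\<lambda>v. ?h (?c (v i)) * of_bool (?K < real (?c (v j)))) = H * F"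
      if "i \<in> {1..l}" "j \<in> {1..l}-{i}" for i j
      using tavg_two[OF n that(1), of j "\<lambda>u. ?h (?c u)" "\<lambda>u. of_bool (?K < real (?c u))"] that
      by (simp add: H_def F_def)
    ultimately show ?thesis
      unfolding tavg_add tavg_const[OF n] tavg_sum tavg_cmult by simp
  qed
  also have "\<dots> \<le> real n * H + ((\<Sum>i\<in>{1..l}. (1 + \<beta>) / y' * (H * A ^ (l - 1)))
      + (\<Sum>i\<in>{1..l}. \<Sum>j\<in>{1..l}. real l * M * real l powr \<beta> * (H * (A * exp (- x * ?K)))))"
  proof (intro add_left_mono add_mono sum_mono order.trans[OF sum_mono sum_mono2])
    fix i j
    have "cmgf n (2 * y') E \<le> A" using cmgf_mono_x[OF y, of n E] U by (simp add: y'_def)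
    then show "(1 + \<beta>) / y' * (H * cmgf n (2 * y') E ^ (l - 1)) \<le> (1 + \<beta>) / y' * (H * A ^ (l - 1))"
      using cmgf_ge_1[OF n, of "2 * y'" E] y'0 \<beta> H0 by (intro mult_left_mono power_mono) auto
    show "real l * M * real l powr \<beta> * (H * F) \<le> real l * M * real l powr \<beta> * (H * (A * exp (- x * ?K)))"
      using fraction_big_le[OF n _ U] x H0 M0 by (intro mult_left_mono) (auto simp: F_def)
    show "0 \<le> real l * M * real l powr \<beta> * (H * (A * exp (- x * ?K)))"
      using M0 H0 cmgf_ge_1[OF n, of x E] U x by (intro mult_nonneg_nonneg) auto
  qed auto
  also have "\<dots> = real n * H + (real l * ((1 + \<beta>) / y') * A ^ (l - 1)
         + real l ^ 3 * M * real l powr \<beta> * (A * exp (- x * cap n))) * H"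
    by (simp add: algebra_simps power3_eq_cube)
  also have "\<dots> = (1 + (real l * ((1 + \<beta>) / y') * A ^ (l - 1)
         + real l ^ 3 * M * real l powr \<beta> * (A * exp (- x * cap n))) / n) * (real n * H)"
  proof -
    have "real n * H + Z * H = (1 + Z / real n) * (real n * H)" for Z using n by (simp add: field_simps)
    then show ?thesis .
  qed
  finally show ?thesis unfolding H_def y'_def .
qed

text \<open>While the truncated moment is bounded, the weighted sum grows by a factor of at most
\<open>1 + \<Gamma> * log n / n\<close> per step, hence by a fixed power of \<open>n\<close> in total. A component of size \<open>B * log n\<close>
contributes \<open>n\<close> to a power that grows with \<open>B\<close>, so that for large \<open>B\<close> Markov's inequality beats every
given power of \<open>n\<close>.\<close>

lemma no_large_component:
  assumes x: "0 < x" "x \<le> 1" and A: "1 \<le> A" and \<tau>: "0 \<le> \<tau>"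
  shows "\<exists>B>0. \<forall>\<^sub>F n in sequentially. \<forall>m. real m \<le> \<tau> * real n \<longrightarrow>
    uniform_prob (tuples n) m (\<lambda>h. \<exists>i\<le>m. (\<forall>j<i. cmgf n x (graph n (take j h)) \<le> A) \<and>
       (\<exists>u\<in>{1..n}. B * ln (real n) < real (csize n (graph n (take i h)) u))) \<le> real n powr (-102)"
proof -
  \<comment> \<open>With \<open>\<beta> = b * ln n\<close> the cost \<open>l powr \<beta> \<le> n powr (x / 16)\<close> of a collision is less than the inverse
     of its probability, which is of order \<open>n powr (- x / 8)\<close>.\<close>
  define b where "b = x / (16 * real l)"
  define \<Gamma> where "\<Gamma> = real l * ((1 + b) / (8 * b)) * A ^ (l - 1) + real l ^ 3 * A"
  \<comment> \<open>The weight of a component of size \<open>B * cap n\<close> is \<open>B powr \<beta> = n powr (\<Gamma> * \<tau> + 103)\<close>; it exceeds the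
     bound \<open>n powr (\<Gamma> * \<tau> + 1)\<close> for the expected total weight by the factor \<open>n powr 102\<close>.\<close>
  define B where "B = exp ((\<Gamma> * \<tau> + 103) / b)"
  have l: "2 \<le> real l" using l2 by simp
  have b0: "0 < b" using x l by (simp add: b_def)
  have \<Gamma>0: "0 \<le> \<Gamma>" using b0 A by (simp add: \<Gamma>_def)
  have B0: "0 < B" by (simp add: B_def)
  have lnl: "b * ln (real l) \<le> x / 16"
  proof -
    have "ln (real l) \<le> real l" using l ln_le_minus_one[of "real l"] by linarith
    then have "b * ln (real l) \<le> b * real l" using b0 by (intro mult_left_mono) auto
    then show ?thesis using l by (simp add: b_def)
  qed
  have y16: "16 * b \<le> x" 
  proof -
    have "x * 1 \<le> x * real l" using x l by (intro mult_left_mono) auto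
    then show ?thesis using l by (simp add: b_def field_simps)
  qed
  have ev1: "\<forall>\<^sub>F n in sequentially. (B / 8 * ln (real n)) * real n powr (- x / 16) \<le> 1" using x B0 by real_asymp
  have ev2: "\<forall>\<^sub>F n in sequentially. (8::real) \<le> ln (real n)" by real_asymp
  have "\<forall>\<^sub>F n in sequentially. \<forall>m. real m \<le> \<tau> * real n \<longrightarrow>
    uniform_prob (tuples n) m (\<lambda>h. \<exists>i\<le>m. (\<forall>j<i. cmgf n x (graph n (take j h)) \<le> A) \<and>
       (\<exists>u\<in>{1..n}. B / 8 * ln (real n) < real (csize n (graph n (take i h)) u))) \<le> real n powr (-102)"
    using ev1 ev2 eventually_gt_at_top[of 0]
  proof eventually_elim
    case (elim n)
    then have n: "0 < n" by simp
    define L where "L = ln (real n)"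
    have L: "8 \<le> L" using elim(2) by (simp add: L_def)
    have nL: "real n powr z = exp (z * L)" for z using n by (simp add: powr_def L_def)
    define \<beta> where "\<beta> = b * L"
    define M where "M = B / 8 * L"
    have K: "cap n = L / 8" "1 \<le> cap n" using L by (auto simp: cap_def L_def)
    have \<beta>0: "0 < \<beta>" using b0 L by (simp add: \<beta>_def)
    have M0: "0 \<le> M" using B0 L by (simp add: M_def)
    let ?W = "\<lambda>h. real n * vavg n (\<lambda>u. hpow (cap n) \<beta> (csize n (graph n h) u))"
    let ?good = "\<lambda>h. cmgf n x (graph n h) \<le> A \<and> (\<forall>u\<in>{1..n}. real (csize n (graph n h) u) \<le> M)"
    have y: "2 * (\<beta> / cap n) \<le> x" using y16 L by (simp add: \<beta>_def K)
    have rate: "real l * ((1 + \<beta>) / (\<beta> / cap n)) * A ^ (l - 1)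
         + real l ^ 3 * M * real l powr \<beta> * (A * exp (- x * cap n)) \<le> \<Gamma> * L"
    proof -
      have "(1 + \<beta>) / (\<beta> / cap n) = (1 + b * L) / (8 * b)" using L b0 by (simp add: \<beta>_def K field_simps)
      also have "\<dots> \<le> (1 + b) * L / (8 * b)" using L b0 by (intro divide_right_mono) (auto simp: algebra_simps)
      finally have 1: "real l * ((1 + \<beta>) / (\<beta> / cap n)) * A ^ (l - 1) \<le> real l * ((1 + b) * L / (8 * b)) * A ^ (l - 1)"
        using A by (intro mult_right_mono mult_left_mono) auto
      have "real l powr \<beta> = exp (b * ln (real l) * L)" using l by (simp add: powr_def \<beta>_def mult_ac)
      also have "\<dots> \<le> exp (x / 16 * L)" using lnl L by (simp add: mult_right_mono)
      finally have "real l powr \<beta> * exp (- x * cap n) \<le> exp (x / 16 * L) * exp (- x * cap n)"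
        by (intro mult_right_mono) auto
      also have "\<dots> = real n powr (- x / 16)" by (simp add: nL K exp_add[symmetric])
      finally have "M * (real l powr \<beta> * exp (- x * cap n)) \<le> M * real n powr (- x / 16)"
        using M0 by (intro mult_left_mono) auto
      also have "\<dots> \<le> 1" using elim(1) by (simp only: M_def L_def)
      also have "1 \<le> L" using L by simp
      finally have "real l ^ 3 * A * (M * (real l powr \<beta> * exp (- x * cap n))) \<le> real l ^ 3 * A * L"
        using A by (intro mult_left_mono) auto
      with 1 show ?thesis by (simp add: \<Gamma>_def algebra_simps)
    qed
    have step: "(\<Sum>v\<in>tuples n. ?W (h @ [v])) / card (tuples n) \<le> (1 + \<Gamma> * L / n) * ?W h"
      if h: "set h \<subseteq> tuples n" "?good h" for h
    proof -
      have "tavg n (\<lambda>v. real n * vavg n (\<lambda>u. hpow (cap n) \<beta> (csize n (step n v (graph n h)) u)))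
        \<le> (1 + (real l * ((1 + \<beta>) / (\<beta> / cap n)) * A ^ (l - 1)
         + real l ^ 3 * M * real l powr \<beta> * (A * exp (- x * cap n))) / n) * ?W h"
        by (rule hpow_drift[OF n edges_on_graph[OF h(1)] x(1)]) (use h K \<beta>0 y in auto)
      also have "\<dots> \<le> (1 + \<Gamma> * L / n) * ?W h"
        using K by (intro mult_right_mono add_left_mono divide_right_mono rate mult_nonneg_nonneg vavg_nonneg)
          (auto intro: less_imp_le[OF hpow_pos])
      finally show ?thesis by (simp add: tavg_def)
    qed
    show ?case
    proof (intro allI impI)
      fix m assume m: "real m \<le> \<tau> * real n"
      have "uniform_prob (tuples n) m (\<lambda>h. \<exists>i\<le>m. (\<forall>j<i. cmgf n x (graph n (take j h)) \<le> A) \<and>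
          (\<exists>u\<in>{1..n}. B / 8 * ln (real n) < real (csize n (graph n (take i h)) u)))
        \<le> uniform_prob (tuples n) m (\<lambda>h. \<exists>i\<le>m. (\<forall>j<i. ?good ([] @ take j h)) \<and> B powr \<beta> \<le> ?W ([] @ take i h))"
      proof (rule uniform_prob_mono)
        fix h assume "\<exists>i\<le>m. (\<forall>j<i. cmgf n x (graph n (take j h)) \<le> A) \<and>
          (\<exists>u\<in>{1..n}. B / 8 * ln (real n) < real (csize n (graph n (take i h)) u))"
        then obtain i where i: "i \<le> m" "\<forall>j<i. cmgf n x (graph n (take j h)) \<le> A"
          "\<exists>u\<in>{1..n}. M < real (csize n (graph n (take i h)) u)" by (auto simp: M_def L_def)
        let ?P = "\<lambda>k. \<exists>u\<in>{1..n}. M < real (csize n (graph n (take k h)) u)"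
        obtain k where k: "k \<le> i" "?P k" "\<And>j. j < k \<Longrightarrow> \<not> ?P j"
          using ex_least_nat_le[of ?P i] i(3) by blast
        then obtain u where u: "u \<in> {1..n}" "M < real (csize n (graph n (take k h)) u)" by blast
        have "B powr \<beta> \<le> hpow (cap n) \<beta> (csize n (graph n (take k h)) u)"
        proof -
          have "B * cap n \<le> max (real (csize n (graph n (take k h)) u)) (cap n)" using u(2) by (simp add: M_def K)
          then show ?thesis unfolding hpow_def using K B0 \<beta>0 by (intro powr_mono2) (auto simp: pos_le_divide_eq)
        qed
        also have "\<dots> \<le> (\<Sum>u\<in>{1..n}. hpow (cap n) \<beta> (csize n (graph n (take k h)) u))"
          by (rule member_le_sum[OF u(1), where f = "\<lambda>u. hpow (cap n) \<beta> (csize n (graph n (take k h)) u)"])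
            (use K in \<open>auto intro: less_imp_le[OF hpow_pos]\<close>)
        also have "\<dots> = ?W (take k h)" using n by (simp add: vavg_def)
        finally show "\<exists>i\<le>m. (\<forall>j<i. ?good ([] @ take j h)) \<and> B powr \<beta> \<le> ?W ([] @ take i h)"
          using i k by (intro exI[of _ k]) (auto simp: not_less)
      qed
      also have "\<dots> \<le> (1 + \<Gamma> * L / n) ^ m * ?W [] / B powr \<beta>"
        by (rule maximal_inequality[OF finite_tuples tuples_nonempty[OF n]])
          (use step \<Gamma>0 L B0 K in \<open>auto intro!: mult_nonneg_nonneg vavg_nonneg less_imp_le[OF hpow_pos]\<close>)
      also have "\<dots> \<le> exp (\<Gamma> * \<tau> * L) * real n / B powr \<beta>"
      proof (intro divide_right_mono mult_mono)
        have "(1 + \<Gamma> * L / n) ^ m \<le> exp (\<Gamma> * L / n) ^ m"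
          using \<Gamma>0 L by (intro power_mono exp_ge_add_one_self) auto
        also have "\<dots> = exp (\<Gamma> * L * (real m / n))" by (simp add: exp_of_nat_mult[symmetric])
        also have "\<dots> \<le> exp (\<Gamma> * L * \<tau>)"
        proof -
          have "real m / n \<le> \<tau>" using m n by (simp add: pos_divide_le_eq)
          then have "\<Gamma> * L * (real m / n) \<le> \<Gamma> * L * \<tau>" using \<Gamma>0 L by (intro mult_left_mono) auto
          then show ?thesis by simp
        qed
        finally show "(1 + \<Gamma> * L / n) ^ m \<le> exp (\<Gamma> * \<tau> * L)" by (simp add: mult_ac)
        have "hpow (cap n) \<beta> (csize n {} u) = 1" if "u \<in> {1..n}" for u
          using that K by (simp add: hpow_def max_absorb2)
        then show "?W [] \<le> real n" by (simp add: vavg_def)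
      qed (use K in \<open>auto intro!: mult_nonneg_nonneg vavg_nonneg less_imp_le[OF hpow_pos]\<close>)
      also have "\<dots> = exp (\<Gamma> * \<tau> * L) * exp L * exp (- ((\<Gamma> * \<tau> + 103) * L))"
        using n b0 by (simp add: L_def powr_def B_def \<beta>_def exp_minus divide_inverse)
      also have "\<dots> = real n powr (-102)"
        by (simp add: nL exp_add[symmetric] algebra_simps)
      finally show "uniform_prob (tuples n) m (\<lambda>h. \<exists>i\<le>m. (\<forall>j<i. cmgf n x (graph n (take j h)) \<le> A) \<and>
          (\<exists>u\<in>{1..n}. B / 8 * ln (real n) < real (csize n (graph n (take i h)) u))) \<le> real n powr (-102)" .
    qed
  qed
  then show ?thesis using B0 by (intro exI[of _ "B / 8"]) auto
qed

definition tails :: "real \<Rightarrow> real \<Rightarrow> nat \<Rightarrow> edges \<Rightarrow> bool" where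
  "tails a A n E \<longleftrightarrow> (\<forall>k\<ge>1. real (N_ge n E k) \<le> A * exp (- a * real k) * real n)"

text \<open>Up to the truncation the tail bound is Markov's inequality. Between the truncation and the largest
possible size \<open>B * ln n\<close> the bound at the truncation is reused, which costs a factor \<open>8 * B\<close> in the rate.
Beyond that size there are no vertices.\<close>

lemma tails_from_cmgf:
  assumes n: "0 < n" and x: "0 < x" and B: "0 < B" "1 \<le> 8 * B" and U: "cmgf n x E \<le> A"
    and big: "\<And>u. u \<in> {1..n} \<Longrightarrow> real (csize n E u) \<le> B * ln (real n)" and L: "0 < ln (real n)"
  shows "tails (x / (8 * B)) A n E"
  unfolding tails_def
proof (intro allI impI)
  fix k :: nat assume "1 \<le> k"
  show "real (N_ge n E k) \<le> A * exp (- (x / (8 * B)) * real k) * real n"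
  proof (cases "real k \<le> B * ln (real n)")
    case False
    then have "csize n E u < k" if "u \<in> {1..n}" for u using big[OF that] by linarith
    then have "real (N_ge n E k) = 0" unfolding N_ge_sum by (intro sum.neutral ballI) (simp add: not_le)
    also have "0 \<le> A * exp (- (x / (8 * B)) * real k) * real n" using cmgf_ge_1[OF n, of x E] U x by simp
    finally show ?thesis .
  next
    case True
    have kc: "x / (8 * B) * real k \<le> x * capped n k"
    proof -
      have "real k / (8 * B) \<le> capped n k"
        using True B mult_mono[of 1 "8 * B" "real k" "real k"] by (auto simp: capped_def cap_def field_simps)
      then show ?thesis using x mult_left_mono[of "real k / (8 * B)" "capped n k" x] by simp
    qed
    have "exp (x * capped n k) * real (N_ge n E k) = (\<Sum>u\<in>{1..n}. exp (x * capped n k) * of_bool (k \<le> csize n E u))"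
      by (simp add: N_ge_sum sum_distrib_left)
    also have "\<dots> \<le> (\<Sum>u\<in>{1..n}. cexp n x (csize n E u))"
      using x monoD[OF mono_cexp[of x n], of k] by (intro sum_mono) (auto simp: cexp_def of_bool_def)
    also have "\<dots> \<le> A * real n" using U n by (simp add: cmgf_def vavg_def field_simps)
    finally have "real (N_ge n E k) \<le> exp (- (x * capped n k)) * (A * real n)"
      by (simp add: exp_minus field_simps)
    also have "\<dots> \<le> exp (- (x / (8 * B) * real k)) * (A * real n)"
      using kc cmgf_ge_1[OF n, of x E] U x by (intro mult_right_mono) auto
    finally show ?thesis by (simp add: mult_ac)
  qed
qed

lemma subcritical_before_mono: "subcritical_before n t C h i \<Longrightarrow> j \<le> i \<Longrightarrow> subcritical_before n t C h j"
  by (auto simp: subcritical_before_def)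

theorem tails_while_subcritical:
  assumes t: "0 \<le> t" and C: "1 \<le> C" and w: "0 \<le> w" "w * real l * (real l - 1) * C < 1"
  shows "\<exists>a>0. \<exists>A>0. \<forall>\<^sub>F n in sequentially. uniform_prob (tuples n) (nat \<lfloor>(t + w) * real n\<rfloor>)
     (\<lambda>h. \<exists>i\<le>nat \<lfloor>(t + w) * real n\<rfloor>. subcritical_before n t C h i \<and> \<not> tails a A n (graph n (take i h)))
     \<le> real n powr (-100)"
proof -
  obtain x A Q where x: "0 < x" "x \<le> 1" and A: "1 \<le> A" and ev1: "\<forall>\<^sub>F n in sequentially.
      uniform_prob (tuples n) (nat \<lfloor>(t + w) * real n\<rfloor>)
       (\<lambda>h. \<exists>i\<le>nat \<lfloor>(t + w) * real n\<rfloor>. subcritical_before n t C h i \<and> A < cmgf n x (graph n (take i h)))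
     \<le> Q * real n powr (-102)"
    using cmgf_controlled_all[OF assms] unfolding cmgf_controlled_def by blast
  obtain B0 where B0: "0 < B0" and ev2: "\<forall>\<^sub>F n in sequentially. \<forall>m. real m \<le> (t + w) * real n \<longrightarrow>
    uniform_prob (tuples n) m (\<lambda>h. \<exists>i\<le>m. (\<forall>j<i. cmgf n x (graph n (take j h)) \<le> A) \<and>
       (\<exists>u\<in>{1..n}. B0 * ln (real n) < real (csize n (graph n (take i h)) u))) \<le> real n powr (-102)"
    using no_large_component[OF x A, of "t + w"] t w by auto
  define B where "B = max B0 1"
  have B: "0 < B" "1 \<le> 8 * B" "B0 \<le> B" by (auto simp: B_def)
  have ev3: "\<forall>\<^sub>F n in sequentially. Q * real n powr (-102) + real n powr (-102) \<le> real n powr (-100)" by real_asymp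
  have ev4: "\<forall>\<^sub>F n in sequentially. 0 < ln (real n)" by real_asymp
  have "\<forall>\<^sub>F n in sequentially. uniform_prob (tuples n) (nat \<lfloor>(t + w) * real n\<rfloor>)
     (\<lambda>h. \<exists>i\<le>nat \<lfloor>(t + w) * real n\<rfloor>. subcritical_before n t C h i \<and> \<not> tails (x / (8 * B)) A n (graph n (take i h)))
     \<le> real n powr (-100)"
    using ev1 ev2 ev3 ev4 eventually_gt_at_top[of 0]
  proof eventually_elim
    case (elim n)
    then have n: "0 < n" by simp
    define m where "m = nat \<lfloor>(t + w) * real n\<rfloor>"
    have m: "real m \<le> (t + w) * real n" using t w by (simp add: m_def)
    let ?P1 = "\<lambda>h. \<exists>i\<le>m. subcritical_before n t C h i \<and> A < cmgf n x (graph n (take i h))"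
    let ?P2 = "\<lambda>h. \<exists>i\<le>m. (\<forall>j<i. cmgf n x (graph n (take j h)) \<le> A) \<and>
       (\<exists>u\<in>{1..n}. B0 * ln (real n) < real (csize n (graph n (take i h)) u))"
    have "uniform_prob (tuples n) m (\<lambda>h. \<exists>i\<le>m. subcritical_before n t C h i \<and> \<not> tails (x / (8 * B)) A n (graph n (take i h)))
      \<le> uniform_prob (tuples n) m (\<lambda>h. ?P1 h \<or> ?P2 h)"
    proof (rule uniform_prob_mono)
      fix h assume "\<exists>i\<le>m. subcritical_before n t C h i \<and> \<not> tails (x / (8 * B)) A n (graph n (take i h))"
      then obtain i where i: "i \<le> m" "subcritical_before n t C h i" "\<not> tails (x / (8 * B)) A n (graph n (take i h))" by blast
      show "?P1 h \<or> ?P2 h"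
      proof (cases "?P1 h")
        case False
        then have U: "cmgf n x (graph n (take j h)) \<le> A" if "j \<le> i" for j
          using that i subcritical_before_mono[OF i(2) that] by (meson le_trans not_le)
        have "\<exists>u\<in>{1..n}. B * ln (real n) < real (csize n (graph n (take i h)) u)"
          using tails_from_cmgf[OF n x(1) B(1,2) U[of i] _ elim(4)] i(3) by (meson le_refl not_le)
        moreover have "B0 * ln (real n) \<le> B * ln (real n)" using B elim(4) by (intro mult_right_mono) auto
        ultimately have "\<exists>u\<in>{1..n}. B0 * ln (real n) < real (csize n (graph n (take i h)) u)"
          by (meson order.strict_trans1)
        then have "?P2 h" using i(1) U by (intro exI[of _ i]) auto
        then show ?thesis ..
      qed blast
    qed
    also have "\<dots> \<le> uniform_prob (tuples n) m ?P1 + uniform_prob (tuples n) m ?P2" by (rule uniform_prob_disj)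
    also have "\<dots> \<le> Q * real n powr (-102) + real n powr (-102)"
      using elim(1) elim(2) m by (intro add_mono) (auto simp: m_def)
    also have "\<dots> \<le> real n powr (-100)" by (rule elim(3))
    finally show ?case by (simp add: m_def)
  qed
  moreover have "0 < x / (8 * B)" using x B by simp
  ultimately show ?thesis using A by (intro exI[of _ "x / (8 * B)"] conjI exI[of _ A]) auto
qed

end

section \<open>Concentration of the component size counts\<close>

lemma sum_exp_le:
  assumes "0 < a" shows "a * (\<Sum>k\<in>{1..n}. exp (- a * real k)) \<le> 1 - exp (- a * real n)"
proof (induction n)
  case (Suc n)
  have "a * exp (- a * real (Suc n)) \<le> (exp a - 1) * exp (- a * real (Suc n))"
    using exp_ge_add_one_self[of a] by (intro mult_right_mono) (linarith, simp)
  also have "\<dots> = exp (- a * real n) - exp (- a * real (Suc n))"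
    by (simp add: left_diff_distrib exp_add[symmetric] algebra_simps)
  finally show ?case using Suc by (simp add: distrib_left)
qed simp

context size_rule_process
begin

definition freq :: "nat \<Rightarrow> edges \<Rightarrow> nat \<Rightarrow> real" where
  "freq n E k = real (N_eq n E k) / n"

text \<open>The mean of \<open>size_change\<close> when the \<open>l\<close> sizes are independent and the \<open>j\<close>-th has density \<open>p j\<close>. In the
process all \<open>p j\<close> are equal; different ones are needed to exchange the factors of a product one by
one.\<close>

definition drift :: "nat \<Rightarrow> (nat \<Rightarrow> nat \<Rightarrow> real) \<Rightarrow> nat \<Rightarrow> real" where
  "drift N p k = (\<Sum>c\<in>{1..l} \<rightarrow>\<^sub>E {1..N}. (\<Prod>j\<in>{1..l}. p j (c j)) * size_change c k)"

lemma group_subset: "group c j \<subseteq> {1..l}"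
  unfolding group_def by (rule component_subset)

lemma size_change_cong:
  assumes "\<And>j. j \<in> {1..l} \<Longrightarrow> c j = c' j" shows "size_change c k = size_change c' k"
proof -
  have "chosen c = chosen c'"
    unfolding chosen_def by (rule arg_cong[where f = R], rule map_cong) (use assms in auto)
  then have g: "group c j = group c' j" for j by (simp add: group_def)
  have "new_size c j = new_size c' j" for j
    unfolding new_size_def g using group_subset[of c' j] assms by (intro sum.cong) auto
  then show ?thesis unfolding size_change_def using assms by (intro sum.cong) auto
qed

lemma new_size_le: "new_size c j \<le> (\<Sum>i\<in>{1..l}. c i)"
  unfolding new_size_def by (rule sum_mono2) (use group_subset in auto)

lemma member_le_total: "j \<in> {1..l} \<Longrightarrow> c j \<le> (\<Sum>i\<in>{1..l}. c i)" for c :: "nat \<Rightarrow> nat"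
  by (rule member_le_sum) auto

lemma size_change_abs_le: "\<bar>size_change c k\<bar> \<le> real (\<Sum>j\<in>{1..l}. c j)"
proof -
  have "\<bar>size_change c k\<bar> \<le> (\<Sum>j\<in>{1..l}. \<bar>real (c j) * (of_bool (new_size c j = k) - of_bool (c j = k))\<bar>)"
    unfolding size_change_def by (rule sum_abs)
  also have "\<dots> \<le> (\<Sum>j\<in>{1..l}. real (c j))" by (intro sum_mono) (auto simp: of_bool_def)
  finally show ?thesis by simp
qed

lemma size_change_large: "(\<Sum>j\<in>{1..l}. c j) < k \<Longrightarrow> size_change c k = 0"
  unfolding size_change_def
proof (rule sum.neutral, rule ballI)
  fix j assume *: "(\<Sum>j\<in>{1..l}. c j) < k" "j \<in> {1..l}"
  then have "new_size c j \<noteq> k" "c j \<noteq> k" using new_size_le[of c j] member_le_total[of j c] by auto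
  then show "real (c j) * (of_bool (new_size c j = k) - of_bool (c j = k)) = 0" by simp
qed

lemma drift_graph:
  assumes n: "0 < n"
  shows "drift n (\<lambda>_. freq n E) k = tavg n (\<lambda>v. size_change (csize n E \<circ> v) k)"
proof -
  let ?c = "csize n E"
  have f: "freq n E a = vavg n (\<lambda>u. of_bool (?c u = a))" for a
    by (simp add: freq_def vavg_def N_eq_sum)
  have "drift n (\<lambda>_. freq n E) k
    = (\<Sum>c\<in>{1..l} \<rightarrow>\<^sub>E {1..n}. tavg n (\<lambda>v. size_change c k * (\<Prod>j\<in>{1..l}. of_bool (?c (v j) = c j))))"
    unfolding drift_def f tavg_cmult
  proof (rule sum.cong[OF refl])
    fix c :: "nat \<Rightarrow> nat"
    show "(\<Prod>j\<in>{1..l}. vavg n (\<lambda>u. of_bool (?c u = c j))) * size_change c k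
      = size_change c k * tavg n (\<lambda>v. \<Prod>j\<in>{1..l}. of_bool (?c (v j) = c j))"
      unfolding tavg_prod[of n "\<lambda>j u. of_bool (?c u = c j)"] by (rule mult.commute)
  qed
  also have "\<dots> = tavg n (\<lambda>v. \<Sum>c\<in>{1..l} \<rightarrow>\<^sub>E {1..n}. size_change c k * (\<Prod>j\<in>{1..l}. of_bool (?c (v j) = c j)))"
    by (rule tavg_sum[symmetric])
  also have "\<dots> = tavg n (\<lambda>v. size_change (?c \<circ> v) k)"
    unfolding tavg_def
  proof (intro arg_cong2[of _ _ _ _ "(/)"] sum.cong refl)
    fix v assume v: "v \<in> tuples n"
    let ?r = "restrict (?c \<circ> v) {1..l}"
    have r: "?r \<in> {1..l} \<rightarrow>\<^sub>E {1..n}"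
      using tuplesD[OF v] csize_ge_1 csize_le by (auto simp: Suc_le_eq)
    have "(\<Prod>j\<in>{1..l}. of_bool (?c (v j) = c j)) = (of_bool (c = ?r) :: real)" if c: "c \<in> {1..l} \<rightarrow>\<^sub>E {1..n}" for c
    proof (cases "c = ?r")
      case True then show ?thesis by simp
    next
      case False
      then obtain j where "j \<in> {1..l}" "c j \<noteq> ?r j" using PiE_ext[OF c r] by blast
      then have "\<exists>j\<in>{1..l}. of_bool (?c (v j) = c j) = (0::real)" by (intro bexI[of _ j]) auto
      then show ?thesis using False by (simp add: prod_zero_iff)
    qed
    then have "(\<Sum>c\<in>{1..l} \<rightarrow>\<^sub>E {1..n}. size_change c k * (\<Prod>j\<in>{1..l}. of_bool (?c (v j) = c j)))
      = (\<Sum>c\<in>{1..l} \<rightarrow>\<^sub>E {1..n}. if c = ?r then size_change c k else 0)"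
      by (intro sum.cong) auto
    also have "\<dots> = size_change ?r k" using r by (simp add: finite_PiE)
    also have "\<dots> = size_change (?c \<circ> v) k" by (rule size_change_cong) auto
    finally show "(\<Sum>c\<in>{1..l} \<rightarrow>\<^sub>E {1..n}. size_change c k * (\<Prod>j\<in>{1..l}. of_bool (?c (v j) = c j)))
      = size_change (?c \<circ> v) k" .
  qed
  finally show ?thesis .
qed

lemma tavg_abs_le: "\<bar>tavg n F\<bar> \<le> tavg n (\<lambda>v. \<bar>F v\<bar>)"
  by (simp add: tavg_def abs_divide divide_right_mono)

lemma total_le:
  assumes "v \<in> tuples n" and "\<And>u. u \<in> {1..n} \<Longrightarrow> real (csize n E u) \<le> K"
  shows "real (total n E v) \<le> real l * K"
proof -
  have "real (total n E v) = (\<Sum>j\<in>{1..l}. real (csize n E (v j)))" by (simp add: total_def)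
  also have "\<dots> \<le> (\<Sum>j\<in>{1..l}. K)" by (intro sum_mono assms(2) tuplesD[OF assms(1)])
  finally show ?thesis by simp
qed

text \<open>The two quantities differ only for tuples that are not separated.\<close>

lemma expected_change:
  assumes n: "0 < n" and E: "edges_on n E" and K: "\<And>u. u \<in> {1..n} \<Longrightarrow> real (csize n E u) \<le> K"
  shows "\<bar>tavg n (\<lambda>v. real (N_eq n (step n v E) k) - real (N_eq n E k)) - drift n (\<lambda>_. freq n E) k\<bar>
    \<le> 2 * real l ^ 3 * K * susceptibility n E / n"
proof -
  let ?D = "\<lambda>v. real (N_eq n (step n v E) k) - real (N_eq n E k) - size_change (csize n E \<circ> v) k"
  have K0: "0 \<le> K" using K[of 1] n by auto
  have D: "\<bar>?D v\<bar> \<le> 2 * real l * K * of_bool (\<not> separated n E v)" if v: "v \<in> tuples n" for v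
  proof (cases "separated n E v")
    case True then show ?thesis using N_eq_change_separated[OF E v True] by simp
  next
    case False
    have "\<bar>?D v\<bar> \<le> 2 * real (total n E v)"
      using N_eq_change_le[OF E v, of k] size_change_abs_le[of "csize n E \<circ> v" k]
      by (simp add: total_def abs_le_iff)
    then show ?thesis using total_le[OF v K] False by simp
  qed
  have "\<bar>tavg n ?D\<bar> \<le> tavg n (\<lambda>v. 2 * real l * K * of_bool (\<not> separated n E v))"
    by (rule order.trans[OF tavg_abs_le tavg_mono[OF D]])
  also have "\<dots> \<le> 2 * real l * K * (real l ^ 2 * susceptibility n E / n)"
    unfolding tavg_cmult using K0 by (intro mult_left_mono tavg_not_separated n) auto
  finally show ?thesis
    by (simp add: drift_graph[OF n] tavg_diff power2_eq_square power3_eq_cube mult_ac)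
qed

lemma drift_graph_abs_le:
  assumes n: "0 < n" and K: "\<And>u. u \<in> {1..n} \<Longrightarrow> real (csize n E u) \<le> K"
  shows "\<bar>drift n (\<lambda>_. freq n E) k\<bar> \<le> real l * K"
proof -
  have "\<bar>drift n (\<lambda>_. freq n E) k\<bar> \<le> tavg n (\<lambda>v. \<bar>size_change (csize n E \<circ> v) k\<bar>)"
    unfolding drift_graph[OF n] by (rule tavg_abs_le)
  also have "\<dots> \<le> tavg n (\<lambda>v. real l * K)"
  proof (rule tavg_mono)
    fix v assume v: "v \<in> tuples n"
    show "\<bar>size_change (csize n E \<circ> v) k\<bar> \<le> real l * K"
      using size_change_abs_le[of "csize n E \<circ> v" k] total_le[OF v K] by (simp add: total_def)
  qed
  finally show ?thesis by (simp add: tavg_const[OF n])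
qed

lemma tails_susceptibility:
  assumes "tails a A n E" "0 < a" "0 < A" "0 < n" shows "susceptibility n E \<le> A / a"
proof -
  have "susceptibility n E = (\<Sum>k\<in>{1..n}. real (N_ge n E k)) / n"
    unfolding susceptibility_eq sum_N_ge ..
  also have "\<dots> \<le> (\<Sum>k\<in>{1..n}. A * exp (- a * real k) * real n) / n"
    using assms(1) by (intro divide_right_mono sum_mono) (auto simp: tails_def)
  also have "\<dots> = A * (\<Sum>k\<in>{1..n}. exp (- a * real k))"
    using assms(4) by (simp add: sum_distrib_left sum_distrib_right[symmetric])
  also have "\<dots> \<le> A * (1 / a)"
  proof (intro mult_left_mono)
    have "a * (\<Sum>k\<in>{1..n}. exp (- a * real k)) \<le> 1"
      using sum_exp_le[OF assms(2), of n] exp_gt_zero[of "- a * real n"] by linarith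
    then show "(\<Sum>k\<in>{1..n}. exp (- a * real k)) \<le> 1 / a" using assms(2) by (simp add: field_simps)
  qed (use assms in auto)
  finally show ?thesis by simp
qed

lemma tails_csize:
  assumes "tails a A n E" "0 < a" "0 < A" "A \<le> real n" "u \<in> {1..n}"
  shows "real (csize n E u) \<le> 2 / a * ln (real n)"
proof -
  let ?c = "csize n E u"
  have n: "0 < real n" using assms by auto
  have "N_ge n E ?c \<noteq> 0" using assms(5) by (auto simp: N_ge_def card_eq_0_iff)
  then have "1 \<le> real (N_ge n E ?c)" by simp
  also have "\<dots> \<le> A * exp (- a * real ?c) * real n"
    using assms(1) csize_ge_1[OF assms(5), of E] by (simp add: tails_def)
  also have "\<dots> \<le> real n * exp (- a * real ?c) * real n"
    using assms by (intro mult_right_mono) auto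
  finally have "exp (a * real ?c) \<le> real n * real n" by (simp add: exp_minus field_simps)
  then have "a * real ?c \<le> ln (real n * real n)" using n by (subst ln_ge_iff) auto
  also have "\<dots> = 2 * ln (real n)" using n by (simp add: ln_mult)
  finally show ?thesis using assms(2) by (simp add: field_simps)
qed

text \<open>The number \<open>N\<^sub>k\<close> minus its accumulated drift; up to the error in \<open>expected_change\<close> it is a martingale.\<close>

definition compensated :: "nat \<Rightarrow> nat \<Rightarrow> (nat \<Rightarrow> nat) list \<Rightarrow> real" where
  "compensated n k h = real (N_eq n (graph n h) k) - (\<Sum>j<length h. drift n (\<lambda>_. freq n (graph n (take j h))) k)"

lemma compensated_snoc:
  "compensated n k (h @ [v]) = compensated n k h
     + (real (N_eq n (step n v (graph n h)) k) - real (N_eq n (graph n h) k)) - drift n (\<lambda>_. freq n (graph n h)) k"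
  by (simp add: compensated_def)

text \<open>The sign \<open>\<sigma>\<close> treats upper and lower deviations together. Subtracting the error of \<open>expected_change\<close> in
every step turns the compensated count into a supermartingale; these corrections add up to the
term that is subtracted from \<open>\<delta>\<close>.\<close>

lemma compensated_deviation_one:
  fixes \<sigma> :: real
  assumes n: "0 < n" and a: "0 < a" "0 < A" "A \<le> real n" and big: "2 * real l ^ 2 * (A / a) \<le> real n"
    and L: "0 < ln (real n)" and \<sigma>: "\<bar>\<sigma>\<bar> = 1" and m: "real m \<le> t * real n"
  shows "uniform_prob (tuples n) m (\<lambda>h. \<exists>i\<le>m. (\<forall>j<i. tails a A n (graph n (take j h))) \<and>
       \<delta> \<le> \<sigma> * (compensated n k (take i h) - compensated n k []))
    \<le> exp (t - (\<delta> - t * (2 * real l ^ 3 * (2 / a * ln (real n)) * (A / a))) / (sqrt (real n) * (3 * real l * (2 / a * ln (real n)))))"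
proof -
  define K where "K = 2 / a * ln (real n)"
  define err where "err = 2 * real l ^ 3 * K * (A / a) / n"
  define \<beta> where "\<beta> = 3 * real l * K"
  \<comment> \<open>Over order \<open>n\<close> steps this makes the quadratic term in Azuma's inequality bounded.\<close>
  define \<theta> where "\<theta> = 1 / (sqrt (real n) * \<beta>)"
  define f where "f h = \<sigma> * compensated n k h - real (length h) * err" for h
  have K0: "0 < K" using a L by (simp add: K_def)
  have \<beta>0: "0 < \<beta>" using K0 l2 by (simp add: \<beta>_def)
  have err0: "0 \<le> err" using K0 a by (simp add: err_def)
  have err_le: "err \<le> real l * K"
  proof -
    have "err = real l * K * (2 * real l ^ 2 * (A / a) / n)" by (simp add: err_def power3_eq_cube power2_eq_square)
    also have "\<dots> \<le> real l * K * 1"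
    proof (intro mult_left_mono)
      show "2 * real l ^ 2 * (A / a) / real n \<le> 1" using big n by (subst pos_divide_le_eq) auto
    qed (use K0 in auto)
    finally show ?thesis by simp
  qed
  let ?good = "\<lambda>h. tails a A n (graph n h)"
  have Kc: "real (csize n (graph n h) u) \<le> K" if "?good h" "u \<in> {1..n}" for h u
    using tails_csize[OF that(1) a that(2)] by (simp add: K_def)
  have drift: "(\<Sum>v\<in>tuples n. f (h @ [v])) / card (tuples n) \<le> f h"
    if h: "set h \<subseteq> tuples n" "length h < length [] + m" "?good h" for h
  proof -
    let ?E = "graph n h"
    let ?X = "tavg n (\<lambda>v. real (N_eq n (step n v ?E) k) - real (N_eq n ?E k)) - drift n (\<lambda>_. freq n ?E) k"
    have "\<bar>?X\<bar> \<le> 2 * real l ^ 3 * K * susceptibility n ?E / n"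
      by (rule expected_change[OF n edges_on_graph[OF h(1)] Kc[OF h(3)]])
    also have "\<dots> \<le> err"
      unfolding err_def using K0 tails_susceptibility[OF h(3) a(1,2) n]
      by (intro divide_right_mono mult_left_mono) auto
    finally have "\<bar>\<sigma> * ?X\<bar> \<le> err" by (simp only: abs_mult \<sigma> mult_1)
    then have "\<sigma> * ?X \<le> err" by (rule order.trans[OF abs_ge_self])
    moreover have "tavg n (\<lambda>v. f (h @ [v])) = f h + \<sigma> * ?X - err"
    proof -
      have "(\<lambda>v. f (h @ [v])) = (\<lambda>v. (f h - err - \<sigma> * drift n (\<lambda>_. freq n ?E) k)
        + \<sigma> * (real (N_eq n (step n v ?E) k) - real (N_eq n ?E k)))"
        by (simp add: f_def compensated_snoc algebra_simps)
      then show ?thesis by (simp only: tavg_add tavg_const[OF n] tavg_cmult) (simp add: algebra_simps)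
    qed
    ultimately show ?thesis by (simp add: tavg_def)
  qed
  have jump: "\<bar>f (h @ [v]) - f h\<bar> \<le> \<beta>"
    if h: "set h \<subseteq> tuples n" "length h < length [] + m" "?good h" and v: "v \<in> tuples n" for h v
  proof -
    let ?E = "graph n h"
    let ?Y = "real (N_eq n (step n v ?E) k) - real (N_eq n ?E k) - drift n (\<lambda>_. freq n ?E) k"
    have "\<bar>?Y\<bar> \<le> real l * K + real l * K"
      using N_eq_change_le[OF edges_on_graph[OF h(1)] v, of k] total_le[OF v Kc[OF h(3)]]
        drift_graph_abs_le[OF n Kc[OF h(3)], of k] by linarith
    moreover have "f (h @ [v]) - f h = \<sigma> * ?Y - err"
      by (simp add: f_def compensated_snoc algebra_simps)
    moreover have "\<bar>\<sigma> * ?Y\<bar> = \<bar>?Y\<bar>" using \<sigma> by (simp add: abs_mult)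
    ultimately show ?thesis using err0 err_le unfolding \<beta>_def mult.assoc[of 3] by linarith
  qed
  have "uniform_prob (tuples n) m (\<lambda>h. \<exists>i\<le>m. (\<forall>j<i. ?good (take j h)) \<and>
       \<delta> \<le> \<sigma> * (compensated n k (take i h) - compensated n k []))
    \<le> uniform_prob (tuples n) m (\<lambda>h. \<exists>i\<le>m. (\<forall>j<i. ?good ([] @ take j h)) \<and> f [] + (\<delta> - real m * err) \<le> f ([] @ take i h))"
  proof (rule uniform_prob_mono)
    fix h assume h: "h \<in> hists (tuples n) m" and "\<exists>i\<le>m. (\<forall>j<i. ?good (take j h)) \<and>
       \<delta> \<le> \<sigma> * (compensated n k (take i h) - compensated n k [])"
    then obtain i where i: "i \<le> m" "\<forall>j<i. ?good (take j h)" "\<delta> \<le> \<sigma> * (compensated n k (take i h) - compensated n k [])"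
      by blast
    have "real i * err \<le> real m * err" using i err0 by (intro mult_right_mono) auto
    then have "f [] + (\<delta> - real m * err) \<le> f (take i h)"
      using i h by (simp add: f_def algebra_simps)
    then show "\<exists>i\<le>m. (\<forall>j<i. ?good ([] @ take j h)) \<and> f [] + (\<delta> - real m * err) \<le> f ([] @ take i h)"
      using i by auto
  qed
  also have "\<dots> \<le> exp (real m * (\<theta> * \<beta>)\<^sup>2 - \<theta> * (\<delta> - real m * err))"
  proof (rule azuma_inequality[OF finite_tuples tuples_nonempty[OF n] drift jump])
    show "0 \<le> \<theta>" "0 \<le> \<beta>" using \<beta>0 by (auto simp: \<theta>_def)
    have "\<theta> * \<beta> = 1 / sqrt (real n)" using \<beta>0 by (simp add: \<theta>_def)
    then show "\<theta> * \<beta> \<le> 1" using n by simp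
  qed auto
  also have "\<dots> \<le> exp (t - (\<delta> - t * (2 * real l ^ 3 * K * (A / a))) / (sqrt (real n) * \<beta>))"
  proof -
    have "(\<theta> * \<beta>)\<^sup>2 = 1 / real n" using \<beta>0 n by (simp add: \<theta>_def power_divide)
    moreover have "real m * (1 / real n) \<le> t" using m n by (simp add: field_simps)
    ultimately have 1: "real m * (\<theta> * \<beta>)\<^sup>2 \<le> t" by simp
    have "real m * err \<le> t * real n * err" using m err0 by (intro mult_right_mono) auto
    also have "\<dots> = t * (2 * real l ^ 3 * K * (A / a))" using n by (simp add: err_def)
    finally have "\<theta> * (\<delta> - t * (2 * real l ^ 3 * K * (A / a))) \<le> \<theta> * (\<delta> - real m * err)"
      using \<beta>0 by (intro mult_left_mono) (auto simp: \<theta>_def)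
    with 1 show ?thesis by (simp add: \<theta>_def)
  qed
  finally show ?thesis by (simp add: K_def \<beta>_def)
qed

theorem compensated_deviation:
  assumes a: "0 < a" "0 < A"
  shows "\<forall>\<^sub>F n in sequentially. \<forall>m. real m \<le> t * real n \<longrightarrow>
    uniform_prob (tuples n) m (\<lambda>h. \<exists>i\<le>m. (\<forall>j<i. tails a A n (graph n (take j h))) \<and>
       (\<exists>k\<in>{1..n}. sqrt (real n) * ln (real n) ^ 3 \<le> \<bar>compensated n k (take i h) - compensated n k []\<bar>))
    \<le> real n powr (-100)"
proof -
  have l: "0 < real l" using l2 by simp
  have ev1: "\<forall>\<^sub>F n in sequentially. real n * (2 * exp (t - (sqrt (real n) * ln (real n) ^ 3 - t * (2 * real l ^ 3 * (2 / a * ln (real n)) * (A / a)))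
      / (sqrt (real n) * (3 * real l * (2 / a * ln (real n)))))) \<le> real n powr (-100)"
    using a l by real_asymp
  have ev2: "\<forall>\<^sub>F n in sequentially. A \<le> real n" by real_asymp
  have ev3: "\<forall>\<^sub>F n in sequentially. 2 * real l ^ 2 * (A / a) \<le> real n" by real_asymp
  have ev4: "\<forall>\<^sub>F n in sequentially. 0 < ln (real n)" by real_asymp
  show ?thesis
    using ev1 ev2 ev3 ev4 eventually_gt_at_top[of 0]
  proof eventually_elim
    case (elim n)
    then have n: "0 < n" by simp
    define \<delta> where "\<delta> = sqrt (real n) * ln (real n) ^ 3"
    define B where "B = exp (t - (\<delta> - t * (2 * real l ^ 3 * (2 / a * ln (real n)) * (A / a))) / (sqrt (real n) * (3 * real l * (2 / a * ln (real n)))))"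
    show ?case
    proof (intro allI impI)
      fix m assume m: "real m \<le> t * real n"
      let ?P = "\<lambda>\<sigma> k h. \<exists>i\<le>m. (\<forall>j<i. tails a A n (graph n (take j h))) \<and>
         \<delta> \<le> \<sigma> * (compensated n k (take i h) - compensated n k [])"
      have P: "uniform_prob (tuples n) m (?P \<sigma> k) \<le> B" if "\<bar>\<sigma>\<bar> = 1" for \<sigma> k
        unfolding B_def by (rule compensated_deviation_one[OF n a elim(2,3,4) that m])
      have "uniform_prob (tuples n) m (\<lambda>h. \<exists>i\<le>m. (\<forall>j<i. tails a A n (graph n (take j h))) \<and>
         (\<exists>k\<in>{1..n}. \<delta> \<le> \<bar>compensated n k (take i h) - compensated n k []\<bar>))
        \<le> uniform_prob (tuples n) m (\<lambda>h. \<exists>k\<in>{1..n}. ?P 1 k h \<or> ?P (-1) k h)"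
      proof (rule uniform_prob_mono)
        fix h assume "\<exists>i\<le>m. (\<forall>j<i. tails a A n (graph n (take j h))) \<and>
         (\<exists>k\<in>{1..n}. \<delta> \<le> \<bar>compensated n k (take i h) - compensated n k []\<bar>)"
        then obtain i k where ik: "i \<le> m" "\<forall>j<i. tails a A n (graph n (take j h))" "k \<in> {1..n}"
          "\<delta> \<le> \<bar>compensated n k (take i h) - compensated n k []\<bar>" by blast
        then have "\<delta> \<le> 1 * (compensated n k (take i h) - compensated n k []) \<or>
          \<delta> \<le> (-1) * (compensated n k (take i h) - compensated n k [])" by (simp add: abs_if split: if_splits)
        then show "\<exists>k\<in>{1..n}. ?P 1 k h \<or> ?P (-1) k h" using ik by blast
      qed
      also have "\<dots> \<le> (\<Sum>k\<in>{1..n}. uniform_prob (tuples n) m (\<lambda>h. ?P 1 k h \<or> ?P (-1) k h))"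
        by (rule uniform_prob_bex) simp
      also have "\<dots> \<le> (\<Sum>k\<in>{1..n}. 2 * B)"
      proof (rule sum_mono)
        fix k
        show "uniform_prob (tuples n) m (\<lambda>h. ?P 1 k h \<or> ?P (-1) k h) \<le> 2 * B"
          using uniform_prob_disj[of "tuples n" m "?P 1 k" "?P (-1) k"] P[of 1 k] P[of "-1" k] by simp
      qed
      also have "\<dots> \<le> real n powr (-100)" using elim(1) by (simp add: B_def \<delta>_def)
      finally show "uniform_prob (tuples n) m (\<lambda>h. \<exists>i\<le>m. (\<forall>j<i. tails a A n (graph n (take j h))) \<and>
       (\<exists>k\<in>{1..n}. sqrt (real n) * ln (real n) ^ 3 \<le> \<bar>compensated n k (take i h) - compensated n k []\<bar>))
        \<le> real n powr (-100)" by (simp add: \<delta>_def)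
    qed
  qed
qed

end

section \<open>One-sided Lipschitz property of the drift\<close>

text \<open>Many sums and products below range over \<open>{1..l}\<close>; rewriting \<open>1\<close> to \<open>Suc 0\<close> in them would prevent the
application of facts about these ranges.\<close>

declare One_nat_def [simp del]

context size_rule_process
begin

definition size_dist :: "nat \<Rightarrow> real \<Rightarrow> (nat \<Rightarrow> real) \<Rightarrow> bool" where
  "size_dist N C p \<longleftrightarrow> (\<forall>k. 0 \<le> p k) \<and> (\<Sum>k\<in>{1..N}. p k) = 1 \<and> (\<Sum>k\<in>{1..N}. real k * p k) \<le> C"

abbreviation sizes :: "nat \<Rightarrow> (nat \<Rightarrow> nat) set" where
  "sizes N \<equiv> {1..l} \<rightarrow>\<^sub>E {1..N}"

lemma finite_sizes [simp]: "finite (sizes N)" by (simp add: finite_PiE)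

lemma sum_sizes_prod:
  fixes f :: "nat \<Rightarrow> nat \<Rightarrow> real"
  shows "(\<Sum>c\<in>sizes N. \<Prod>j\<in>{1..l}. f j (c j)) = (\<Prod>j\<in>{1..l}. \<Sum>a\<in>{1..N}. f j a)"
  by (rule prod_sum_PiE[symmetric]) auto

context
  fixes N r :: nat and C :: real and q :: "nat \<Rightarrow> nat \<Rightarrow> real"
  assumes r: "r \<in> {1..l}" and q: "\<And>i. size_dist N C (q i)"
begin

text \<open>For a signed \<open>g\<close> in position \<open>r\<close> and probability densities \<open>q i\<close> in the other positions, the drift is
split according to which vertices change their component size: those of the \<open>r\<close>-th component (\<open>own\<close>)
and those of the others (\<open>rest\<close>).\<close>

definition others :: "(nat \<Rightarrow> nat) \<Rightarrow> real" where
  "others c = (\<Prod>i\<in>{1..l}-{r}. q i (c i))"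

lemma q0: "0 \<le> q i a" and q1: "(\<Sum>a\<in>{1..N}. q i a) = 1" and qC: "(\<Sum>a\<in>{1..N}. real a * q i a) \<le> C"
  using q[of i] by (auto simp: size_dist_def)

lemma prod_remove: "(\<Prod>i\<in>{1..l}. P i) = P r * (\<Prod>i\<in>{1..l}-{r}. P i)" for P :: "nat \<Rightarrow> real"
  by (rule prod.remove) (use r in auto)

lemma prod_split_if:
  "(\<Prod>i\<in>{1..l}. (if i = r then f else g i) (c i)) = f (c r) * (\<Prod>i\<in>{1..l}-{r}. g i (c i) :: real)"
  unfolding prod_remove by (auto intro!: arg_cong2[of _ _ _ _ "(*)"] prod.cong)

lemma prod_split_if_sum:
  "(\<Prod>i\<in>{1..l}. \<Sum>a\<in>A. (if i = r then f else g i) a) = (\<Sum>a\<in>A. f a) * (\<Prod>i\<in>{1..l}-{r}. \<Sum>a\<in>A. g i a :: real)"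
  unfolding prod_remove by (auto intro!: arg_cong2[of _ _ _ _ "(*)"] prod.cong)

lemma others_nonneg: "0 \<le> others c"
  unfolding others_def by (intro prod_nonneg q0)

lemma C_nonneg: "0 \<le> C"
  using qC[of r] q0 by (meson sum_nonneg mult_nonneg_nonneg of_nat_0_le_iff order_trans)

lemma sum_others: "(\<Sum>c\<in>sizes N. f (c r) * others c) = (\<Sum>a\<in>{1..N}. f a)" for f :: "nat \<Rightarrow> real"
proof -
  have "(\<Sum>c\<in>sizes N. f (c r) * others c) = (\<Sum>c\<in>sizes N. \<Prod>i\<in>{1..l}. (if i = r then f else q i) (c i))"
    unfolding others_def prod_split_if ..
  also have "\<dots> = (\<Prod>i\<in>{1..l}. \<Sum>a\<in>{1..N}. (if i = r then f else q i) a)" by (rule sum_sizes_prod)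
  also have "\<dots> = (\<Sum>a\<in>{1..N}. f a) * (\<Prod>i\<in>{1..l}-{r}. \<Sum>a\<in>{1..N}. q i a)"
    by (rule prod_split_if_sum)
  finally show ?thesis by (simp add: q1)
qed

lemma sum_others_mean:
  fixes f :: "nat \<Rightarrow> real"
  assumes j: "j \<in> {1..l}-{r}" and f: "\<And>a. 0 \<le> f a"
  shows "(\<Sum>c\<in>sizes N. f (c r) * others c * real (c j)) \<le> (\<Sum>a\<in>{1..N}. f a) * C"
proof -
  let ?g = "\<lambda>i a. if i = j then real a * q i a else q i a"
  have sp: "(\<Prod>i\<in>{1..l}-{r}. P i) = P j * (\<Prod>i\<in>{1..l}-{r}-{j}. P i)" for P :: "nat \<Rightarrow> real"
    using j by (intro prod.remove) auto
  have "(\<Sum>c\<in>sizes N. f (c r) * others c * real (c j))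
    = (\<Sum>c\<in>sizes N. \<Prod>i\<in>{1..l}. (if i = r then f else ?g i) (c i))"
  proof (intro sum.cong refl)
    fix c
    have "(\<Prod>i\<in>{1..l}. (if i = r then f else ?g i) (c i)) = f (c r) * (\<Prod>i\<in>{1..l}-{r}. ?g i (c i))"
      by (rule prod_split_if)
    also have "(\<Prod>i\<in>{1..l}-{r}. ?g i (c i)) = real (c j) * others c"
      unfolding others_def sp by simp
    finally show "f (c r) * others c * real (c j) = (\<Prod>i\<in>{1..l}. (if i = r then f else ?g i) (c i))" by simp
  qed
  also have "\<dots> = (\<Prod>i\<in>{1..l}. \<Sum>a\<in>{1..N}. (if i = r then f else ?g i) a)" by (rule sum_sizes_prod)
  also have "\<dots> = (\<Sum>a\<in>{1..N}. f a) * (\<Prod>i\<in>{1..l}-{r}. \<Sum>a\<in>{1..N}. ?g i a)"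
    by (rule prod_split_if_sum)
  also have "(\<Prod>i\<in>{1..l}-{r}. \<Sum>a\<in>{1..N}. ?g i a) = (\<Sum>a\<in>{1..N}. real a * q j a)"
    unfolding sp by (simp add: q1)
  also have "(\<Sum>a\<in>{1..N}. f a) * (\<Sum>a\<in>{1..N}. real a * q j a) \<le> (\<Sum>a\<in>{1..N}. f a) * C"
    by (intro mult_left_mono qC sum_nonneg f)
  finally show ?thesis .
qed

definition own :: "(nat \<Rightarrow> real) \<Rightarrow> nat \<Rightarrow> real" where
  "own g k = (\<Sum>c\<in>sizes N. g (c r) * others c * (real (c r) * (of_bool (new_size c r = k) - of_bool (c r = k))))"

definition rest :: "(nat \<Rightarrow> real) \<Rightarrow> nat \<Rightarrow> real" where
  "rest g k = (\<Sum>c\<in>sizes N. g (c r) * others c *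
     (\<Sum>j\<in>{1..l}-{r}. real (c j) * (of_bool (new_size c j = k) - of_bool (c j = k))))"

lemma own_rest: "(\<Sum>c\<in>sizes N. g (c r) * others c * size_change c k) = own g k + rest g k"
  unfolding own_def rest_def sum.distrib[symmetric]
  by (intro sum.cong refl) (simp add: size_change_def sum.remove[OF _ r] distrib_left)

lemma own_add: "own (\<lambda>a. g a + g' a) k = own g k + own g' k"
  unfolding own_def sum.distrib[symmetric] by (intro sum.cong refl) (simp add: distrib_right)

lemma sum_of_bool_le: "(\<Sum>k\<in>{1..N}. of_bool (s = k)) \<le> (1::real)"
proof -
  have "(\<Sum>k\<in>{1..N}. of_bool (s = k)) = (\<Sum>k\<in>{1..N}. if k = s then 1 else (0::real))"
    by (intro sum.cong) auto
  then show ?thesis by simp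
qed

lemma sum_abs_of_bool_diff: "(\<Sum>k\<in>{1..N}. \<bar>of_bool (s = k) - of_bool (s' = k)\<bar>) \<le> (2::real)"
proof -
  have "(\<Sum>k\<in>{1..N}. \<bar>of_bool (s = k) - of_bool (s' = k)\<bar>) \<le> (\<Sum>k\<in>{1..N}. of_bool (s = k) + of_bool (s' = k) :: real)"
    by (intro sum_mono) (auto simp: of_bool_def)
  also have "\<dots> \<le> 2" using sum_of_bool_le[of s] sum_of_bool_le[of s'] by (simp add: sum.distrib)
  finally show ?thesis .
qed

text \<open>The factor \<open>real a\<close> is the rate at which a component of size \<open>a\<close> is hit. It is unbounded, and this
estimate is therefore applied to the noise only.\<close>

lemma own_abs_le: "(\<Sum>k\<in>{1..N}. \<bar>own g k\<bar>) \<le> 2 * (\<Sum>a\<in>{1..N}. real a * \<bar>g a\<bar>)"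
proof -
  have "(\<Sum>k\<in>{1..N}. \<bar>own g k\<bar>) \<le> (\<Sum>k\<in>{1..N}. \<Sum>c\<in>sizes N. \<bar>g (c r)\<bar> * others c * real (c r) *
      \<bar>of_bool (new_size c r = k) - of_bool (c r = k)\<bar>)"
    unfolding own_def
    by (intro sum_mono order.trans[OF sum_abs]) (simp add: abs_mult others_nonneg mult.assoc)
  also have "\<dots> = (\<Sum>c\<in>sizes N. \<bar>g (c r)\<bar> * others c * real (c r) *
      (\<Sum>k\<in>{1..N}. \<bar>of_bool (new_size c r = k) - of_bool (c r = k)\<bar>))"
    by (subst sum.swap) (simp add: sum_distrib_left)
  also have "\<dots> \<le> (\<Sum>c\<in>sizes N. \<bar>g (c r)\<bar> * others c * real (c r) * 2)"
    by (intro sum_mono mult_left_mono sum_abs_of_bool_diff mult_nonneg_nonneg others_nonneg) auto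
  also have "\<dots> = 2 * (\<Sum>c\<in>sizes N. (real (c r) * \<bar>g (c r)\<bar>) * others c)"
    by (simp add: sum_distrib_left mult_ac)
  also have "\<dots> = 2 * (\<Sum>a\<in>{1..N}. real a * \<bar>g a\<bar>)"
    by (simp only: sum_others[of "\<lambda>a. real a * \<bar>g a\<bar>"])
  finally show ?thesis .
qed

text \<open>The other components have mean size at most \<open>C\<close>, independently of the size in position \<open>r\<close>.\<close>

lemma rest_abs_le: "(\<Sum>k\<in>{1..N}. \<bar>rest g k\<bar>) \<le> 2 * real l * C * (\<Sum>a\<in>{1..N}. \<bar>g a\<bar>)"
proof -
  let ?d = "\<lambda>c j k. \<bar>of_bool (new_size c j = k) - of_bool (c j = k)\<bar> :: real"
  have "(\<Sum>k\<in>{1..N}. \<bar>rest g k\<bar>) \<le> (\<Sum>k\<in>{1..N}. \<Sum>c\<in>sizes N. \<bar>g (c r)\<bar> * others c *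
     (\<Sum>j\<in>{1..l}-{r}. real (c j) * ?d c j k))"
    unfolding rest_def
  proof (intro sum_mono order.trans[OF sum_abs])
    fix k c
    have "\<bar>\<Sum>j\<in>{1..l}-{r}. real (c j) * (of_bool (new_size c j = k) - of_bool (c j = k))\<bar>
      \<le> (\<Sum>j\<in>{1..l}-{r}. real (c j) * ?d c j k)"
      by (rule order.trans[OF sum_abs]) (simp add: abs_mult)
    then show "\<bar>g (c r) * others c * (\<Sum>j\<in>{1..l}-{r}. real (c j) * (of_bool (new_size c j = k) - of_bool (c j = k)))\<bar>
      \<le> \<bar>g (c r)\<bar> * others c * (\<Sum>j\<in>{1..l}-{r}. real (c j) * ?d c j k)"
      by (simp add: abs_mult others_nonneg mult_left_mono)
  qed
  also have "\<dots> = (\<Sum>c\<in>sizes N. \<bar>g (c r)\<bar> * others c * (\<Sum>j\<in>{1..l}-{r}. real (c j) * (\<Sum>k\<in>{1..N}. ?d c j k)))"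
  proof -
    have inner: "(\<Sum>k\<in>{1..N}. \<Sum>j\<in>{1..l}-{r}. real (c j) * ?d c j k)
      = (\<Sum>j\<in>{1..l}-{r}. real (c j) * (\<Sum>k\<in>{1..N}. ?d c j k))" for c
      unfolding sum_distrib_left by (rule sum.swap)
    show ?thesis by (subst sum.swap) (simp only: sum_distrib_left[symmetric] inner)
  qed
  also have "\<dots> \<le> (\<Sum>c\<in>sizes N. \<bar>g (c r)\<bar> * others c * (\<Sum>j\<in>{1..l}-{r}. real (c j) * 2))"
    by (intro sum_mono mult_left_mono sum_abs_of_bool_diff mult_nonneg_nonneg others_nonneg) auto
  also have "\<dots> = 2 * (\<Sum>j\<in>{1..l}-{r}. \<Sum>c\<in>sizes N. \<bar>g (c r)\<bar> * others c * real (c j))"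
    by (subst sum.swap) (simp add: sum_distrib_left mult_ac)
  also have "\<dots> \<le> 2 * (\<Sum>j\<in>{1..l}-{r}. (\<Sum>a\<in>{1..N}. \<bar>g a\<bar>) * C)"
    by (intro mult_left_mono sum_mono sum_others_mean[of _ "\<lambda>a. \<bar>g a\<bar>"]) auto
  also have "\<dots> \<le> 2 * (real l * ((\<Sum>a\<in>{1..N}. \<bar>g a\<bar>) * C))"
    using r C_nonneg by (intro mult_left_mono) (auto intro!: mult_right_mono mult_nonneg_nonneg sum_nonneg)
  finally show ?thesis by (simp add: mult_ac)
qed

text \<open>The \<open>own\<close> part only moves the mass \<open>d (c r)\<close> from size \<open>c r\<close> to size \<open>new_size c r\<close>. If the fraction
\<open>\<eta> * c r\<close> that moves is at most \<open>1\<close>, then \<open>d + \<eta> * own d\<close> is the image of \<open>d\<close> under a substochastic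
matrix, and its \<open>L\<^sup>1\<close> norm does not grow, however large the rates are.\<close>

lemma own_contraction:
  assumes \<eta>: "0 \<le> \<eta>" "\<eta> * real N \<le> 1"
  shows "(\<Sum>k\<in>{1..N}. \<bar>d k + \<eta> * own d k\<bar>) \<le> (\<Sum>k\<in>{1..N}. \<bar>d k\<bar>)"
proof -
  let ?u = "\<lambda>c k. of_bool (c r = k) * (1 - \<eta> * real (c r)) + \<eta> * real (c r) * of_bool (new_size c r = k) :: real"
  have u0: "0 \<le> ?u c k" if "c \<in> sizes N" for c k
  proof -
    have "c r \<le> N" using PiE_mem[OF that r] by simp
    then have "\<eta> * real (c r) \<le> \<eta> * real N" using \<eta> by (intro mult_left_mono) auto
    then have "\<eta> * real (c r) \<le> 1" using \<eta> by linarith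
    then show ?thesis using \<eta> by simp
  qed
  have usum: "(\<Sum>k\<in>{1..N}. ?u c k) \<le> 1" if "c \<in> sizes N" for c
  proof -
    have "c r \<le> N" using PiE_mem[OF that r] by simp
    then have "\<eta> * real (c r) \<le> \<eta> * real N" using \<eta> by (intro mult_left_mono) auto
    then have le1: "\<eta> * real (c r) \<le> 1" using \<eta> by linarith
    have "(\<Sum>k\<in>{1..N}. ?u c k) = (\<Sum>k\<in>{1..N}. of_bool (c r = k)) * (1 - \<eta> * real (c r))
      + \<eta> * real (c r) * (\<Sum>k\<in>{1..N}. of_bool (new_size c r = k))"
      by (simp only: sum.distrib sum_distrib_right sum_distrib_left)
    also have "\<dots> \<le> 1 * (1 - \<eta> * real (c r)) + \<eta> * real (c r) * 1"
      using le1 \<eta> by (intro add_mono mult_right_mono mult_left_mono sum_of_bool_le) auto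
    finally show ?thesis by simp
  qed
  have eq: "d k + \<eta> * own d k = (\<Sum>c\<in>sizes N. d (c r) * others c * ?u c k)" if k: "k \<in> {1..N}" for k
  proof -
    have "d k = (\<Sum>a\<in>{1..N}. if a = k then d a else 0)" using k by simp
    also have "\<dots> = (\<Sum>a\<in>{1..N}. d a * of_bool (a = k))" by (intro sum.cong) auto
    also have "\<dots> = (\<Sum>c\<in>sizes N. (d (c r) * of_bool (c r = k)) * others c)"
      by (rule sum_others[symmetric])
    finally have "d k + \<eta> * own d k = (\<Sum>c\<in>sizes N. (d (c r) * of_bool (c r = k)) * others c) + \<eta> * own d k" by simp
    also have "\<dots> = (\<Sum>c\<in>sizes N. d (c r) * others c * ?u c k)"
      unfolding own_def sum_distrib_left sum.distrib[symmetric]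
      by (intro sum.cong refl) (simp add: algebra_simps)
    finally show ?thesis .
  qed
  have "(\<Sum>k\<in>{1..N}. \<bar>d k + \<eta> * own d k\<bar>) \<le> (\<Sum>k\<in>{1..N}. \<Sum>c\<in>sizes N. \<bar>d (c r)\<bar> * others c * ?u c k)"
  proof (rule sum_mono)
    fix k assume k: "k \<in> {1..N}"
    have "\<bar>\<Sum>c\<in>sizes N. d (c r) * others c * ?u c k\<bar> \<le> (\<Sum>c\<in>sizes N. \<bar>d (c r) * others c * ?u c k\<bar>)" by (rule sum_abs)
    also have "\<dots> = (\<Sum>c\<in>sizes N. \<bar>d (c r)\<bar> * others c * ?u c k)"
      using u0 by (intro sum.cong refl) (simp only: abs_mult abs_of_nonneg[OF others_nonneg] abs_of_nonneg)
    finally show "\<bar>d k + \<eta> * own d k\<bar> \<le> (\<Sum>c\<in>sizes N. \<bar>d (c r)\<bar> * others c * ?u c k)" using eq[OF k] by simp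
  qed
  also have "\<dots> = (\<Sum>c\<in>sizes N. \<bar>d (c r)\<bar> * others c * (\<Sum>k\<in>{1..N}. ?u c k))"
    by (subst sum.swap) (simp only: sum_distrib_left)
  also have "\<dots> \<le> (\<Sum>c\<in>sizes N. \<bar>d (c r)\<bar> * others c * 1)"
    by (intro sum_mono mult_left_mono usum mult_nonneg_nonneg others_nonneg) auto
  also have "\<dots> = (\<Sum>k\<in>{1..N}. \<bar>d k\<bar>)" using sum_others[of "\<lambda>a. \<bar>d a\<bar>"] by simp
  finally show ?thesis .
qed

end

text \<open>The product density of \<open>x\<close> is changed into that of \<open>y\<close> one position at a time.\<close>

lemma drift_telescope:
  fixes x y :: "nat \<Rightarrow> real"
  assumes x: "size_dist N C x" and y: "size_dist N C y"
  shows "drift N (\<lambda>_. x) k - drift N (\<lambda>_. y) k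
    = (\<Sum>r\<in>{1..l}. own N r (\<lambda>i. if i < r then x else y) (\<lambda>a. x a - y a) k
                 + rest N r (\<lambda>i. if i < r then x else y) (\<lambda>a. x a - y a) k)"
proof -
  let ?G = "\<lambda>r. drift N (\<lambda>i. if i < r then x else y) k"
  have "?G (Suc r) - ?G r = own N r (\<lambda>i. if i < r then x else y) (\<lambda>a. x a - y a) k
                 + rest N r (\<lambda>i. if i < r then x else y) (\<lambda>a. x a - y a) k" if r: "r \<in> {1..l}" for r
  proof -
    let ?q = "\<lambda>i. if i < r then x else y"
    have q: "size_dist N C (?q i)" for i using x y by simp
    have "?G (Suc r) - ?G r = (\<Sum>c\<in>sizes N. (x (c r) - y (c r)) * others r ?q c * size_change c k)"
      unfolding drift_def sum_subtractf[symmetric]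
    proof (intro sum.cong refl)
      fix c
      have "(\<Prod>j\<in>{1..l}. (if j < Suc r then x else y) (c j)) = x (c r) * others r ?q c"
        unfolding others_def[OF r q] using r by (subst prod.remove[of _ r]) (auto intro!: prod.cong simp: less_Suc_eq)
      moreover have "(\<Prod>j\<in>{1..l}. (if j < r then x else y) (c j)) = y (c r) * others r ?q c"
        unfolding others_def[OF r q] using r by (subst prod.remove[of _ r]) (auto intro!: prod.cong)
      ultimately show "(\<Prod>j\<in>{1..l}. (if j < Suc r then x else y) (c j)) * size_change c k
        - (\<Prod>j\<in>{1..l}. (if j < r then x else y) (c j)) * size_change c k
        = (x (c r) - y (c r)) * others r ?q c * size_change c k" by (simp add: algebra_simps)
    qed
    also have "\<dots> = own N r ?q (\<lambda>a. x a - y a) k + rest N r ?q (\<lambda>a. x a - y a) k"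
      by (rule own_rest[OF r q])
    finally show ?thesis .
  qed
  then have "(\<Sum>r\<in>{1..l}. own N r (\<lambda>i. if i < r then x else y) (\<lambda>a. x a - y a) k
                 + rest N r (\<lambda>i. if i < r then x else y) (\<lambda>a. x a - y a) k) = (\<Sum>r\<in>{1..l}. ?G (Suc r) - ?G r)"
    by simp
  also have "\<dots> = ?G (Suc l) - ?G 1" by (rule sum_Suc_diff) simp
  also have "?G (Suc l) = drift N (\<lambda>_. x) k" unfolding drift_def by (intro sum.cong refl) auto
  also have "?G 1 = drift N (\<lambda>_. y) k" unfolding drift_def by (intro sum.cong refl) auto
  finally show ?thesis by simp
qed

text \<open>Let \<open>x\<close> and \<open>y\<close> be the densities of two runs, \<open>d\<close> the difference of their Euler schemes and \<open>e\<close> the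
difference of their noises. The \<open>own\<close> parts of \<open>d\<close> are harmless by \<open>own_contraction\<close>, used with
\<open>\<eta> = h * l\<close> because \<open>d\<close> has to be shared out evenly among the \<open>l\<close> positions. The \<open>rest\<close> parts are
Lipschitz, and only the noise is measured in the stronger norm with weights \<open>k\<close>.\<close>

lemma euler_step_stable:
  assumes x: "size_dist N C x" and y: "size_dist N C y"
    and de: "\<And>k. k \<in> {1..N} \<Longrightarrow> x k - y k = d k + e k"
    and h: "0 \<le> h" "h * real l * real N \<le> 1"
  shows "(\<Sum>k\<in>{1..N}. \<bar>d k + h * (drift N (\<lambda>_. x) k - drift N (\<lambda>_. y) k)\<bar>)
    \<le> (1 + h * (2 * real l ^ 2 * C)) * (\<Sum>k\<in>{1..N}. \<bar>d k\<bar>)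
      + h * (2 * real l + 2 * real l ^ 2 * C) * (\<Sum>k\<in>{1..N}. real k * \<bar>e k\<bar>)"
proof -
  let ?q = "\<lambda>r i. if i < r then x else y"
  have q: "size_dist N C (?q r i)" for r i using x y by simp
  let ?D = "\<Sum>k\<in>{1..N}. \<bar>d k\<bar>" and ?W = "\<Sum>k\<in>{1..N}. real k * \<bar>e k\<bar>"
  let ?g = "\<lambda>a. x a - y a"
  have l0: "0 < real l" using l2 by simp
  have C0: "0 \<le> C" using C_nonneg[of 1 N C "\<lambda>_. x"] x l2 by auto
  have E: "(\<Sum>k\<in>{1..N}. \<bar>e k\<bar>) \<le> ?W"
    by (rule sum_mono) (use mult_right_mono[of 1 _ "\<bar>e _\<bar>"] in auto)
  have g: "(\<Sum>k\<in>{1..N}. \<bar>?g k\<bar>) \<le> ?D + ?W"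
  proof -
    have "(\<Sum>k\<in>{1..N}. \<bar>?g k\<bar>) \<le> (\<Sum>k\<in>{1..N}. \<bar>d k\<bar> + \<bar>e k\<bar>)" by (intro sum_mono) (use de in auto)
    then show ?thesis using E by (simp add: sum.distrib)
  qed
  have own_split: "own N r (?q r) ?g k = own N r (?q r) d k + own N r (?q r) e k" if "r \<in> {1..l}" for r k
  proof -
    have "own N r (?q r) ?g k = own N r (?q r) (\<lambda>a. d a + e a) k"
      unfolding own_def[OF that q]
    proof (rule sum.cong[OF refl])
      fix c assume "c \<in> sizes N"
      from de[OF PiE_mem[OF this that]]
      show "(x (c r) - y (c r)) * others r (?q r) c * (real (c r) * (of_bool (new_size c r = k) - of_bool (c r = k)))
        = (d (c r) + e (c r)) * others r (?q r) c * (real (c r) * (of_bool (new_size c r = k) - of_bool (c r = k)))"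
        by (simp only:)
    qed
    then show ?thesis by (simp only: own_add[OF that q])
  qed
  have key: "d k + h * (drift N (\<lambda>_. x) k - drift N (\<lambda>_. y) k)
    = (\<Sum>r\<in>{1..l}. (d k + h * real l * own N r (?q r) d k) / real l
        + h * own N r (?q r) e k + h * rest N r (?q r) ?g k)" for k
  proof -
    have "(\<Sum>r\<in>{1..l}. (d k + h * real l * own N r (?q r) d k) / real l
        + h * own N r (?q r) e k + h * rest N r (?q r) ?g k)
      = (\<Sum>r\<in>{1..l}. d k / real l + h * (own N r (?q r) ?g k + rest N r (?q r) ?g k))"
      by (intro sum.cong refl) (use l0 in \<open>simp add: own_split field_simps\<close>)
    also have "\<dots> = d k + h * (\<Sum>r\<in>{1..l}. own N r (?q r) ?g k + rest N r (?q r) ?g k)"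
      using l0 by (simp only: sum.distrib[of "\<lambda>_. d k / real l"] sum_distrib_left[symmetric]) simp
    finally show ?thesis unfolding drift_telescope[OF x y] by simp
  qed
  have "(\<Sum>k\<in>{1..N}. \<bar>d k + h * (drift N (\<lambda>_. x) k - drift N (\<lambda>_. y) k)\<bar>)
    \<le> (\<Sum>k\<in>{1..N}. \<Sum>r\<in>{1..l}. \<bar>d k + h * real l * own N r (?q r) d k\<bar> / real l
        + h * \<bar>own N r (?q r) e k\<bar> + h * \<bar>rest N r (?q r) ?g k\<bar>)"
    unfolding key
  proof (intro sum_mono order.trans[OF sum_abs])
    fix k r
    have tri: "\<bar>u + v + w\<bar> \<le> \<bar>u\<bar> + \<bar>v\<bar> + \<bar>w\<bar>" for u v w :: real by linarith
    show "\<bar>(d k + h * real l * own N r (?q r) d k) / real l + h * own N r (?q r) e k + h * rest N r (?q r) ?g k\<bar>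
      \<le> \<bar>d k + h * real l * own N r (?q r) d k\<bar> / real l + h * \<bar>own N r (?q r) e k\<bar> + h * \<bar>rest N r (?q r) ?g k\<bar>"
      using h(1) by (intro order.trans[OF tri]) (simp add: abs_mult abs_divide)
  qed
  also have "\<dots> = (\<Sum>r\<in>{1..l}. (\<Sum>k\<in>{1..N}. \<bar>d k + h * real l * own N r (?q r) d k\<bar>) / real l
        + h * (\<Sum>k\<in>{1..N}. \<bar>own N r (?q r) e k\<bar>) + h * (\<Sum>k\<in>{1..N}. \<bar>rest N r (?q r) ?g k\<bar>))"
    by (subst sum.swap) (simp only: sum.distrib sum_distrib_left sum_divide_distrib)
  also have "\<dots> \<le> (\<Sum>r\<in>{1..l}. ?D / real l + h * (2 * ?W) + h * (2 * real l * C * (?D + ?W)))"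
  proof (rule sum_mono)
    fix r assume r: "r \<in> {1..l}"
    have "(\<Sum>k\<in>{1..N}. \<bar>rest N r (?q r) ?g k\<bar>) \<le> 2 * real l * C * (\<Sum>k\<in>{1..N}. \<bar>?g k\<bar>)"
      by (rule rest_abs_le[OF r q])
    also have "\<dots> \<le> 2 * real l * C * (?D + ?W)" using C0 by (intro mult_left_mono g) auto
    finally show "(\<Sum>k\<in>{1..N}. \<bar>d k + h * real l * own N r (?q r) d k\<bar>) / real l
        + h * (\<Sum>k\<in>{1..N}. \<bar>own N r (?q r) e k\<bar>) + h * (\<Sum>k\<in>{1..N}. \<bar>rest N r (?q r) ?g k\<bar>)
      \<le> ?D / real l + h * (2 * ?W) + h * (2 * real l * C * (?D + ?W))"
      using h by (intro add_mono divide_right_mono mult_left_mono own_contraction[OF r q] own_abs_le[OF r q]) auto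
  qed
  also have "\<dots> = real l * (?D / real l + h * (2 * ?W) + h * (2 * real l * C * (?D + ?W)))" by simp
  also have "\<dots> = (1 + h * (2 * real l ^ 2 * C)) * ?D + h * (2 * real l + 2 * real l ^ 2 * C) * ?W"
    using l0 by (simp add: algebra_simps power2_eq_square)
  finally show ?thesis .
qed

end

section \<open>Comparison of runs with different numbers of vertices\<close>

lemma discrete_gronwall:
  fixes D :: "nat \<Rightarrow> real"
  assumes D0: "D 0 = 0" and \<alpha>: "0 \<le> \<alpha>" and \<gamma>: "0 \<le> \<gamma>"
    and step: "\<And>j. j < m \<Longrightarrow> D (Suc j) \<le> (1 + \<alpha>) * D j + \<gamma>"
  shows "j \<le> m \<Longrightarrow> D j \<le> exp (\<alpha> * real j) * (real j * \<gamma>)"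
proof (induction j)
  case 0 then show ?case using D0 by simp
next
  case (Suc j)
  have "D (Suc j) \<le> (1 + \<alpha>) * D j + \<gamma>" using step Suc.prems by auto
  also have "\<dots> \<le> exp \<alpha> * (exp (\<alpha> * real j) * (real j * \<gamma>)) + exp (\<alpha> * real (Suc j)) * \<gamma>"
  proof (intro add_mono)
    have "(1 + \<alpha>) * D j \<le> (1 + \<alpha>) * (exp (\<alpha> * real j) * (real j * \<gamma>))"
      using Suc \<alpha> by (intro mult_left_mono) auto
    also have "\<dots> \<le> exp \<alpha> * (exp (\<alpha> * real j) * (real j * \<gamma>))"
      using \<gamma> by (intro mult_right_mono exp_ge_add_one_self) auto
    finally show "(1 + \<alpha>) * D j \<le> exp \<alpha> * (exp (\<alpha> * real j) * (real j * \<gamma>))" .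
    have "1 * \<gamma> \<le> exp (\<alpha> * real (Suc j)) * \<gamma>"
      using \<alpha> \<gamma> by (intro mult_right_mono) (auto simp: mult_nonneg_nonneg)
    then show "\<gamma> \<le> exp (\<alpha> * real (Suc j)) * \<gamma>" by simp
  qed
  also have "\<dots> = exp (\<alpha> * real (Suc j)) * (real (Suc j) * \<gamma>)"
    by (simp add: exp_add algebra_simps)
  finally show ?case .
qed

lemma sum_div_blocks:
  fixes f :: "nat \<Rightarrow> real"
  assumes "0 < m"
  shows "(\<Sum>j'<j. f (j' div m)) = real m * (\<Sum>i<j div m. f i) + real (j mod m) * f (j div m)"
proof -
  let ?i = "j div m" and ?r = "j mod m"
  have j: "j = ?i * m + ?r" by simp
  have dv: "j' div m = i" if "i * m \<le> j'" "j' < i * m + m" for i j'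
    using that by (intro div_nat_eqI) (auto simp: mult.commute)
  have "{..<a + b} = {..<a} \<union> {a..<a + b}" for a b :: nat by auto
  from this[of "?i * m" ?r] have "{..<j} = {..<?i * m} \<union> {?i * m..<?i * m + ?r}"
    by (simp only: div_mult_mod_eq)
  then have "(\<Sum>j'<j. f (j' div m)) = (\<Sum>j'\<in>{..<?i * m} \<union> {?i * m..<?i * m + ?r}. f (j' div m))"
    by (rule arg_cong[where f = "sum (\<lambda>j'. f (j' div m))"])
  also have "\<dots> = (\<Sum>j'<?i * m. f (j' div m)) + (\<Sum>j'\<in>{?i * m..<?i * m + ?r}. f (j' div m))"
    by (rule sum.union_disjoint) auto
  also have "(\<Sum>j'<?i * m. f (j' div m)) = (\<Sum>i<?i. \<Sum>j'\<in>{i * m..<i * m + m}. f (j' div m))"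
    by (rule sum.nat_group[symmetric])
  also have "\<dots> = (\<Sum>i<?i. \<Sum>j'\<in>{i * m..<i * m + m}. f i)"
  proof (intro sum.cong refl arg_cong[where f = f])
    fix i j' assume "j' \<in> {i * m..<i * m + m}"
    then show "j' div m = i" by (intro dv) auto
  qed
  also have "\<dots> = real m * (\<Sum>i<?i. f i)" by (simp add: sum_distrib_left)
  also have "(\<Sum>j'\<in>{?i * m..<?i * m + ?r}. f (j' div m)) = (\<Sum>j'\<in>{?i * m..<?i * m + ?r}. f ?i)"
  proof (intro sum.cong refl arg_cong[where f = f])
    fix j' assume j': "j' \<in> {?i * m..<?i * m + ?r}"
    have "?r < m" using assms by simp
    then show "j' div m = ?i" using j' by (intro dv) (simp_all only: atLeastLessThan_iff, linarith)
  qed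
  finally show ?thesis by (simp only: sum_constant card_atLeastLessThan add_diff_cancel_left')
qed

context size_rule_process
begin

text \<open>Initial density plus accumulated drift, at the densities that the run actually visits. It differs
from an exact solution of the Euler scheme by the feedback of the noise.\<close>

definition euler :: "nat \<Rightarrow> (nat \<Rightarrow> nat \<Rightarrow> real) \<Rightarrow> nat \<Rightarrow> nat \<Rightarrow> real" where
  "euler n x i k = of_bool (k = 1) + (\<Sum>j<i. drift n (\<lambda>_. x j) k) / n"

definition good_run :: "nat \<Rightarrow> nat \<Rightarrow> real \<Rightarrow> real \<Rightarrow> real \<Rightarrow> (nat \<Rightarrow> nat \<Rightarrow> real) \<Rightarrow> bool" where
  "good_run n T K C \<mu> x \<longleftrightarrow> 0 < n \<and> 1 \<le> K \<and> real l * K \<le> real n \<and> 0 \<le> \<mu> \<and>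
     (\<forall>i\<le>T. size_dist n C (x i) \<and> x i 0 = 0 \<and> (\<forall>k. K < real k \<longrightarrow> x i k = 0) \<and>
       (\<forall>k\<in>{1..n}. \<bar>x i k - euler n x i k\<bar> \<le> \<mu>))"

text \<open>The distance, in the norm with weights \<open>k\<close>, between a good run and its Euler scheme on a refined
lattice: the noise \<open>\<mu>\<close> occurs for at most \<open>l * K\<close> sizes, and within one step of length \<open>1/n\<close> the
scheme moves by the norm of the drift divided by \<open>n\<close>.\<close>

definition run_error :: "nat \<Rightarrow> real \<Rightarrow> real \<Rightarrow> real \<Rightarrow> real" where
  "run_error n K C \<mu> = (real l * K)\<^sup>2 * \<mu> + 4 * real l ^ 2 * K * C / n"

lemma size_dist_extend:
  assumes "size_dist n C p" "n \<le> N" "\<And>k. n < k \<Longrightarrow> p k = 0"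
  shows "size_dist N C p"
proof -
  have "(\<Sum>k\<in>{1..N}. p k) = (\<Sum>k\<in>{1..n}. p k)" "(\<Sum>k\<in>{1..N}. real k * p k) = (\<Sum>k\<in>{1..n}. real k * p k)"
    by (rule sum.mono_neutral_right; use assms in auto)+
  then show ?thesis using assms(1) by (simp add: size_dist_def)
qed

lemma drift_extend:
  assumes "n \<le> N" "\<And>k. n < k \<Longrightarrow> x k = 0"
  shows "drift N (\<lambda>_. x) k = drift n (\<lambda>_. x) k"
  unfolding drift_def
proof (rule sum.mono_neutral_right)
  show "sizes n \<subseteq> sizes N" using assms(1) by (intro PiE_mono) auto
  show "\<forall>c\<in>sizes N - sizes n. (\<Prod>j\<in>{1..l}. x (c j)) * size_change c k = 0"
  proof
    fix c assume c: "c \<in> sizes N - sizes n"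
    then obtain j where j: "j \<in> {1..l}" "c j \<notin> {1..n}" by (auto simp: PiE_iff)
    moreover have "c j \<in> {1..N}" using c j(1) by (auto simp: PiE_iff)
    ultimately have "x (c j) = 0" using assms(2) by auto
    then have "(\<Prod>j\<in>{1..l}. x (c j)) = 0" using j(1) by (intro prod_zero) auto
    then show "(\<Prod>j\<in>{1..l}. x (c j)) * size_change c k = 0" by simp
  qed
qed simp

lemma drift_large:
  assumes "\<And>k. K < real k \<Longrightarrow> x k = 0" "real l * K < real k"
  shows "drift N (\<lambda>_. x) k = 0"
  unfolding drift_def
proof (rule sum.neutral, rule ballI)
  fix c assume "c \<in> sizes N"
  show "(\<Prod>j\<in>{1..l}. x (c j)) * size_change c k = 0"
  proof (cases "\<exists>j\<in>{1..l}. K < real (c j)")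
    case True
    then have "(\<Prod>j\<in>{1..l}. x (c j)) = 0" using assms(1) by (intro prod_zero) auto
    then show ?thesis by simp
  next
    case False
    then have "(\<Sum>j\<in>{1..l}. real (c j)) \<le> (\<Sum>j\<in>{1..l}. K)" by (intro sum_mono) (meson not_le)
    then have "real (\<Sum>j\<in>{1..l}. c j) < real k" using assms(2) by simp
    then have "(\<Sum>j\<in>{1..l}. c j) < k" by (simp only: of_nat_less_iff)
    then show ?thesis by (simp add: size_change_large)
  qed
qed

lemma drift_weighted_le:
  assumes x: "size_dist N C x" and K: "\<And>k. K < real k \<Longrightarrow> x k = 0" "1 \<le> K"
  shows "(\<Sum>k\<in>{1..N}. real k * \<bar>drift N (\<lambda>_. x) k\<bar>) \<le> 4 * real l ^ 2 * K * C"
proof -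
  have r: "1 \<in> {1..l}" using l2 by simp
  have eq: "drift N (\<lambda>_. x) k = own N 1 (\<lambda>_. x) x k + rest N 1 (\<lambda>_. x) x k" for k
    unfolding own_rest[OF r x, symmetric] drift_def
    by (intro sum.cong refl) (simp add: prod_remove[OF r x, of "\<lambda>j. x (_ j)"] others_def[OF r x])
  have C0: "0 \<le> C" by (rule C_nonneg[OF r x])
  have "(\<Sum>k\<in>{1..N}. \<bar>drift N (\<lambda>_. x) k\<bar>) \<le> (\<Sum>k\<in>{1..N}. \<bar>own N 1 (\<lambda>_. x) x k\<bar> + \<bar>rest N 1 (\<lambda>_. x) x k\<bar>)"
    unfolding eq by (intro sum_mono abs_triangle_ineq)
  also have "\<dots> \<le> 2 * (\<Sum>a\<in>{1..N}. real a * \<bar>x a\<bar>) + 2 * real l * C * (\<Sum>a\<in>{1..N}. \<bar>x a\<bar>)"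
    unfolding sum.distrib by (intro add_mono own_abs_le[OF r x] rest_abs_le[OF r x])
  also have "\<dots> \<le> 2 * C + 2 * real l * C * 1"
    using x C0 by (intro add_mono mult_left_mono) (auto simp: size_dist_def)
  also have "\<dots> \<le> 4 * real l * C"   proof -
    have "1 * C \<le> real l * C" using l2 C0 by (intro mult_right_mono) auto
    then show ?thesis by (simp add: algebra_simps)
  qed
  finally have D: "(\<Sum>k\<in>{1..N}. \<bar>drift N (\<lambda>_. x) k\<bar>) \<le> 4 * real l * C" .
  have "(\<Sum>k\<in>{1..N}. real k * \<bar>drift N (\<lambda>_. x) k\<bar>) \<le> (\<Sum>k\<in>{1..N}. (real l * K) * \<bar>drift N (\<lambda>_. x) k\<bar>)"
  proof (rule sum_mono)
    fix k
    show "real k * \<bar>drift N (\<lambda>_. x) k\<bar> \<le> real l * K * \<bar>drift N (\<lambda>_. x) k\<bar>"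
    proof (cases "real l * K < real k")
      case True then show ?thesis using drift_large[OF K(1) True] by simp
    next
      case False then show ?thesis by (intro mult_right_mono) auto
    qed
  qed
  also have "\<dots> \<le> (real l * K) * (4 * real l * C)"
    unfolding sum_distrib_left[symmetric] using K by (intro mult_left_mono D) auto
  finally show ?thesis by (simp add: power2_eq_square mult_ac)
qed

context
  fixes n T :: nat and K C \<mu> :: real and x :: "nat \<Rightarrow> nat \<Rightarrow> real" and N m :: nat
  assumes run: "good_run n T K C \<mu> x" and nN: "n \<le> N" and m: "0 < m"
begin

text \<open>The Euler scheme of the run interpolated at mesh \<open>1 / (n * m)\<close>. Schemes for \<open>n\<close> and for \<open>m\<close> vertices can
be compared at this common mesh; the mesh is also short enough for \<open>own_contraction\<close>.\<close>

definition refined :: "nat \<Rightarrow> nat \<Rightarrow> real" where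
  "refined j k = of_bool (k = 1) + 1 / (real n * real m) * (\<Sum>j'<j. drift N (\<lambda>_. x (j' div m)) k)"

lemma run_n: "0 < n" "1 \<le> K" "real l * K \<le> real n" "0 \<le> \<mu>"
  using run by (auto simp: good_run_def)

lemma run_zero:
  assumes "i \<le> T" shows "K < real k \<Longrightarrow> x i k = 0" "n < k \<Longrightarrow> x i k = 0"
proof -
  show *: "K < real k \<Longrightarrow> x i k = 0" using run assms by (auto simp: good_run_def)
  have "K \<le> real l * K" using run_n l2 mult_right_mono[of 1 "real l" K] by simp
  then show "n < k \<Longrightarrow> x i k = 0" using run_n by (intro *) linarith
qed

lemma run_dist: "i \<le> T \<Longrightarrow> size_dist N C (x i)"
  using run run_zero(2) by (intro size_dist_extend[OF _ nN]) (auto simp: good_run_def)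

lemma run_near_euler:
  assumes i: "i \<le> T" and k: "1 \<le> k"
  shows "\<bar>x i k - euler n x i k\<bar> \<le> \<mu> * of_bool (real k \<le> real l * K)"
proof (cases "real k \<le> real l * K")
  case True
  then have "k \<in> {1..n}" using k run_n by simp
  then show ?thesis using run i True by (auto simp: good_run_def)
next
  case False
  have lK: "K \<le> real l * K" "1 < real l * K"
    using run_n l2 mult_right_mono[of 1 "real l" K] mult_mono[of 2 "real l" 1 K] by auto
  have "x i k = 0" using False lK by (intro run_zero i) auto
  moreover have "k \<noteq> 1" using False lK by auto
  moreover have "drift n (\<lambda>_. x j) k = 0" if "j < i" for j
    using False i that by (intro drift_large[of K]) (auto intro: run_zero)
  ultimately show ?thesis using False by (simp add: euler_def)
qed

lemma refined_near_run:
  assumes j: "j div m \<le> T"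
  shows "(\<Sum>k\<in>{1..N}. real k * \<bar>x (j div m) k - refined j k\<bar>) \<le> run_error n K C \<mu>"
proof -
  let ?i = "j div m" and ?r = "j mod m"
  let ?s = "real ?r / (real n * real m)"
  have pos: "0 < real n" "0 < real m" using run_n m by auto
  have lK0: "0 \<le> real l * K" using run_n by simp
  have refined_eq: "refined j k = euler n x ?i k + ?s * drift N (\<lambda>_. x ?i) k" for k
  proof -
    have "(\<Sum>i<?i. drift N (\<lambda>_. x i) k) = (\<Sum>i<?i. drift n (\<lambda>_. x i) k)"
      using j by (intro sum.cong refl drift_extend nN) (auto intro: run_zero)
    then show ?thesis
      unfolding refined_def euler_def sum_div_blocks[OF m, of "\<lambda>i. drift N (\<lambda>_. x i) k"]
      using pos by (simp add: field_simps)
  qed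
  have s: "0 \<le> ?s" "?s \<le> 1 / n"
  proof -
    have "real ?r \<le> real m" using m mod_less_divisor[OF m, of j] by simp
    then show "?s \<le> 1 / n" using pos by (simp add: field_simps)
  qed simp
  have cardK: "(\<Sum>k\<in>{1..N}. real k * (\<mu> * of_bool (real k \<le> real l * K))) \<le> (real l * K)\<^sup>2 * \<mu>"
  proof -
    have "(\<Sum>k\<in>{1..N}. real k * (\<mu> * of_bool (real k \<le> real l * K))) \<le> (\<Sum>k\<in>{1..N}. (real l * K) * \<mu> * of_bool (real k \<le> real l * K))"
      using run_n by (intro sum_mono) (auto simp: of_bool_def mult_right_mono)
    also have "\<dots> = (real l * K) * \<mu> * real (card {k \<in> {1..N}. real k \<le> real l * K})"
      by (simp add: sum_distrib_left[symmetric] of_bool_def sum.If_cases Int_def)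
    also have "\<dots> \<le> (real l * K) * \<mu> * (real l * K)"
    proof (intro mult_left_mono)
      have "card {k \<in> {1..N}. real k \<le> real l * K} \<le> card {1..nat \<lfloor>real l * K\<rfloor>}"
        by (intro card_mono) (auto simp: le_nat_floor)
      then have "real (card {k \<in> {1..N}. real k \<le> real l * K}) \<le> real (nat \<lfloor>real l * K\<rfloor>)" by simp
      also have "\<dots> \<le> real l * K" using lK0 by simp
      finally show "real (card {k \<in> {1..N}. real k \<le> real l * K}) \<le> real l * K" .
    qed (use run_n lK0 in auto)
    finally show ?thesis by (simp add: power2_eq_square mult_ac)
  qed
  have "(\<Sum>k\<in>{1..N}. real k * \<bar>x ?i k - refined j k\<bar>)
    \<le> (\<Sum>k\<in>{1..N}. real k * (\<mu> * of_bool (real k \<le> real l * K)) + ?s * (real k * \<bar>drift N (\<lambda>_. x ?i) k\<bar>))"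
  proof (rule sum_mono)
    fix k assume "k \<in> {1..N}"
    then have k: "1 \<le> k" by simp
    have tri: "\<bar>a - (b + c)\<bar> \<le> \<bar>a - b\<bar> + \<bar>c\<bar>" for a b c :: real by linarith
    have "\<bar>x ?i k - refined j k\<bar> \<le> \<bar>x ?i k - euler n x ?i k\<bar> + \<bar>?s * drift N (\<lambda>_. x ?i) k\<bar>"
      unfolding refined_eq by (rule tri)
    also have "\<bar>?s * drift N (\<lambda>_. x ?i) k\<bar> = ?s * \<bar>drift N (\<lambda>_. x ?i) k\<bar>" by (simp only: abs_mult abs_of_nonneg[OF s(1)])
    also have "\<bar>x ?i k - euler n x ?i k\<bar> \<le> \<mu> * of_bool (real k \<le> real l * K)" by (rule run_near_euler[OF j k])
    finally have "real k * \<bar>x ?i k - refined j k\<bar> \<le> real k * (\<mu> * of_bool (real k \<le> real l * K) + ?s * \<bar>drift N (\<lambda>_. x ?i) k\<bar>)"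
      by (intro mult_left_mono) auto
    then show "real k * \<bar>x ?i k - refined j k\<bar> \<le> real k * (\<mu> * of_bool (real k \<le> real l * K)) + ?s * (real k * \<bar>drift N (\<lambda>_. x ?i) k\<bar>)"
      by (simp only: distrib_left mult.left_commute)
  qed
  also have "\<dots> \<le> (real l * K)\<^sup>2 * \<mu> + 1 / n * (4 * real l ^ 2 * K * C)"
    unfolding sum.distrib sum_distrib_left[symmetric]
    by (intro add_mono cardK mult_mono s drift_weighted_le[OF run_dist[OF j] run_zero(1)[OF j] run_n(2)])
      (auto intro!: sum_nonneg)
  finally show ?thesis by (simp add: run_error_def)
qed

end

text \<open>The difference of the two refined schemes starts at \<open>0\<close> and obeys the recursion of
\<open>euler_step_stable\<close>, so it is controlled by Gronwall's inequality.\<close>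

theorem runs_close:
  assumes x: "good_run n T K C \<mu> x" and y: "good_run m T' K' C \<mu>' y"
    and s: "0 \<le> s" "s \<le> t" and i: "nat \<lfloor>s * real n\<rfloor> \<le> T" "nat \<lfloor>s * real m\<rfloor> \<le> T'"
  shows "(\<Sum>k\<in>{1..max n m}. \<bar>x (nat \<lfloor>s * real n\<rfloor>) k - y (nat \<lfloor>s * real m\<rfloor>) k\<bar>)
    \<le> (exp (2 * real l ^ 2 * C * t) * (t * (2 * real l + 2 * real l ^ 2 * C)) + 1)
       * (run_error n K C \<mu> + run_error m K' C \<mu>')"
proof -
  define N where "N = max n m"
  define h where "h = 1 / (real n * real m)"
  define J where "J = nat \<lfloor>s * real n * real m\<rfloor>"
  have n: "0 < n" and m: "0 < m" using x y by (auto simp: good_run_def)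
  have nN: "n \<le> N" "m \<le> N" by (auto simp: N_def)
  have y': "real m = real n * real m / real n" using n by simp
  let ?Z = "refined n x N m" and ?Y = "refined m y N n"
  define D where "D j = (\<Sum>k\<in>{1..N}. \<bar>?Z j k - ?Y j k\<bar>)" for j
  define \<epsilon> where "\<epsilon> = run_error n K C \<mu> + run_error m K' C \<mu>'"
  \<comment> \<open>On the common lattice both runs are at their step belonging to time \<open>s\<close>.\<close>
  have Jdiv: "J div m = nat \<lfloor>s * real n\<rfloor>" "J div n = nat \<lfloor>s * real m\<rfloor>"
  proof -
    have fl: "nat \<lfloor>a * real p\<rfloor> div p = nat \<lfloor>a\<rfloor>" if "0 \<le> a" "0 < p" for a and p :: nat
    proof -
      have "\<lfloor>a\<rfloor> = \<lfloor>a * real p\<rfloor> div int p"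
        using floor_divide_real_eq_div[of "int p" "a * real p"] that by simp
      moreover have "0 \<le> \<lfloor>a * real p\<rfloor>" using that by simp
      ultimately show ?thesis using nat_div_distrib[of "\<lfloor>a * real p\<rfloor>" "int p"] by simp
    qed
    show "J div m = nat \<lfloor>s * real n\<rfloor>" using fl[of "s * real n" m] s m by (simp add: J_def)
    show "J div n = nat \<lfloor>s * real m\<rfloor>" using fl[of "s * real m" n] s n by (simp add: J_def mult_ac)
  qed
  have h0: "0 \<le> h" by (simp add: h_def)
  have hl: "h * real l * real N \<le> 1"
  proof -
    have "1 \<le> K" "1 \<le> K'" using x y by (auto simp: good_run_def)
    then have "real l * 1 \<le> real l * K" "real l * 1 \<le> real l * K'"
      by (auto intro!: mult_left_mono simp del: mult_1_right)
    then have "real l \<le> real n" "real l \<le> real m" using x y by (auto simp: good_run_def)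
    then have "real l * real N \<le> real n * real m"
      using mult_right_mono[of "real l" "real n" "real m"] mult_right_mono[of "real l" "real m" "real n"]
      by (cases "n \<le> m") (auto simp: N_def max_def mult.commute)
    then show ?thesis using n m by (simp add: h_def field_simps)
  qed
  have iT: "j div m \<le> T" "j div n \<le> T'" if "j \<le> J" for j
    using div_le_mono[OF that, of m] div_le_mono[OF that, of n] Jdiv i by auto
  have C0: "0 \<le> C" using C_nonneg[of 1 N C "\<lambda>_. x 0"] run_dist[OF x nN(1) m] l2 by auto
  have \<epsilon>0: "0 \<le> \<epsilon>" using x y C0 by (auto simp: \<epsilon>_def run_error_def good_run_def)
  have err: "(\<Sum>k\<in>{1..N}. real k * \<bar>(x (j div m) k - ?Z j k) - (y (j div n) k - ?Y j k)\<bar>) \<le> \<epsilon>" if "j \<le> J" for j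
  proof -
    have "(\<Sum>k\<in>{1..N}. real k * \<bar>(x (j div m) k - ?Z j k) - (y (j div n) k - ?Y j k)\<bar>)
      \<le> (\<Sum>k\<in>{1..N}. real k * \<bar>x (j div m) k - ?Z j k\<bar> + real k * \<bar>y (j div n) k - ?Y j k\<bar>)"
      unfolding distrib_left[symmetric] by (intro sum_mono mult_left_mono) auto
    also have "\<dots> \<le> \<epsilon>"
      unfolding sum.distrib \<epsilon>_def
      by (intro add_mono refined_near_run[OF x nN(1) m iT(1)[OF that]] refined_near_run[OF y nN(2) n iT(2)[OF that]])
    finally show ?thesis .
  qed
  have step: "D (Suc j) \<le> (1 + h * (2 * real l ^ 2 * C)) * D j + h * (2 * real l + 2 * real l ^ 2 * C) * \<epsilon>" if "j < J" for j
  proof -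
    let ?e = "\<lambda>k. (x (j div m) k - ?Z j k) - (y (j div n) k - ?Y j k)"
    have jT: "j div m \<le> T" "j div n \<le> T'" using iT that by auto
    have "D (Suc j) = (\<Sum>k\<in>{1..N}. \<bar>(?Z j k - ?Y j k) + h * (drift N (\<lambda>_. x (j div m)) k - drift N (\<lambda>_. y (j div n)) k)\<bar>)"
      unfolding D_def refined_def[OF x nN(1) m] refined_def[OF y nN(2) n] h_def
      by (intro sum.cong refl arg_cong[where f = abs]) (simp add: algebra_simps)
    also have "\<dots> \<le> (1 + h * (2 * real l ^ 2 * C)) * D j
      + h * (2 * real l + 2 * real l ^ 2 * C) * (\<Sum>k\<in>{1..N}. real k * \<bar>?e k\<bar>)"
      unfolding D_def
      by (rule euler_step_stable[OF run_dist[OF x nN(1) m jT(1)] run_dist[OF y nN(2) n jT(2)] _ h0 hl]) simp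
    also have "\<dots> \<le> (1 + h * (2 * real l ^ 2 * C)) * D j + h * (2 * real l + 2 * real l ^ 2 * C) * \<epsilon>"
      using h0 C0 err[of j] that by (intro add_left_mono mult_left_mono) auto
    finally show ?thesis .
  qed
  have Jh: "h * real J \<le> t"
  proof -
    have "real J \<le> s * real n * real m" using s by (simp add: J_def)
    then have "h * real J \<le> h * (s * real n * real m)" using h0 by (intro mult_left_mono)
    also have "\<dots> = s" using n m by (simp add: h_def)
    finally show ?thesis using s by simp
  qed
  have D0: "D 0 = 0" by (simp add: D_def refined_def[OF x nN(1) m] refined_def[OF y nN(2) n])
  have "D J \<le> exp (h * (2 * real l ^ 2 * C) * real J) * (real J * (h * (2 * real l + 2 * real l ^ 2 * C) * \<epsilon>))"
    by (rule discrete_gronwall[OF D0 _ _ step]) (use h0 C0 \<epsilon>0 in auto)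
  also have "\<dots> = exp (2 * real l ^ 2 * C * (h * real J)) * ((h * real J) * (2 * real l + 2 * real l ^ 2 * C)) * \<epsilon>"
    by (simp add: mult_ac)
  also have "\<dots> \<le> exp (2 * real l ^ 2 * C * t) * (t * (2 * real l + 2 * real l ^ 2 * C)) * \<epsilon>"
    using Jh h0 C0 \<epsilon>0 s by (intro mult_right_mono mult_mono) (auto intro!: mult_left_mono)
  finally have DJ: "D J \<le> exp (2 * real l ^ 2 * C * t) * (t * (2 * real l + 2 * real l ^ 2 * C)) * \<epsilon>" .
  have tri: "\<bar>a - b\<bar> \<le> \<bar>p - q\<bar> + 1 * \<bar>(a - p) - (b - q)\<bar>" for a b p q :: real
    using abs_triangle_ineq[of "p - q" "(a - p) - (b - q)"] by simp
  have "(\<Sum>k\<in>{1..N}. \<bar>x (J div m) k - y (J div n) k\<bar>)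
    \<le> (\<Sum>k\<in>{1..N}. \<bar>?Z J k - ?Y J k\<bar> + real k * \<bar>(x (J div m) k - ?Z J k) - (y (J div n) k - ?Y J k)\<bar>)"
  proof (rule sum_mono)
    fix k assume "k \<in> {1..N}"
    then have "1 * \<bar>(x (J div m) k - ?Z J k) - (y (J div n) k - ?Y J k)\<bar> \<le> real k * \<bar>(x (J div m) k - ?Z J k) - (y (J div n) k - ?Y J k)\<bar>"
      by (intro mult_right_mono) auto
    then show "\<bar>x (J div m) k - y (J div n) k\<bar>
      \<le> \<bar>?Z J k - ?Y J k\<bar> + real k * \<bar>(x (J div m) k - ?Z J k) - (y (J div n) k - ?Y J k)\<bar>"
      by (intro order.trans[OF tri add_left_mono])
  qed
  also have "\<dots> \<le> exp (2 * real l ^ 2 * C * t) * (t * (2 * real l + 2 * real l ^ 2 * C)) * \<epsilon> + \<epsilon>"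
    unfolding sum.distrib using DJ err[of J] by (intro add_mono) (auto simp: D_def)
  finally show ?thesis unfolding Jdiv N_def \<epsilon>_def by (simp add: algebra_simps)
qed

end

section \<open>Bounded susceptibility propagates in time\<close>

lemma has_sum_from_partial_sums:
  fixes f :: "nat \<Rightarrow> real"
  assumes nonneg: "\<And>k. 1 \<le> k \<Longrightarrow> 0 \<le> f k" and lim: "(\<lambda>J. \<Sum>k\<in>{1..J}. f k) \<longlonglongrightarrow> L"
  shows "(f has_sum L) {1..}"
proof -
  define g where "g k = (if 1 \<le> k then f k else 0)" for k
  have "(\<Sum>k<Suc J. g k) = (\<Sum>k\<in>{1..J}. f k)" for J
  proof -
    have "(\<Sum>k<Suc J. g k) = (\<Sum>k\<in>{1..J}. g k)"
      by (rule sum.mono_neutral_right) (auto simp: g_def)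
    then show ?thesis by (simp add: g_def)
  qed
  with lim have "(\<lambda>J. \<Sum>k<Suc J. g k) \<longlonglongrightarrow> L" by simp
  then have "g sums L" unfolding sums_def by (rule LIMSEQ_imp_Suc)
  then have "(g has_sum L) UNIV" by (rule sums_nonneg_imp_has_sum) (auto simp: g_def nonneg)
  then show ?thesis by (rule has_sum_cong_neutral[THEN iffD1, rotated -1]) (auto simp: g_def)
qed

lemma sum_exp_tail_le:
  assumes b: "0 < b"
  shows "(\<Sum>k\<in>{M + 1..J}. exp (- b * real k)) \<le> exp (- b * real M) / b"
proof (cases "M \<le> J")
  case True
  have "(\<Sum>k\<in>{M + 1..J}. exp (- b * real k)) = (\<Sum>k\<in>{1..J - M}. exp (- b * real (k + M)))"
    using sum.shift_bounds_cl_nat_ivl[of "\<lambda>k. exp (- b * real k)" 1 M "J - M"] True by (simp add: add.commute)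
  also have "\<dots> = exp (- b * real M) * (\<Sum>k\<in>{1..J - M}. exp (- b * real k))"
    by (simp add: sum_distrib_left exp_add[symmetric] algebra_simps)
  also have "\<dots> \<le> exp (- b * real M) * (1 / b)"
  proof (intro mult_left_mono)
    have "b * (\<Sum>k\<in>{1..J - M}. exp (- b * real k)) \<le> 1"
      using sum_exp_le[OF b, of "J - M"] exp_gt_zero[of "- b * real (J - M)"] by linarith
    then show "(\<Sum>k\<in>{1..J - M}. exp (- b * real k)) \<le> 1 / b" using b by (simp add: field_simps)
  qed simp
  finally show ?thesis by simp
qed (use b in simp)

lemma weighted_tail_le:
  fixes f :: "nat \<Rightarrow> real"
  assumes a: "0 < a" and A: "0 \<le> A" and f: "\<And>k. 1 \<le> k \<Longrightarrow> f k \<le> A * exp (- a * real k)"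
  shows "(\<Sum>k\<in>{M + 1..J}. real k * f k) \<le> 4 * A / a\<^sup>2 * exp (- (a / 2) * real M)"
proof -
  have "(\<Sum>k\<in>{M + 1..J}. real k * f k) \<le> (\<Sum>k\<in>{M + 1..J}. 2 * A / a * exp (- (a / 2) * real k))"
  proof (rule sum_mono)
    fix k assume "k \<in> {M + 1..J}"
    then have k: "1 \<le> k" by simp
    have "a / 2 * real k \<le> exp (a / 2 * real k)" using exp_ge_add_one_self[of "a / 2 * real k"] by linarith
    then have "real k \<le> 2 / a * exp (a / 2 * real k)" using a by (simp add: field_simps)
    then have "real k * (A * exp (- a * real k)) \<le> 2 / a * exp (a / 2 * real k) * (A * exp (- a * real k))"
      using A by (intro mult_right_mono) auto
    also have "\<dots> = 2 * A / a * exp (- (a / 2) * real k)" by (simp add: exp_add[symmetric] field_simps)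
    also have "real k * f k \<le> real k * (A * exp (- a * real k))" by (intro mult_left_mono f k) simp
    finally show "real k * f k \<le> 2 * A / a * exp (- (a / 2) * real k)" by simp
  qed
  also have "\<dots> = 2 * A / a * (\<Sum>k\<in>{M + 1..J}. exp (- (a / 2) * real k))" by (rule sum_distrib_left[symmetric])
  also have "\<dots> \<le> 2 * A / a * (exp (- (a / 2) * real M) / (a / 2))"
    using a A by (intro mult_left_mono sum_exp_tail_le) auto
  finally show ?thesis by (simp add: power2_eq_square)
qed

context size_rule_process
begin

definition max_size :: "real \<Rightarrow> nat \<Rightarrow> real" where
  "max_size a n = 2 / a * ln (real n)"

definition fluct :: "nat \<Rightarrow> real" where
  "fluct n = ln (real n) ^ 3 / sqrt (real n)"

definition hist_run :: "nat \<Rightarrow> (nat \<Rightarrow> nat) list \<Rightarrow> nat \<Rightarrow> nat \<Rightarrow> real" where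
  "hist_run n h i k = freq n (graph n (take i h)) k"

text \<open>The conditions that hold with high probability while the process is subcritical and that make the
densities of the history a good run.\<close>

definition run_ok :: "real \<Rightarrow> real \<Rightarrow> nat \<Rightarrow> nat \<Rightarrow> (nat \<Rightarrow> nat) list \<Rightarrow> bool" where
  "run_ok a A n i h \<longleftrightarrow> (\<forall>j\<le>i. tails a A n (graph n (take j h)) \<and>
     (\<forall>k\<in>{1..n}. \<bar>compensated n k (take j h) - compensated n k []\<bar> < sqrt (real n) * ln (real n) ^ 3))"

abbreviation err :: "real \<Rightarrow> real \<Rightarrow> nat \<Rightarrow> real" where
  "err a A n \<equiv> run_error n (max_size a n) (A / a) (fluct n)"

lemma freq_nonneg [simp]: "0 \<le> freq n E k" by (simp add: freq_def)

lemma freq_zero: "freq n E 0 = 0"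
proof -
  have "{v \<in> {1..n}. csize n E v = 0} = {}" using csize_pos[of _ n E] by fastforce
  then show ?thesis by (simp add: freq_def N_eq_def)
qed

lemma freq_sum: "0 < n \<Longrightarrow> (\<Sum>k\<in>{1..n}. freq n E k) = 1"
  using sum_N_eq[of "\<lambda>_. 1" n E] by (simp add: freq_def sum_divide_distrib[symmetric])

lemma freq_mean: "(\<Sum>k\<in>{1..n}. real k * freq n E k) = susceptibility n E"
  by (simp add: susceptibility_def freq_def)

lemma freq_le_1: "0 < n \<Longrightarrow> freq n E k \<le> 1"
proof -
  have "{v \<in> {1..n}. csize n E v = k} \<subseteq> {1..n}" by auto
  from card_mono[OF _ this] show "0 < n \<Longrightarrow> freq n E k \<le> 1" by (simp add: freq_def N_eq_def)
qed

lemma freq_tail: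
  assumes "tails a A n E" "0 < n" "1 \<le> k" shows "freq n E k \<le> A * exp (- a * real k)"
proof -
  have "real (N_eq n E k) \<le> real (N_ge n E k)"
    unfolding N_eq_def N_ge_def by (intro of_nat_mono card_mono) auto
  also have "\<dots> \<le> A * exp (- a * real k) * real n" using assms by (simp add: tails_def)
  finally show ?thesis using assms by (simp add: freq_def field_simps)
qed

lemma freq_large:
  assumes "tails a A n E" "0 < a" "0 < A" "A \<le> real n" "max_size a n < real k"
  shows "freq n E k = 0"
proof -
  have "{v \<in> {1..n}. csize n E v = k} = {}"
    using tails_csize[OF assms(1-4)] assms(5) by (fastforce simp: max_size_def)
  then show ?thesis by (simp add: freq_def N_eq_def)
qed

lemma good_run_hist:
  assumes a: "0 < a" "0 < A" and n: "A \<le> real n" "1 \<le> max_size a n" "real l * max_size a n \<le> real n" "1 < n"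
    and ok: "run_ok a A n T h" and T: "T \<le> length h"
  shows "good_run n T (max_size a n) (A / a) (fluct n) (hist_run n h)"
  unfolding good_run_def
proof (intro conjI allI impI ballI)
  show "0 < n" "1 \<le> max_size a n" "real l * max_size a n \<le> real n" using n by auto
  show "0 \<le> fluct n" using n by (simp add: fluct_def)
  fix i assume i: "i \<le> T"
  have tl: "tails a A n (graph n (take i h))" using ok i by (simp add: run_ok_def)
  show "size_dist n (A / a) (hist_run n h i)"
    using n tails_susceptibility[OF tl a] by (simp add: size_dist_def hist_run_def freq_sum freq_mean)
  show "hist_run n h i 0 = 0" by (simp add: hist_run_def freq_zero)
  show "hist_run n h i k = 0" if "max_size a n < real k" for k
    unfolding hist_run_def by (rule freq_large[OF tl a n(1) that])
  fix k assume k: "k \<in> {1..n}"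
  have c0: "compensated n k [] = real n * of_bool (k = 1)"
    by (simp add: compensated_def N_eq_sum eq_commute[of _ k])
  have "hist_run n h i k - euler n (hist_run n h) i k = (compensated n k (take i h) - compensated n k []) / n"
  proof -
    have "(\<Sum>j<length (take i h). drift n (\<lambda>_. freq n (graph n (take j (take i h)))) k)
      = (\<Sum>j<i. drift n (\<lambda>_. hist_run n h j) k)"
      using i T by (intro sum.cong) (auto simp: hist_run_def[abs_def] min_absorb1)
    then show ?thesis unfolding c0
      using n by (simp add: compensated_def euler_def hist_run_def freq_def field_simps)
  qed
  moreover have "\<bar>compensated n k (take i h) - compensated n k []\<bar> / n \<le> sqrt (real n) * ln (real n) ^ 3 / n"
    using ok i k by (intro divide_right_mono) (auto simp: run_ok_def less_imp_le)
  moreover have "sqrt (real n) * ln (real n) ^ 3 / n = fluct n"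
    using n by (simp add: fluct_def field_simps)
  ultimately show "\<bar>hist_run n h i k - euler n (hist_run n h) i k\<bar> \<le> fluct n" by (simp add: abs_divide)
qed

lemma susceptibility_take_le: "susceptibility n (graph n (take j h)) \<le> susceptibility n (graph n h)"
proof (rule susceptibility_mono)
  show "graph n (take j h) \<subseteq> graph n h"
    using graph_append_mono[of n "take j h" "drop j h"] by simp
qed

lemma subcritical_beforeI:
  assumes "susceptibility n (graph n (take (nat \<lfloor>t * real n\<rfloor>) h)) \<le> C"
  shows "subcritical_before n t C h i"
  unfolding subcritical_before_def
proof (intro allI impI)
  fix j assume "real j \<le> t * real n"
  then have "j \<le> nat \<lfloor>t * real n\<rfloor>" by (simp add: le_nat_floor)
  from susceptibility_mono[OF graph_take_mono[OF this, of n h], of n]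
  show "susceptibility n (graph n (take j h)) \<le> C" using assms by linarith
qed

lemma run_ok_while_subcritical:
  assumes t: "0 \<le> t" and C: "1 \<le> C" and w: "0 \<le> w" "w * real l * (real l - 1) * C < 1"
  shows "\<exists>a>0. \<exists>A>0. \<forall>\<^sub>F n in sequentially. uniform_prob (tuples n) (nat \<lfloor>(t + w) * real n\<rfloor>)
     (\<lambda>h. \<exists>i\<le>nat \<lfloor>(t + w) * real n\<rfloor>. subcritical_before n t C h i \<and> \<not> run_ok a A n i h)
     \<le> 2 * real n powr (-100)"
proof -
  obtain a A where a: "0 < a" "0 < A" and ev1: "\<forall>\<^sub>F n in sequentially. uniform_prob (tuples n) (nat \<lfloor>(t + w) * real n\<rfloor>)
     (\<lambda>h. \<exists>i\<le>nat \<lfloor>(t + w) * real n\<rfloor>. subcritical_before n t C h i \<and> \<not> tails a A n (graph n (take i h)))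
     \<le> real n powr (-100)"
    using tails_while_subcritical[OF assms] by blast
  have "\<forall>\<^sub>F n in sequentially. uniform_prob (tuples n) (nat \<lfloor>(t + w) * real n\<rfloor>)
     (\<lambda>h. \<exists>i\<le>nat \<lfloor>(t + w) * real n\<rfloor>. subcritical_before n t C h i \<and> \<not> run_ok a A n i h) \<le> 2 * real n powr (-100)"
    using ev1 compensated_deviation[OF a, of "t + w"]
  proof eventually_elim
    case (elim n)
    define m where "m = nat \<lfloor>(t + w) * real n\<rfloor>"
    have m: "real m \<le> (t + w) * real n" using t w by (simp add: m_def)
    let ?P1 = "\<lambda>h. \<exists>i\<le>m. subcritical_before n t C h i \<and> \<not> tails a A n (graph n (take i h))"
    let ?P2 = "\<lambda>h. \<exists>i\<le>m. (\<forall>j<i. tails a A n (graph n (take j h))) \<and>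
       (\<exists>k\<in>{1..n}. sqrt (real n) * ln (real n) ^ 3 \<le> \<bar>compensated n k (take i h) - compensated n k []\<bar>)"
    have "uniform_prob (tuples n) m (\<lambda>h. \<exists>i\<le>m. subcritical_before n t C h i \<and> \<not> run_ok a A n i h)
      \<le> uniform_prob (tuples n) m (\<lambda>h. ?P1 h \<or> ?P2 h)"
    proof (rule uniform_prob_mono)
      fix h assume "\<exists>i\<le>m. subcritical_before n t C h i \<and> \<not> run_ok a A n i h"
      then obtain i where i: "i \<le> m" "subcritical_before n t C h i" "\<not> run_ok a A n i h" by blast
      show "?P1 h \<or> ?P2 h"
      proof (cases "?P1 h")
        case False
        then have T: "tails a A n (graph n (take j h))" if "j \<le> i" for j
          using subcritical_before_mono[OF i(2) that] that i(1) le_trans by blast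
        from i(3) obtain j k where jk: "j \<le> i" "k \<in> {1..n}"
          "sqrt (real n) * ln (real n) ^ 3 \<le> \<bar>compensated n k (take j h) - compensated n k []\<bar>"
          unfolding run_ok_def using T by (auto simp: not_less)
        then have "?P2 h" using T i(1) by (intro exI[of _ j]) auto
        then show ?thesis ..
      qed blast
    qed
    also have "\<dots> \<le> uniform_prob (tuples n) m ?P1 + uniform_prob (tuples n) m ?P2" by (rule uniform_prob_disj)
    also have "uniform_prob (tuples n) m ?P1 \<le> real n powr (-100)" using elim(1) by (simp add: m_def)
    also have "uniform_prob (tuples n) m ?P2 \<le> real n powr (-100)" using elim(2) m by blast
    finally show ?case by (simp add: m_def)
  qed
  then show ?thesis using a by blast
qed

text \<open>The negation of \<open>S \<rightarrow> \<infinity>\<close> in probability at time \<open>t\<close>. It gives bounded susceptibility only with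
a probability bounded below, and only for infinitely many \<open>n\<close>; \<open>weak_strong\<close> upgrades it to
\<open>strongly_subcritical\<close>.\<close>

definition weakly_subcritical :: "real \<Rightarrow> bool" where
  "weakly_subcritical t \<longleftrightarrow> (\<exists>C. \<not> (\<lambda>n. uniform_prob (tuples n) (nat \<lfloor>t * real n\<rfloor>) (\<lambda>h. susceptibility n (graph n h) \<le> C)) \<longlonglongrightarrow> 0)"

definition strongly_subcritical :: "real \<Rightarrow> bool" where
  "strongly_subcritical t \<longleftrightarrow> (\<exists>C\<ge>1. \<exists>Q. \<forall>\<^sub>F n in sequentially.
     uniform_prob (tuples n) (nat \<lfloor>t * real n\<rfloor>) (\<lambda>h. C < susceptibility n (graph n h)) \<le> Q * real n powr (-100))"

definition typical :: "real \<Rightarrow> real \<Rightarrow> real \<Rightarrow> bool" where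
  "typical a A t \<longleftrightarrow> 0 < a \<and> 0 < A \<and> (\<exists>Q. \<forall>\<^sub>F n in sequentially. uniform_prob (tuples n) (nat \<lfloor>t * real n\<rfloor>)
     (\<lambda>h. \<not> run_ok a A n (nat \<lfloor>t * real n\<rfloor>) h) \<le> Q * real n powr (-100))"

text \<open>With high probability the susceptibility at time \<open>t\<close> is bounded, hence also before \<open>t\<close> by
monotonicity, and then one more window can be crossed.\<close>

lemma strongly_subcritical_extend:
  assumes t: "0 \<le> t" and s: "\<forall>\<^sub>F n in sequentially.
     uniform_prob (tuples n) (nat \<lfloor>t * real n\<rfloor>) (\<lambda>h. C < susceptibility n (graph n h)) \<le> Q * real n powr (-100)"
    and C: "1 \<le> C" and w: "0 \<le> w" "w * real l * (real l - 1) * C < 1"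
  shows "\<exists>a A. typical a A (t + w)"
proof -
  obtain a A where a: "0 < a" "0 < A" and ev: "\<forall>\<^sub>F n in sequentially. uniform_prob (tuples n) (nat \<lfloor>(t + w) * real n\<rfloor>)
     (\<lambda>h. \<exists>i\<le>nat \<lfloor>(t + w) * real n\<rfloor>. subcritical_before n t C h i \<and> \<not> run_ok a A n i h)
     \<le> 2 * real n powr (-100)"
    using run_ok_while_subcritical[OF t C w] by blast
  have "\<forall>\<^sub>F n in sequentially. uniform_prob (tuples n) (nat \<lfloor>(t + w) * real n\<rfloor>)
     (\<lambda>h. \<not> run_ok a A n (nat \<lfloor>(t + w) * real n\<rfloor>) h) \<le> (Q + 2) * real n powr (-100)"
    using s ev eventually_gt_at_top[of 0]
  proof eventually_elim
    case (elim n)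
    define M0 where "M0 = nat \<lfloor>t * real n\<rfloor>"
    define M where "M = nat \<lfloor>(t + w) * real n\<rfloor>"
    have "M0 \<le> M" unfolding M0_def M_def using w by (intro nat_mono floor_mono mult_right_mono) auto
    then obtain d where d: "M = M0 + d" using le_Suc_ex by blast
    let ?P1 = "\<lambda>h. C < susceptibility n (graph n h)"
    let ?P2 = "\<lambda>h. \<exists>i\<le>M. subcritical_before n t C h i \<and> \<not> run_ok a A n i h"
    have "uniform_prob (tuples n) M (\<lambda>h. \<not> run_ok a A n M h) \<le> uniform_prob (tuples n) M (\<lambda>h. ?P1 (take M0 h) \<or> ?P2 h)"
    proof (rule uniform_prob_mono)
      fix h assume "\<not> run_ok a A n M h"
      then show "?P1 (take M0 h) \<or> ?P2 h"
        using subcritical_beforeI[of n t h C M] unfolding M0_def by (auto simp: not_less)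
    qed
    also have "\<dots> \<le> uniform_prob (tuples n) M (\<lambda>h. ?P1 (take M0 h)) + uniform_prob (tuples n) M ?P2" by (rule uniform_prob_disj)
    also have "uniform_prob (tuples n) M (\<lambda>h. ?P1 (take M0 h)) = uniform_prob (tuples n) M0 ?P1"
      unfolding d by (rule uniform_prob_take[OF finite_tuples tuples_nonempty]) (use elim in simp)
    also have "\<dots> \<le> Q * real n powr (-100)" using elim(1) by (simp add: M0_def)
    also have "uniform_prob (tuples n) M ?P2 \<le> 2 * real n powr (-100)" using elim(2) by (simp add: M_def)
    finally show ?case by (simp add: M_def distrib_right)
  qed
  then show ?thesis unfolding typical_def using a by blast
qed

lemma strongly_subcritical_initial:
  assumes w: "0 \<le> w" "w * real l * (real l - 1) < 1"
  shows "\<exists>a A. typical a A w"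
proof -
  have "\<forall>\<^sub>F n in sequentially. uniform_prob (tuples n) (nat \<lfloor>0 * real n\<rfloor>) (\<lambda>h. 1 < susceptibility n (graph n h)) \<le> 0 * real n powr (-100)"
    using eventually_gt_at_top[of 0]
    by eventually_elim (simp add: susceptibility_empty)
  from strongly_subcritical_extend[OF _ this, of w] show ?thesis using w by simp
qed

lemma typical_strong:
  assumes "typical a A t"
  shows "strongly_subcritical t"
proof -
  obtain Q where a: "0 < a" "0 < A" and ev: "\<forall>\<^sub>F n in sequentially. uniform_prob (tuples n) (nat \<lfloor>t * real n\<rfloor>)
     (\<lambda>h. \<not> run_ok a A n (nat \<lfloor>t * real n\<rfloor>) h) \<le> Q * real n powr (-100)"
    using assms unfolding typical_def by blast
  have "\<forall>\<^sub>F n in sequentially. uniform_prob (tuples n) (nat \<lfloor>t * real n\<rfloor>) (\<lambda>h. max 1 (A / a) < susceptibility n (graph n h)) \<le> Q * real n powr (-100)"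
    using ev eventually_gt_at_top[of 0]
  proof eventually_elim
    case (elim n)
    let ?M = "nat \<lfloor>t * real n\<rfloor>"
    have "uniform_prob (tuples n) ?M (\<lambda>h. max 1 (A / a) < susceptibility n (graph n h)) \<le> uniform_prob (tuples n) ?M (\<lambda>h. \<not> run_ok a A n ?M h)"
    proof (rule uniform_prob_mono)
      fix h assume h: "h \<in> hists (tuples n) ?M" and S: "max 1 (A / a) < susceptibility n (graph n h)"
      show "\<not> run_ok a A n ?M h"
      proof
        assume "run_ok a A n ?M h"
        then have "tails a A n (graph n (take ?M h))" by (simp add: run_ok_def)
        then have "susceptibility n (graph n (take ?M h)) \<le> A / a" using a elim by (intro tails_susceptibility) auto
        then show False using S h by simp
      qed
    qed
    then show ?case using elim by linarith
  qed
  then show ?thesis unfolding strongly_subcritical_def by (intro exI[of _ "max 1 (A / a)"]) auto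
qed

lemma strong_typical:
  assumes "strongly_subcritical t" "0 \<le> t"
  shows "\<exists>a A. typical a A t" "\<exists>t'>t. strongly_subcritical t'"
proof -
  obtain C Q where C: "1 \<le> C" and ev: "\<forall>\<^sub>F n in sequentially.
     uniform_prob (tuples n) (nat \<lfloor>t * real n\<rfloor>) (\<lambda>h. C < susceptibility n (graph n h)) \<le> Q * real n powr (-100)"
    using assms(1) unfolding strongly_subcritical_def by blast
  show "\<exists>a A. typical a A t" using strongly_subcritical_extend[OF assms(2) ev C, of 0] by simp
  define P where "P = real l * (real l - 1) * C"
  have P: "0 < P" using l2 C by (simp add: P_def)
  define w where "w = 1 / (2 * P)"
  have "w * P < 1" "0 < w" using P by (auto simp: w_def)
  then have "\<exists>a A. typical a A (t + w)"
    using strongly_subcritical_extend[OF assms(2) ev C, of w] by (simp add: P_def mult.assoc)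
  then show "\<exists>t'>t. strongly_subcritical t'" using typical_strong \<open>0 < w\<close> by (intro exI[of _ "t + w"]) auto
qed

lemma strongly_subcritical_antimono:
  assumes "strongly_subcritical t" "s \<le> t"
  shows "strongly_subcritical s"
proof -
  obtain C Q where C: "1 \<le> C" and ev: "\<forall>\<^sub>F n in sequentially.
     uniform_prob (tuples n) (nat \<lfloor>t * real n\<rfloor>) (\<lambda>h. C < susceptibility n (graph n h)) \<le> Q * real n powr (-100)"
    using assms(1) unfolding strongly_subcritical_def by blast
  have "\<forall>\<^sub>F n in sequentially.
     uniform_prob (tuples n) (nat \<lfloor>s * real n\<rfloor>) (\<lambda>h. C < susceptibility n (graph n h)) \<le> Q * real n powr (-100)"
    using ev eventually_gt_at_top[of 0]
  proof eventually_elim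
    case (elim n)
    define M0 where "M0 = nat \<lfloor>s * real n\<rfloor>"
    define M where "M = nat \<lfloor>t * real n\<rfloor>"
    have "M0 \<le> M" unfolding M0_def M_def using assms by (intro nat_mono floor_mono mult_right_mono) auto
    then obtain d where d: "M = M0 + d" using le_Suc_ex by blast
    have "uniform_prob (tuples n) M0 (\<lambda>h. C < susceptibility n (graph n h))
      = uniform_prob (tuples n) M (\<lambda>h. C < susceptibility n (graph n (take M0 h)))"
      unfolding d by (rule uniform_prob_take[OF finite_tuples tuples_nonempty, symmetric]) (use elim in simp)
    also have "\<dots> \<le> uniform_prob (tuples n) M (\<lambda>h. C < susceptibility n (graph n h))"
    proof (rule uniform_prob_mono)
      fix h assume "C < susceptibility n (graph n (take M0 h))"
      then show "C < susceptibility n (graph n h)"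
        using susceptibility_take_le[of n M0 h] by linarith
    qed
    finally show ?case using elim by (simp add: M0_def M_def)
  qed
  then show ?thesis unfolding strongly_subcritical_def using C by blast
qed

lemma strong_weak:
  assumes "strongly_subcritical t" shows "weakly_subcritical t"
proof -
  obtain C Q where C: "1 \<le> C" and ev: "\<forall>\<^sub>F n in sequentially.
     uniform_prob (tuples n) (nat \<lfloor>t * real n\<rfloor>) (\<lambda>h. C < susceptibility n (graph n h)) \<le> Q * real n powr (-100)"
    using assms(1) unfolding strongly_subcritical_def by blast
  show ?thesis unfolding weakly_subcritical_def
  proof (intro exI notI)
    assume lim: "(\<lambda>n. uniform_prob (tuples n) (nat \<lfloor>t * real n\<rfloor>) (\<lambda>h. susceptibility n (graph n h) \<le> C)) \<longlonglongrightarrow> 0"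
    have "\<forall>\<^sub>F n in sequentially. uniform_prob (tuples n) (nat \<lfloor>t * real n\<rfloor>) (\<lambda>h. susceptibility n (graph n h) \<le> C) < 1/2"
      by (rule order_tendstoD(2)[OF lim]) simp
    moreover have "\<forall>\<^sub>F n in sequentially. Q * real n powr (-100) < 1/2" by real_asymp
    ultimately have "\<forall>\<^sub>F n::nat in sequentially. False"
      using ev eventually_gt_at_top[of 0]
    proof eventually_elim
      case (elim n)
      have "uniform_prob (tuples n) (nat \<lfloor>t * real n\<rfloor>) (\<lambda>h. \<not> C < susceptibility n (graph n h))
        = 1 - uniform_prob (tuples n) (nat \<lfloor>t * real n\<rfloor>) (\<lambda>h. C < susceptibility n (graph n h))"
        by (rule uniform_prob_not[OF finite_tuples tuples_nonempty]) (use elim in simp)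
      then show ?case using elim by (simp add: not_less)
    qed
    then show False by simp
  qed
qed

text \<open>The constant of \<open>runs_close\<close> up to time \<open>t\<close>, for the mean bound \<open>A / a\<close> implied by the tails.\<close>

definition stab :: "real \<Rightarrow> real \<Rightarrow> real \<Rightarrow> real" where
  "stab t a A = exp (2 * real l ^ 2 * (A / a) * t) * (t * (2 * real l + 2 * real l ^ 2 * (A / a))) + 1"

text \<open>The numbers of vertices for which \<open>run_ok\<close> yields a good run with the parameters \<open>max_size a n\<close>,
\<open>A / a\<close> and \<open>fluct n\<close>.\<close>

definition large :: "real \<Rightarrow> real \<Rightarrow> nat \<Rightarrow> bool" where
  "large a A n \<longleftrightarrow> A \<le> real n \<and> 1 \<le> max_size a n \<and> real l * max_size a n \<le> real n \<and> 1 < n"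

lemma eventually_large:
  assumes "0 < a" shows "\<forall>\<^sub>F n in sequentially. large a A n"
proof -
  have "\<forall>\<^sub>F n in sequentially. A \<le> real n" "\<forall>\<^sub>F n in sequentially. 1 \<le> 2 / a * ln (real n)"
    "\<forall>\<^sub>F n in sequentially. real l * (2 / a * ln (real n)) \<le> real n" using assms l2 by real_asymp+
  then show ?thesis using eventually_gt_at_top[of 1]
    by eventually_elim (simp add: large_def max_size_def)
qed

lemma err_tendsto:
  assumes "0 < a" "0 < A"
  shows "err a A \<longlonglongrightarrow> 0" "(\<lambda>n. (max_size a n + 2) * err a A n) \<longlonglongrightarrow> 0"
    "\<forall>\<^sub>F n in sequentially. c * ((max_size a n + 2) * err a A n) + c' / real n \<le> ln (real n) ^ 7 / sqrt (real n)"
    "\<forall>\<^sub>F n in sequentially. c * err a A n \<le> ln (real n) ^ 7 / sqrt (real n)"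
proof -
  have l: "0 < real l" using l2 by simp
  show "err a A \<longlonglongrightarrow> 0" "(\<lambda>n. (max_size a n + 2) * err a A n) \<longlonglongrightarrow> 0"
    unfolding run_error_def max_size_def fluct_def using assms l by real_asymp+
  show "\<forall>\<^sub>F n in sequentially. c * ((max_size a n + 2) * err a A n) + c' / real n \<le> ln (real n) ^ 7 / sqrt (real n)"
    unfolding run_error_def max_size_def fluct_def using assms l by real_asymp
  show "\<forall>\<^sub>F n in sequentially. c * err a A n \<le> ln (real n) ^ 7 / sqrt (real n)"
    unfolding run_error_def max_size_def fluct_def using assms l by real_asymp
qed

lemma hist_runs_close:
  assumes a: "0 < a" "0 < A" and n: "large a A n" "run_ok a A n T h" "T \<le> length h"
    and m: "large a A m" "run_ok a A m T' h'" "T' \<le> length h'"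
    and s: "0 \<le> s" "s \<le> t" and i: "nat \<lfloor>s * real n\<rfloor> \<le> T" "nat \<lfloor>s * real m\<rfloor> \<le> T'"
  shows "(\<Sum>k\<in>{1..max n m}. \<bar>hist_run n h (nat \<lfloor>s * real n\<rfloor>) k - hist_run m h' (nat \<lfloor>s * real m\<rfloor>) k\<bar>)
    \<le> stab t a A * (err a A n + err a A m)"
  unfolding stab_def
  by (rule runs_close[OF good_run_hist[OF a _ _ _ _ n(2,3)] good_run_hist[OF a _ _ _ _ m(2,3)] s i])
    (use n(1) m(1) in \<open>auto simp: large_def\<close>)

lemma stab_ge_1: "0 < a \<Longrightarrow> 0 < A \<Longrightarrow> 0 \<le> t \<Longrightarrow> 1 \<le> stab t a A"
  unfolding stab_def by (auto intro!: mult_nonneg_nonneg add_nonneg_nonneg)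

lemma run_ok_mono: "run_ok a A n T h \<Longrightarrow> i \<le> T \<Longrightarrow> run_ok a A n i h"
  by (auto simp: run_ok_def)

text \<open>Sizes above \<open>max_size a m\<close> do not occur, so closeness in \<open>L\<^sup>1\<close> transfers a bound on the mean.\<close>

lemma mean_le_of_close:
  assumes a: "0 < a" "0 < A" and m: "large a A m" and tl: "tails a A m (graph m (take i h))"
    and x: "\<And>k. 0 \<le> x k" and close: "(\<Sum>k\<in>{1..max n m}. \<bar>x k - hist_run m h i k\<bar>) \<le> \<epsilon>"
    and mean: "(\<Sum>k\<in>{1..n}. real k * x k) \<le> C" and supp: "\<And>k. n < k \<Longrightarrow> x k = 0"
  shows "susceptibility m (graph m (take i h)) \<le> C + max_size a m * \<epsilon>"
proof -
  let ?y = "hist_run m h i" and ?N = "max n m"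
  have K: "1 \<le> max_size a m" using m by (simp add: large_def)
  have y0: "?y k = 0" if "max_size a m < real k" for k
    unfolding hist_run_def by (rule freq_large[OF tl a _ that]) (use m in \<open>simp add: large_def\<close>)
  have "susceptibility m (graph m (take i h)) = (\<Sum>k\<in>{1..m}. real k * ?y k)"
    by (simp add: freq_mean[symmetric] hist_run_def)
  also have "\<dots> \<le> (\<Sum>k\<in>{1..?N}. real k * ?y k)"
    by (rule sum_mono2) (auto simp: hist_run_def)
  also have "\<dots> \<le> (\<Sum>k\<in>{1..?N}. real k * x k + max_size a m * \<bar>x k - ?y k\<bar>)"
  proof (rule sum_mono)
    fix k
    show "real k * ?y k \<le> real k * x k + max_size a m * \<bar>x k - ?y k\<bar>"
    proof (cases "max_size a m < real k")
      case True
      then show ?thesis using y0[OF True] x[of k] K by simp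
    next
      case False
      have "real k * (?y k - x k) \<le> real k * \<bar>x k - ?y k\<bar>" by (intro mult_left_mono) auto
      also have "\<dots> \<le> max_size a m * \<bar>x k - ?y k\<bar>" using False by (intro mult_right_mono) auto
      finally show ?thesis by (simp add: algebra_simps)
    qed
  qed
  also have "\<dots> = (\<Sum>k\<in>{1..?N}. real k * x k) + max_size a m * (\<Sum>k\<in>{1..?N}. \<bar>x k - ?y k\<bar>)"
    by (simp only: sum.distrib sum_distrib_left)
  also have "(\<Sum>k\<in>{1..?N}. real k * x k) = (\<Sum>k\<in>{1..n}. real k * x k)"
    by (rule sum.mono_neutral_right) (use supp in auto)
  also have "(\<Sum>k\<in>{1..n}. real k * x k) + max_size a m * (\<Sum>k\<in>{1..?N}. \<bar>x k - ?y k\<bar>) \<le> C + max_size a m * \<epsilon>"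
    using K by (intro add_mono mean mult_left_mono close) auto
  finally show ?thesis .
qed

text \<open>A bootstrap. Consider a run for a large number \<open>m\<close> of vertices at the first step at which its
susceptibility exceeds \<open>C1\<close>. Up to this step, inclusively, it is a good run with high probability, hence
close to a good run for some \<open>n \<ge> m\<close> that exists by assumption and has susceptibility at most \<open>C\<close>. The
difference of the susceptibilities tends to \<open>0\<close> as \<open>m\<close> grows, and \<open>C1 \<ge> C + 1\<close> cannot have been
exceeded.\<close>

theorem weak_strong:
  assumes weak: "weakly_subcritical t" and t: "0 \<le> t"
  shows "strongly_subcritical t"
proof -
  obtain C where C: "\<not> (\<lambda>n. uniform_prob (tuples n) (nat \<lfloor>t * real n\<rfloor>) (\<lambda>h. susceptibility n (graph n h) \<le> C)) \<longlonglongrightarrow> 0"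
    using weak unfolding weakly_subcritical_def by blast
  define C1 where "C1 = max C 1 + 1"
  have C1: "1 \<le> C1" "C + 1 \<le> C1" by (auto simp: C1_def)
  obtain a A where a: "0 < a" "0 < A" and ev0: "\<forall>\<^sub>F n in sequentially. uniform_prob (tuples n) (nat \<lfloor>(t + 0) * real n\<rfloor>)
     (\<lambda>h. \<exists>i\<le>nat \<lfloor>(t + 0) * real n\<rfloor>. subcritical_before n t C1 h i \<and> \<not> run_ok a A n i h)
     \<le> 2 * real n powr (-100)"
    using run_ok_while_subcritical[OF t C1(1), of 0] by auto
  let ?bad = "\<lambda>n h. \<exists>i\<le>nat \<lfloor>t * real n\<rfloor>. subcritical_before n t C1 h i \<and> \<not> run_ok a A n i h"
  have ev: "\<forall>\<^sub>F n in sequentially. uniform_prob (tuples n) (nat \<lfloor>t * real n\<rfloor>) (?bad n) \<le> 2 * real n powr (-100)"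
    using ev0 by simp
  obtain \<delta> where \<delta>: "0 < \<delta>" and freq: "\<exists>\<^sub>F n in sequentially. \<delta> \<le> uniform_prob (tuples n) (nat \<lfloor>t * real n\<rfloor>) (\<lambda>h. susceptibility n (graph n h) \<le> C)"
    using C unfolding tendsto_iff by (auto simp: dist_real_def uniform_prob_nonneg frequently_def not_le)
  have "\<forall>\<^sub>F n in sequentially. 2 * real n powr (-100) < \<delta>" using \<delta> by real_asymp
  with ev eventually_large[OF a(1), of A] have ev': "\<forall>\<^sub>F n in sequentially. large a A n \<and>
      uniform_prob (tuples n) (nat \<lfloor>t * real n\<rfloor>) (?bad n) < \<delta>"
    by eventually_elim auto
  have witness: "\<exists>\<^sub>F n in sequentially. large a A n \<and>
     (\<exists>h\<in>hists (tuples n) (nat \<lfloor>t * real n\<rfloor>). susceptibility n (graph n h) \<le> C \<and> run_ok a A n (nat \<lfloor>t * real n\<rfloor>) h)"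
    using freq
  proof (rule frequently_rev_mp)
    show "\<forall>\<^sub>F n in sequentially. \<delta> \<le> uniform_prob (tuples n) (nat \<lfloor>t * real n\<rfloor>) (\<lambda>h. susceptibility n (graph n h) \<le> C) \<longrightarrow>
      large a A n \<and> (\<exists>h\<in>hists (tuples n) (nat \<lfloor>t * real n\<rfloor>). susceptibility n (graph n h) \<le> C \<and> run_ok a A n (nat \<lfloor>t * real n\<rfloor>) h)"
      using ev'
    proof (eventually_elim)
      case (elim n)
      show ?case
      proof
      assume big: "\<delta> \<le> uniform_prob (tuples n) (nat \<lfloor>t * real n\<rfloor>) (\<lambda>h. susceptibility n (graph n h) \<le> C)"
      let ?M = "nat \<lfloor>t * real n\<rfloor>"
      have "uniform_prob (tuples n) ?M (\<lambda>h. susceptibility n (graph n h) \<le> C)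
        \<le> uniform_prob (tuples n) ?M (\<lambda>h. ?bad n h \<or> (susceptibility n (graph n h) \<le> C \<and> \<not> ?bad n h))"
        by (rule uniform_prob_mono) auto
      also have "\<dots> \<le> uniform_prob (tuples n) ?M (?bad n) + uniform_prob (tuples n) ?M (\<lambda>h. susceptibility n (graph n h) \<le> C \<and> \<not> ?bad n h)"
        by (rule uniform_prob_disj)
      finally have "0 < uniform_prob (tuples n) ?M (\<lambda>h. susceptibility n (graph n h) \<le> C \<and> \<not> ?bad n h)" using elim big by linarith
      from uniform_prob_pos_ex[OF this] obtain h where h: "h \<in> hists (tuples n) ?M" "susceptibility n (graph n h) \<le> C" "\<not> ?bad n h"
        by blast
      have "subcritical_before n t C1 h ?M" using h C1 by (intro subcritical_beforeI) auto
      then have "run_ok a A n ?M h" using h(3) by auto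
      then show "large a A n \<and> (\<exists>h\<in>hists (tuples n) ?M. susceptibility n (graph n h) \<le> C \<and> run_ok a A n ?M h)"
        using h elim by blast
      qed
    qed
  qed
  have lim: "\<forall>\<^sub>F n in sequentially. stab t a A * ((max_size a n + 2) * err a A n) < 1 / 2"
    by (rule order_tendstoD(2)[OF tendsto_mult_right_zero[OF err_tendsto(2)[OF a], of "stab t a A"]]) simp
  have "\<forall>\<^sub>F m in sequentially. \<forall>n\<ge>m. stab t a A * ((max_size a n + 2) * err a A n) < 1 / 2"
    using lim by (rule eventually_all_ge_at_top)
  with ev eventually_large[OF a(1), of A] eventually_gt_at_top[of 0]
  have "\<forall>\<^sub>F m in sequentially. uniform_prob (tuples m) (nat \<lfloor>t * real m\<rfloor>) (\<lambda>h. C1 < susceptibility m (graph m h)) \<le> 2 * real m powr (-100)"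
  proof eventually_elim
    case (elim m)
    let ?M = "nat \<lfloor>t * real m\<rfloor>"
    have "uniform_prob (tuples m) ?M (\<lambda>h. C1 < susceptibility m (graph m h)) \<le> uniform_prob (tuples m) ?M (?bad m)"
    proof (rule uniform_prob_mono, rule ccontr)
      fix h assume h: "h \<in> hists (tuples m) ?M" and S: "C1 < susceptibility m (graph m h)" and nb: "\<not> ?bad m h"
      let ?P = "\<lambda>i. C1 < susceptibility m (graph m (take i h))"
      have "?P ?M" using h S by simp
      then obtain i where i: "i \<le> ?M" "?P i" and least: "\<And>j. j < i \<Longrightarrow> \<not> ?P j"
        using ex_least_nat_le[of ?P ?M] by blast
      have "subcritical_before m t C1 h i" using least by (auto simp: subcritical_before_def not_less)
      then have ok: "run_ok a A m i h" using nb i by auto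
      \<comment> \<open>Taking \<open>n \<ge> m\<close> lets the error of the witness, times \<open>max_size a m\<close>, be estimated by the same quantity
         as the error of the run for \<open>m\<close>.\<close>
      obtain n h' where n: "m \<le> n" "large a A n" and h': "h' \<in> hists (tuples n) (nat \<lfloor>t * real n\<rfloor>)"
        "susceptibility n (graph n h') \<le> C" "run_ok a A n (nat \<lfloor>t * real n\<rfloor>) h'"
        using witness unfolding frequently_sequentially by blast
      have m0: "0 < m" using elim by simp
      define s where "s = real i / real m"
      have "real i \<le> real ?M" using i(1) by simp
      also have "real ?M \<le> t * real m" using t by (intro of_nat_floor) simp
      finally have s: "0 \<le> s" "s \<le> t" using m0 by (auto simp: s_def field_simps)
      have si: "nat \<lfloor>s * real m\<rfloor> = i" using m0 by (simp add: s_def)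
      have sn: "nat \<lfloor>s * real n\<rfloor> \<le> nat \<lfloor>t * real n\<rfloor>" using s by (intro nat_mono floor_mono mult_right_mono) auto
      have "(\<Sum>k\<in>{1..max n m}. \<bar>hist_run n h' (nat \<lfloor>s * real n\<rfloor>) k - hist_run m h (nat \<lfloor>s * real m\<rfloor>) k\<bar>)
        \<le> stab t a A * (err a A n + err a A m)"
        by (rule hist_runs_close[OF a n(2) h'(3) _ elim(2) ok _ s sn]) (use h h' i si in auto)
      then have close: "(\<Sum>k\<in>{1..max n m}. \<bar>hist_run n h' (nat \<lfloor>s * real n\<rfloor>) k - hist_run m h i k\<bar>)
        \<le> stab t a A * (err a A n + err a A m)" by (simp only: si)
      have "susceptibility m (graph m (take i h)) \<le> C + max_size a m * (stab t a A * (err a A n + err a A m))"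
      proof (rule mean_le_of_close[OF a elim(2) _ _ close])
        show "tails a A m (graph m (take i h))" using ok by (simp add: run_ok_def)
        have "susceptibility n (graph n (take (nat \<lfloor>s * real n\<rfloor>) h')) \<le> susceptibility n (graph n h')"
          by (rule susceptibility_take_le)
        then show "(\<Sum>k\<in>{1..n}. real k * hist_run n h' (nat \<lfloor>s * real n\<rfloor>) k) \<le> C"
          using h'(2) by (simp add: hist_run_def freq_mean)
        show "0 \<le> hist_run n h' (nat \<lfloor>s * real n\<rfloor>) k" for k by (simp add: hist_run_def)
        show "hist_run n h' (nat \<lfloor>s * real n\<rfloor>) k = 0" if "n < k" for k
        proof -
          have "{v \<in> {1..n}. csize n (graph n (take (nat \<lfloor>s * real n\<rfloor>) h')) v = k} = {}"
            using that csize_le[of n "graph n (take (nat \<lfloor>s * real n\<rfloor>) h')"] by (auto simp: not_le dest: leD)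
          then show ?thesis by (simp add: hist_run_def freq_def N_eq_def)
        qed
      qed
      also have "max_size a m * (stab t a A * (err a A n + err a A m)) \<le> 1"
      proof -
        have K: "0 \<le> max_size a m" "max_size a m \<le> max_size a n"
          using elim(2) n m0 a by (auto simp: large_def max_size_def intro!: divide_right_mono mult_left_mono)
        have e0: "0 \<le> err a A n" "0 \<le> err a A m" using a n(2) elim(2) by (auto simp: run_error_def fluct_def large_def)
        have st: "0 \<le> stab t a A" using stab_ge_1[OF a t] by simp
        have "max_size a m * err a A n \<le> (max_size a n + 2) * err a A n"
          "max_size a m * err a A m \<le> (max_size a m + 2) * err a A m"
          using K e0 by (auto intro!: mult_right_mono)
        then have "stab t a A * (max_size a m * err a A n) \<le> 1 / 2" "stab t a A * (max_size a m * err a A m) \<le> 1 / 2"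
          using elim(4)[rule_format, OF n(1)] elim(4)[rule_format, of m] mult_left_mono[OF _ st] by (meson le_refl less_imp_le order_trans)+
        then show ?thesis by (simp add: algebra_simps)
      qed
      finally show False using i(2) C1 by linarith
    qed
    then show ?case using elim(1) by linarith
  qed
  then show ?thesis unfolding strongly_subcritical_def using C1 by blast
qed

end

section \<open>Limiting densities and the end of the subcritical phase\<close>

lemma tendsto_zero_upper_bound:
  fixes f g :: "nat \<Rightarrow> real"
  assumes "\<forall>\<^sub>F n in sequentially. f n \<le> g n" "g \<longlonglongrightarrow> 0" "\<And>n. 0 \<le> f n"
  shows "f \<longlonglongrightarrow> 0"
  by (rule tendsto_sandwich[OF _ assms(1) tendsto_const assms(2)]) (simp add: assms(3))

context size_rule_process
begin

definition density_limit :: "nat \<Rightarrow> real \<Rightarrow> real \<Rightarrow> bool" where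
  "density_limit k t r \<longleftrightarrow> (\<forall>e>0. (\<lambda>n. uniform_prob (tuples n) (nat \<lfloor>t * real n\<rfloor>) (\<lambda>h. e < \<bar>freq n (graph n h) k - r\<bar>)) \<longlonglongrightarrow> 0)"

text \<open>The limit in probability of \<open>N\<^sub>k / n\<close> at time \<open>t\<close>. Defining it by this property, for all times
at once, avoids gluing together limits that belong to different constants \<open>a\<close> and \<open>A\<close>.\<close>

definition rho :: "nat \<Rightarrow> real \<Rightarrow> real" where
  "rho k t = (SOME r. density_limit k t r)"

lemma typical_pos: "typical a A t \<Longrightarrow> 0 < a \<and> 0 < A"
  by (simp add: typical_def)

lemma run_ok_take: "i \<le> M \<Longrightarrow> run_ok a A n i (take M h) \<longleftrightarrow> run_ok a A n i h"
  by (auto simp: run_ok_def min_absorb1)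

lemma typical_antimono:
  assumes "typical a A t" "s \<le> t" shows "typical a A s"
proof -
  obtain Q where a: "0 < a" "0 < A" and ev: "\<forall>\<^sub>F n in sequentially. uniform_prob (tuples n) (nat \<lfloor>t * real n\<rfloor>)
     (\<lambda>h. \<not> run_ok a A n (nat \<lfloor>t * real n\<rfloor>) h) \<le> Q * real n powr (-100)"
    using assms unfolding typical_def by blast
  have "\<forall>\<^sub>F n in sequentially. uniform_prob (tuples n) (nat \<lfloor>s * real n\<rfloor>)
     (\<lambda>h. \<not> run_ok a A n (nat \<lfloor>s * real n\<rfloor>) h) \<le> Q * real n powr (-100)"
    using ev eventually_gt_at_top[of 0]
  proof eventually_elim
    case (elim n)
    define M0 where "M0 = nat \<lfloor>s * real n\<rfloor>"
    define M where "M = nat \<lfloor>t * real n\<rfloor>"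
    have le: "M0 \<le> M" unfolding M0_def M_def using assms by (intro nat_mono floor_mono mult_right_mono) auto
    then obtain d where d: "M = M0 + d" using le_Suc_ex by blast
    have "uniform_prob (tuples n) M0 (\<lambda>h. \<not> run_ok a A n M0 h) = uniform_prob (tuples n) M (\<lambda>h. \<not> run_ok a A n M0 (take M0 h))"
      unfolding d by (rule uniform_prob_take[OF finite_tuples tuples_nonempty, symmetric]) (use elim in simp)
    also have "\<dots> \<le> uniform_prob (tuples n) M (\<lambda>h. \<not> run_ok a A n M h)"
      using run_ok_mono[OF _ le] by (intro uniform_prob_mono) (auto simp: run_ok_take)
    finally show ?case using elim by (simp add: M0_def M_def)
  qed
  then show ?thesis using a unfolding typical_def by blast
qed

text \<open>An event of positive probability contains a history; this is how the deterministic comparison of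
runs is brought to bear on the random process.\<close>

lemma typical_history:
  assumes "typical a A t"
  shows "\<forall>\<^sub>F n in sequentially. large a A n \<and> (\<exists>h\<in>hists (tuples n) (nat \<lfloor>t * real n\<rfloor>). run_ok a A n (nat \<lfloor>t * real n\<rfloor>) h)"
proof -
  obtain Q where a: "0 < a" "0 < A" and ev: "\<forall>\<^sub>F n in sequentially. uniform_prob (tuples n) (nat \<lfloor>t * real n\<rfloor>)
     (\<lambda>h. \<not> run_ok a A n (nat \<lfloor>t * real n\<rfloor>) h) \<le> Q * real n powr (-100)"
    using assms unfolding typical_def by blast
  have "\<forall>\<^sub>F n in sequentially. Q * real n powr (-100) < 1" by real_asymp
  with ev eventually_large[OF a(1), of A] eventually_gt_at_top[of 0] show ?thesis
  proof eventually_elim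
    case (elim n)
    let ?M = "nat \<lfloor>t * real n\<rfloor>"
    have "uniform_prob (tuples n) ?M (\<lambda>h. \<not> run_ok a A n ?M h) = 1 - uniform_prob (tuples n) ?M (run_ok a A n ?M)"
      by (rule uniform_prob_not[OF finite_tuples tuples_nonempty]) (use elim in simp)
    then have "0 < uniform_prob (tuples n) ?M (run_ok a A n ?M)" using elim by linarith
    from uniform_prob_pos_ex[OF this] show ?case using elim by blast
  qed
qed

lemma single_close:
  assumes t: "0 \<le> t" and a: "0 < a" "0 < A" and k: "1 \<le> k" "k \<le> n"
    and n: "large a A n" "h \<in> hists (tuples n) (nat \<lfloor>t * real n\<rfloor>)" "run_ok a A n (nat \<lfloor>t * real n\<rfloor>) h"
    and m: "large a A m" "h' \<in> hists (tuples m) (nat \<lfloor>t * real m\<rfloor>)" "run_ok a A m (nat \<lfloor>t * real m\<rfloor>) h'"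
  shows "\<bar>freq n (graph n h) k - freq m (graph m h') k\<bar> \<le> stab t a A * (err a A n + err a A m)"
proof -
  let ?f = "\<lambda>k. \<bar>hist_run n h (nat \<lfloor>t * real n\<rfloor>) k - hist_run m h' (nat \<lfloor>t * real m\<rfloor>) k\<bar>"
  have "?f k \<le> (\<Sum>k\<in>{1..max n m}. ?f k)"
    by (rule member_le_sum) (use k in auto)
  also have "\<dots> \<le> stab t a A * (err a A n + err a A m)"
    by (rule hist_runs_close[OF a n(1,3) _ m(1,3) _ t order_refl order_refl order_refl]) (use n m in auto)
  finally show ?thesis using n(2) m(2) by (simp add: hist_run_def)
qed

text \<open>Choose one good history for every large \<open>n\<close>. Their densities form a Cauchy sequence by
\<open>single_close\<close>, and every other good history has nearly the same density.\<close>

lemma rho_limit: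
  assumes tp: "typical a A t" and t: "0 \<le> t" and k: "1 \<le> k"
  shows "density_limit k t (rho k t)"
  unfolding rho_def
proof (rule someI_ex)
  have a: "0 < a" "0 < A" using typical_pos[OF tp] by auto
  let ?M = "\<lambda>n. nat \<lfloor>t * real n\<rfloor>"
  let ?good = "\<lambda>n h. h \<in> hists (tuples n) (?M n) \<and> run_ok a A n (?M n) h"
  obtain Q where evQ: "\<forall>\<^sub>F n in sequentially. uniform_prob (tuples n) (?M n) (\<lambda>h. \<not> run_ok a A n (?M n) h) \<le> Q * real n powr (-100)"
    using tp unfolding typical_def by blast
  define H where "H n = (SOME h. ?good n h)" for n
  define x where "x n = freq n (graph n (H n)) k" for n
  have evH: "\<forall>\<^sub>F n in sequentially. large a A n \<and> ?good n (H n) \<and> k \<le> n"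
    using typical_history[OF tp] eventually_ge_at_top[of k]
  proof eventually_elim
    case (elim n)
    then have "\<exists>h. ?good n h" by blast
    then have "?good n (H n)" unfolding H_def by (rule someI_ex)
    then show ?case using elim by blast
  qed
  have st: "0 < stab t a A" using stab_ge_1[OF a t] by simp
  have "Cauchy x"
  proof (rule metric_CauchyI)
    fix e :: real assume e: "0 < e"
    have "\<forall>\<^sub>F n in sequentially. err a A n < e / (2 * stab t a A)"
      using e st by (intro order_tendstoD(2)[OF err_tendsto(1)[OF a]]) simp
    with evH have "\<forall>\<^sub>F n in sequentially. (large a A n \<and> ?good n (H n) \<and> k \<le> n) \<and> err a A n < e / (2 * stab t a A)"
      by (rule eventually_conj)
    then obtain N where N: "\<And>n. N \<le> n \<Longrightarrow> (large a A n \<and> ?good n (H n) \<and> k \<le> n) \<and> err a A n < e / (2 * stab t a A)"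
      unfolding eventually_sequentially by blast
    show "\<exists>M. \<forall>m\<ge>M. \<forall>n\<ge>M. dist (x m) (x n) < e"
    proof (intro exI allI impI)
      fix m n assume mn: "N \<le> m" "N \<le> n"
      have "\<bar>x m - x n\<bar> \<le> stab t a A * (err a A m + err a A n)"
        unfolding x_def using N[OF mn(1)] N[OF mn(2)] by (intro single_close[OF t a k]) auto
      also have "\<dots> < stab t a A * (e / (2 * stab t a A) + e / (2 * stab t a A))"
        using N[OF mn(1)] N[OF mn(2)] st by (intro mult_strict_left_mono add_strict_mono) auto
      also have "\<dots> = e" using st by simp
      finally show "dist (x m) (x n) < e" by (simp add: dist_real_def)
    qed
  qed
  then obtain r where r: "x \<longlonglongrightarrow> r" using Cauchy_convergent_iff convergent_def by blast
  have "density_limit k t r"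
    unfolding density_limit_def
  proof (intro allI impI)
    fix e :: real assume e: "0 < e"
    have ev1: "\<forall>\<^sub>F n in sequentially. err a A n < e / (4 * stab t a A)"
      using e st by (intro order_tendstoD(2)[OF err_tendsto(1)[OF a]]) simp
    have ev2: "\<forall>\<^sub>F n in sequentially. dist (x n) r < e / 2" using r e by (intro tendstoD) auto
    have "\<forall>\<^sub>F n in sequentially. uniform_prob (tuples n) (?M n) (\<lambda>h. e < \<bar>freq n (graph n h) k - r\<bar>) \<le> Q * real n powr (-100)"
      using ev1 ev2 evH evQ
    proof eventually_elim
      case (elim n)
      have "uniform_prob (tuples n) (?M n) (\<lambda>h. e < \<bar>freq n (graph n h) k - r\<bar>) \<le> uniform_prob (tuples n) (?M n) (\<lambda>h. \<not> run_ok a A n (?M n) h)"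
      proof (rule uniform_prob_mono, rule notI)
        fix h assume h: "h \<in> hists (tuples n) (?M n)" "e < \<bar>freq n (graph n h) k - r\<bar>" "run_ok a A n (?M n) h"
        have "\<bar>freq n (graph n h) k - x n\<bar> \<le> stab t a A * (err a A n + err a A n)"
          unfolding x_def using elim h by (intro single_close[OF t a k]) auto
        also have "\<dots> < stab t a A * (e / (4 * stab t a A) + e / (4 * stab t a A))"
          using elim st by (intro mult_strict_left_mono add_strict_mono) auto
        also have "\<dots> = e / 2" using st by simp
        finally show False
          using elim(2) h(2) abs_triangle_ineq[of "freq n (graph n h) k - x n" "x n - r"]
          unfolding dist_real_def by simp
      qed
      then show ?case using elim(4) by linarith
    qed
    moreover have "(\<lambda>n. Q * real n powr (-100)) \<longlonglongrightarrow> 0" by real_asymp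
    ultimately show "(\<lambda>n. uniform_prob (tuples n) (?M n) (\<lambda>h. e < \<bar>freq n (graph n h) k - r\<bar>)) \<longlonglongrightarrow> 0"
      by (rule tendsto_zero_upper_bound) (rule uniform_prob_nonneg)
  qed
  then show "\<exists>r. density_limit k t r" ..
qed

text \<open>Compare with a good history for \<open>m\<close> vertices whose first \<open>M\<close> densities are within \<open>\<epsilon>\<close> of the limit,
and let \<open>m\<close> tend to infinity: of the error in \<open>hist_runs_close\<close> only the part belonging to \<open>n\<close> remains.\<close>

lemma rho_close:
  assumes tp: "typical a A t" and s: "0 \<le> s" "s \<le> t"
    and n: "large a A n" "run_ok a A n T h" "T \<le> length h" "nat \<lfloor>s * real n\<rfloor> \<le> T"
  shows "(\<Sum>k\<in>{1..M}. \<bar>hist_run n h (nat \<lfloor>s * real n\<rfloor>) k - rho k s\<bar>) \<le> stab t a A * err a A n"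
proof (rule field_le_epsilon)
  fix e :: real assume e: "0 < e"
  have a: "0 < a" "0 < A" using typical_pos[OF tp] by auto
  have t: "0 \<le> t" using s by simp
  have st: "0 < stab t a A" using stab_ge_1[OF a t] by simp
  let ?x = "hist_run n h (nat \<lfloor>s * real n\<rfloor>)"
  let ?L = "\<lambda>m. nat \<lfloor>s * real m\<rfloor>"
  define \<epsilon> where "\<epsilon> = e / (real M + 1)"
  have \<epsilon>: "0 < \<epsilon>" using e by (simp add: \<epsilon>_def)
  have tps: "typical a A s" by (rule typical_antimono[OF tp s(2)])
  then obtain Q where evQ: "\<forall>\<^sub>F m in sequentially. uniform_prob (tuples m) (?L m) (\<lambda>h. \<not> run_ok a A m (?L m) h) \<le> Q * real m powr (-100)"
    unfolding typical_def by blast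
  have "(\<lambda>m. Q * real m powr (-100) + (\<Sum>k\<in>{1..M}. uniform_prob (tuples m) (?L m) (\<lambda>h. \<epsilon> < \<bar>freq m (graph m h) k - rho k s\<bar>)))
      \<longlonglongrightarrow> 0 + (\<Sum>k\<in>{1..M}. 0)"
  proof (intro tendsto_add tendsto_sum)
    show "(\<lambda>m. Q * real m powr (-100)) \<longlonglongrightarrow> 0" by real_asymp
    fix k assume "k \<in> {1..M}"
    then show "(\<lambda>m. uniform_prob (tuples m) (?L m) (\<lambda>h. \<epsilon> < \<bar>freq m (graph m h) k - rho k s\<bar>)) \<longlonglongrightarrow> 0"
      using rho_limit[OF tps s(1), of k] \<epsilon> by (auto simp: density_limit_def)
  qed
  then have ev1: "\<forall>\<^sub>F m in sequentially. Q * real m powr (-100)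
      + (\<Sum>k\<in>{1..M}. uniform_prob (tuples m) (?L m) (\<lambda>h. \<epsilon> < \<bar>freq m (graph m h) k - rho k s\<bar>)) < 1"
    by (intro order_tendstoD(2)) auto
  have ev2: "\<forall>\<^sub>F m in sequentially. err a A m < \<epsilon> / stab t a A"
    using \<epsilon> st by (intro order_tendstoD(2)[OF err_tendsto(1)[OF a]]) simp
  have "\<forall>\<^sub>F m in sequentially. (\<Sum>k\<in>{1..M}. \<bar>?x k - rho k s\<bar>) \<le> stab t a A * err a A n + e"
    using ev1 ev2 evQ eventually_large[OF a(1), of A] eventually_ge_at_top[of "M + 1"]
  proof eventually_elim
    case (elim m)
    let ?bad = "\<lambda>h. \<not> run_ok a A m (?L m) h \<or> (\<exists>k\<in>{1..M}. \<epsilon> < \<bar>freq m (graph m h) k - rho k s\<bar>)"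
    have "uniform_prob (tuples m) (?L m) ?bad \<le> uniform_prob (tuples m) (?L m) (\<lambda>h. \<not> run_ok a A m (?L m) h)
       + uniform_prob (tuples m) (?L m) (\<lambda>h. \<exists>k\<in>{1..M}. \<epsilon> < \<bar>freq m (graph m h) k - rho k s\<bar>)" by (rule uniform_prob_disj)
    also have "\<dots> \<le> Q * real m powr (-100)
      + (\<Sum>k\<in>{1..M}. uniform_prob (tuples m) (?L m) (\<lambda>h. \<epsilon> < \<bar>freq m (graph m h) k - rho k s\<bar>))"
      by (intro add_mono elim uniform_prob_bex) simp
    finally have "uniform_prob (tuples m) (?L m) ?bad < 1" using elim by linarith
    moreover have "uniform_prob (tuples m) (?L m) (\<lambda>h. \<not> ?bad h) = 1 - uniform_prob (tuples m) (?L m) ?bad"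
      by (rule uniform_prob_not[OF finite_tuples tuples_nonempty]) (use elim in simp)
    ultimately have "0 < uniform_prob (tuples m) (?L m) (\<lambda>h. \<not> ?bad h)" by linarith
    from uniform_prob_pos_ex[OF this] obtain h' where h': "h' \<in> hists (tuples m) (?L m)" "\<not> ?bad h'" by blast
    let ?y = "hist_run m h' (?L m)"
    have y: "?y = freq m (graph m h')" using h' by (simp add: hist_run_def[abs_def])
    have "(\<Sum>k\<in>{1..M}. \<bar>?x k - rho k s\<bar>) \<le> (\<Sum>k\<in>{1..M}. \<bar>?x k - ?y k\<bar> + \<epsilon>)"
    proof (rule sum_mono)
      fix k assume "k \<in> {1..M}"
      then have "\<bar>?y k - rho k s\<bar> \<le> \<epsilon>" using h'(2) unfolding y by (auto simp: not_less)
      then show "\<bar>?x k - rho k s\<bar> \<le> \<bar>?x k - ?y k\<bar> + \<epsilon>"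
        using abs_triangle_ineq[of "?x k - ?y k" "?y k - rho k s"] by simp
    qed
    also have "\<dots> = (\<Sum>k\<in>{1..M}. \<bar>?x k - ?y k\<bar>) + real M * \<epsilon>" by (simp add: sum.distrib)
    also have "(\<Sum>k\<in>{1..M}. \<bar>?x k - ?y k\<bar>) \<le> (\<Sum>k\<in>{1..max n m}. \<bar>?x k - ?y k\<bar>)"
      by (rule sum_mono2) (use elim in auto)
    also have "\<dots> \<le> stab t a A * (err a A n + err a A m)"
      by (rule hist_runs_close[OF a n(1-3) elim(4) _ _ s n(4)]) (use h' in auto)
    also have "\<dots> \<le> stab t a A * err a A n + \<epsilon>"
      using elim(2) st by (simp add: field_simps)
    finally have "(\<Sum>k\<in>{1..M}. \<bar>?x k - rho k s\<bar>) \<le> stab t a A * err a A n + (real M + 1) * \<epsilon>"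
      by (simp add: algebra_simps)
    then show ?case by (simp add: \<epsilon>_def)
  qed
  then show "(\<Sum>k\<in>{1..M}. \<bar>?x k - rho k s\<bar>) \<le> stab t a A * err a A n + e" by simp
qed

lemma rho_close_single:
  assumes tp: "typical a A t" and s: "0 \<le> s" "s \<le> t" and k: "1 \<le> k"
    and n: "large a A n" "run_ok a A n T h" "T \<le> length h" "nat \<lfloor>s * real n\<rfloor> \<le> T"
  shows "\<bar>hist_run n h (nat \<lfloor>s * real n\<rfloor>) k - rho k s\<bar> \<le> stab t a A * err a A n"
proof -
  have "\<bar>hist_run n h (nat \<lfloor>s * real n\<rfloor>) k - rho k s\<bar> \<le> (\<Sum>j\<in>{1..k}. \<bar>hist_run n h (nat \<lfloor>s * real n\<rfloor>) j - rho j s\<bar>)"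
    by (rule member_le_sum) (use k in auto)
  then show ?thesis using rho_close[OF tp s n, of k] by linarith
qed

lemma rho_bounds:
  assumes tp: "typical a A t" and s: "0 \<le> s" "s \<le> t" and k: "1 \<le> k"
  shows "0 \<le> rho k s" "rho k s \<le> 1" "rho k s \<le> A * exp (- a * real k)"
proof -
  have a: "0 < a" "0 < A" using typical_pos[OF tp] by auto
  have ev: "\<forall>\<^sub>F n in sequentially. 0 \<le> rho k s + stab t a A * err a A n \<and> rho k s \<le> 1 + stab t a A * err a A n
      \<and> rho k s \<le> A * exp (- a * real k) + stab t a A * err a A n"
    using typical_history[OF tp]
  proof eventually_elim
    case (elim n)
    let ?L = "nat \<lfloor>s * real n\<rfloor>" and ?T = "nat \<lfloor>t * real n\<rfloor>"
    obtain h where n: "large a A n" and h: "h \<in> hists (tuples n) ?T" "run_ok a A n ?T h" using elim by blast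
    have LT: "?L \<le> ?T" using s by (intro nat_mono floor_mono mult_right_mono) auto
    have "\<bar>hist_run n h ?L k - rho k s\<bar> \<le> stab t a A * err a A n"
      by (rule rho_close_single[OF tp s k n h(2) _ LT]) (use h in auto)
    moreover have "0 \<le> hist_run n h ?L k" "hist_run n h ?L k \<le> 1" "hist_run n h ?L k \<le> A * exp (- a * real k)"
      using n h LT k freq_tail[of a A n "graph n (take ?L h)" k] freq_le_1[of n "graph n (take ?L h)" k]
      by (auto simp: hist_run_def large_def run_ok_def)
    ultimately show ?case by linarith
  qed
  have lim: "(\<lambda>n. c + stab t a A * err a A n) \<longlonglongrightarrow> c + stab t a A * 0" for c
    by (intro tendsto_intros err_tendsto a)
  have ge: "y \<le> c" if "\<forall>\<^sub>F n in sequentially. y \<le> c + stab t a A * err a A n" for y c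
    using tendsto_lowerbound[OF lim[of c] that] by simp
  show "0 \<le> rho k s" by (rule ge, rule eventually_mono[OF ev]) auto
  show "rho k s \<le> 1" by (rule ge, rule eventually_mono[OF ev]) auto
  show "rho k s \<le> A * exp (- a * real k)" by (rule ge, rule eventually_mono[OF ev]) auto
qed

lemma rho_has_sum:
  assumes tp: "typical a A t" and t: "0 \<le> t"
  shows "((\<lambda>k. rho k t) has_sum 1) {1..}"
proof (rule has_sum_from_partial_sums)
  have a: "0 < a" "0 < A" using typical_pos[OF tp] by auto
  show "0 \<le> rho k t" if "1 \<le> k" for k by (rule rho_bounds(1)[OF tp t order_refl that])
  show "(\<lambda>J. \<Sum>k\<in>{1..J}. rho k t) \<longlonglongrightarrow> 1"
  proof (rule metric_LIMSEQ_I)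
    fix e :: real assume e: "0 < e"
    have "(\<lambda>n. stab t a A * err a A n) \<longlonglongrightarrow> stab t a A * 0" by (intro tendsto_intros err_tendsto a)
    then have "\<forall>\<^sub>F n in sequentially. stab t a A * err a A n < e" using e by (intro order_tendstoD(2)) auto
    with typical_history[OF tp] have "\<forall>\<^sub>F n in sequentially. (large a A n \<and> (\<exists>h\<in>hists (tuples n) (nat \<lfloor>t * real n\<rfloor>). run_ok a A n (nat \<lfloor>t * real n\<rfloor>) h)) \<and> stab t a A * err a A n < e"
      by (rule eventually_conj)
    then obtain n h where n: "large a A n" "stab t a A * err a A n < e"
      and h: "h \<in> hists (tuples n) (nat \<lfloor>t * real n\<rfloor>)" "run_ok a A n (nat \<lfloor>t * real n\<rfloor>) h"
      by (force simp: eventually_sequentially)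
    let ?x = "hist_run n h (nat \<lfloor>t * real n\<rfloor>)"
    show "\<exists>no. \<forall>J\<ge>no. dist (\<Sum>k\<in>{1..J}. rho k t) 1 < e"
    proof (intro exI allI impI)
      fix J assume J: "n \<le> J"
      have "(\<Sum>k\<in>{1..J}. ?x k) = (\<Sum>k\<in>{1..n}. ?x k)"
      proof (rule sum.mono_neutral_right)
        show "\<forall>k\<in>{1..J} - {1..n}. ?x k = 0"
        proof
          fix k assume "k \<in> {1..J} - {1..n}"
          then have "{v \<in> {1..n}. csize n (graph n (take (nat \<lfloor>t * real n\<rfloor>) h)) v = k} = {}"
            using csize_le[of n "graph n (take (nat \<lfloor>t * real n\<rfloor>) h)"] by auto
          then show "?x k = 0" by (simp add: hist_run_def freq_def N_eq_def)
        qed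
      qed (use J in auto)
      also have "\<dots> = 1" using n by (simp add: hist_run_def freq_sum large_def)
      finally have "\<bar>(\<Sum>k\<in>{1..J}. rho k t) - 1\<bar> = \<bar>\<Sum>k\<in>{1..J}. rho k t - ?x k\<bar>" by (simp add: sum_subtractf)
      also have "\<dots> \<le> (\<Sum>k\<in>{1..J}. \<bar>?x k - rho k t\<bar>)"
        by (rule order.trans[OF sum_abs]) (simp add: abs_minus_commute)
      also have "\<dots> \<le> stab t a A * err a A n"
        by (rule rho_close[OF tp t order_refl n(1) h(2) _ order_refl]) (use h in auto)
      finally show "dist (\<Sum>k\<in>{1..J}. rho k t) 1 < e" using n(2) by (simp add: dist_real_def)
    qed
  qed
qed

text \<open>Sizes up to \<open>max_size a n\<close> are compared in \<open>L\<^sup>1\<close>, which costs a factor of order \<open>log n\<close>. Larger sizes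
do not occur in the graph, and they contribute \<open>O(1/n)\<close> to the limit because of its exponential tail.\<close>

lemma susceptibility_close:
  assumes tp: "typical a A t" and s: "0 \<le> s" "s \<le> t"
    and n: "large a A n" "run_ok a A n T h" "T \<le> length h" "nat \<lfloor>s * real n\<rfloor> \<le> T"
  shows "\<bar>susceptibility n (graph n (take (nat \<lfloor>s * real n\<rfloor>) h)) - (\<Sum>\<^sub>\<infinity>k\<in>{1..}. real k * rho k s)\<bar>
    \<le> stab t a A * ((max_size a n + 2) * err a A n) + 4 * A / a\<^sup>2 / real n"
proof -
  have a: "0 < a" "0 < A" using typical_pos[OF tp] by auto
  have t: "0 \<le> t" using s by simp
  have st: "0 < stab t a A" using stab_ge_1[OF a t] by simp
  let ?i = "nat \<lfloor>s * real n\<rfloor>"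
  let ?x = "hist_run n h ?i" and ?S = "susceptibility n (graph n (take ?i h))"
  have tl: "tails a A n (graph n (take ?i h))" using n by (simp add: run_ok_def)
  define M where "M = nat \<lceil>max_size a n\<rceil>"
  have K1: "1 \<le> max_size a n" using n by (simp add: large_def)
  have M: "max_size a n \<le> real M" "real M \<le> max_size a n + 1" using K1 by (auto simp: M_def)
  have e0: "0 \<le> err a A n" using a n(1) by (auto simp: run_error_def fluct_def large_def)
  have x0: "?x k = 0" if "max_size a n < real k \<or> n < k" for k
  proof (cases "n < k")
    case True
    then have "{v \<in> {1..n}. csize n (graph n (take ?i h)) v = k} = {}"
      using csize_le[of n "graph n (take ?i h)"] by (auto simp: not_le dest: leD)
    then show ?thesis by (simp add: hist_run_def freq_def N_eq_def)
  next
    case False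
    then show ?thesis using that freq_large[OF tl a, of k] n(1) by (simp add: hist_run_def large_def)
  qed
  have S: "?S = (\<Sum>k\<in>{1..J}. real k * ?x k)" if "M \<le> J" for J
  proof -
    have "?S = (\<Sum>k\<in>{1..n}. real k * ?x k)" by (simp add: freq_mean[symmetric] hist_run_def)
    also have "\<dots> = (\<Sum>k\<in>{1..max n J}. real k * ?x k)"
      by (rule sum.mono_neutral_left) (use x0 in auto)
    also have "\<dots> = (\<Sum>k\<in>{1..J}. real k * ?x k)"
    proof (rule sum.mono_neutral_right)
      show "\<forall>k\<in>{1..max n J} - {1..J}. real k * ?x k = 0"
      proof
        fix k assume "k \<in> {1..max n J} - {1..J}"
        then have "real M < real k" using that by auto
        then show "real k * ?x k = 0" using M x0[of k] by simp
      qed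
    qed auto
    finally show ?thesis .
  qed
  let ?B = "stab t a A * ((max_size a n + 2) * err a A n) + 4 * A / a\<^sup>2 / real n"
  have bound: "\<bar>?S - (\<Sum>k\<in>{1..J}. real k * rho k s)\<bar> \<le> ?B" if J: "M \<le> J" for J
  proof -
    have rho: "0 \<le> rho k s" "rho k s \<le> A * exp (- a * real k)" if "1 \<le> k" for k
      using rho_bounds[OF tp s that] by auto
    have split: "(\<Sum>k\<in>{1..J}. f k) = (\<Sum>k\<in>{1..M}. f k) + (\<Sum>k\<in>{M + 1..J}. f k)" for f :: "nat \<Rightarrow> real"
    proof -
      have "{1..J} = {1..M} \<union> {M + 1..J}" using J by auto
      then show ?thesis by (simp only:) (rule sum.union_disjoint, auto)
    qed
    have "\<bar>?S - (\<Sum>k\<in>{1..J}. real k * rho k s)\<bar>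
      = \<bar>(\<Sum>k\<in>{1..M}. real k * (?x k - rho k s)) - (\<Sum>k\<in>{M + 1..J}. real k * rho k s)\<bar>"
      unfolding S[OF order_refl] split[of "\<lambda>k. real k * rho k s"] by (simp add: sum_subtractf right_diff_distrib)
    also have "\<dots> \<le> \<bar>\<Sum>k\<in>{1..M}. real k * (?x k - rho k s)\<bar> + \<bar>\<Sum>k\<in>{M + 1..J}. real k * rho k s\<bar>"
      by (rule abs_triangle_ineq4)
    also have "\<bar>\<Sum>k\<in>{M + 1..J}. real k * rho k s\<bar> = (\<Sum>k\<in>{M + 1..J}. real k * rho k s)"
      by (rule abs_of_nonneg) (auto intro!: sum_nonneg mult_nonneg_nonneg rho)
    also have "\<dots> \<le> 4 * A / a\<^sup>2 * exp (- (a / 2) * real M)"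
      by (rule weighted_tail_le) (use a rho in auto)
    also have "\<dots> \<le> 4 * A / a\<^sup>2 * (1 / real n)"
    proof (intro mult_left_mono)
      have "a / 2 * max_size a n \<le> a / 2 * real M" using M a by (intro mult_left_mono) auto
      then have "exp (- (a / 2) * real M) \<le> exp (- ln (real n))" using a by (simp add: max_size_def)
      also have "\<dots> = 1 / real n" using n(1) by (simp add: exp_minus large_def field_simps)
      finally show "exp (- (a / 2) * real M) \<le> 1 / real n" .
    qed (use a in auto)
    also have "\<bar>\<Sum>k\<in>{1..M}. real k * (?x k - rho k s)\<bar> \<le> (\<Sum>k\<in>{1..M}. real M * \<bar>?x k - rho k s\<bar>)"
      by (rule order.trans[OF sum_abs]) (auto intro!: sum_mono mult_right_mono simp: abs_mult)
    also have "\<dots> = real M * (\<Sum>k\<in>{1..M}. \<bar>?x k - rho k s\<bar>)" by (rule sum_distrib_left[symmetric])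
    also have "\<dots> \<le> (max_size a n + 2) * (stab t a A * err a A n)"
      using M K1 by (intro mult_mono rho_close[OF tp s n]) (auto intro!: sum_nonneg)
    finally show ?thesis by (simp add: mult_ac)
  qed
  let ?f = "\<lambda>J. \<Sum>k\<in>{1..J}. real k * rho k s"
  have mono: "incseq ?f"
    by (intro monoI sum_mono2) (auto intro!: mult_nonneg_nonneg rho_bounds(1)[OF tp s])
  have upper: "?f J \<le> ?S + ?B" for J
  proof -
    have "?f J \<le> ?f (max J M)" by (rule monoD[OF mono]) simp
    then show ?thesis using bound[of "max J M"] by (simp add: abs_le_iff)
  qed
  obtain L where L: "?f \<longlonglongrightarrow> L" using incseq_convergent[OF mono, of "?S + ?B"] upper by blast
  have "((\<lambda>k. real k * rho k s) has_sum L) {1..}"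
    by (rule has_sum_from_partial_sums[OF _ L]) (auto intro!: mult_nonneg_nonneg rho_bounds(1)[OF tp s])
  then have inf: "(\<Sum>\<^sub>\<infinity>k\<in>{1..}. real k * rho k s) = L" by (rule infsumI)
  have "(\<lambda>J. \<bar>?S - ?f J\<bar>) \<longlonglongrightarrow> \<bar>?S - L\<bar>" by (intro tendsto_intros L)
  then have "\<bar>?S - L\<bar> \<le> ?B"
    by (rule tendsto_upperbound) (use bound in \<open>auto simp: eventually_sequentially\<close>)
  then show ?thesis unfolding inf .
qed

text \<open>Each component contributes its size times the reciprocal of its size, that is, \<open>1\<close>.\<close>

definition num_components :: "nat \<Rightarrow> edges \<Rightarrow> real" where
  "num_components n E = (\<Sum>u\<in>{1..n}. 1 / real (csize n E u))"

text \<open>The rule selects at least one pair, so in a separated step at least two components merge. In this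
component the sum of the reciprocals drops from at least \<open>2\<close> to \<open>1\<close>, and no other summand grows.\<close>

lemma num_components_step:
  assumes E: "edges_on n E" and v: "v \<in> tuples n"
  shows "num_components n (step n v E) \<le> num_components n E - of_bool (separated n E v)"
proof -
  let ?d = "\<lambda>u. 1 / real (csize n E u) - 1 / real (csize n (step n v E) u)"
  have d0: "0 \<le> ?d u" if "u \<in> {1..n}" for u
    using csize_pos[OF that, of E] csize_mono[OF step_mono, of n E u n v] by (auto intro!: divide_left_mono)
  have "of_bool (separated n E v) \<le> (\<Sum>u\<in>{1..n}. ?d u)"
  proof (cases "separated n E v")
    case True
    let ?c = "csize n E \<circ> v"
    have pos: "\<And>j. j \<in> {1..l} \<Longrightarrow> 0 < ?c j" by (rule sizes_pos[OF E v])
    obtain e where "e \<in> chosen ?c" using chosenD(1)[of ?c, OF pos] by blast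
    then obtain a b where ab: "{a, b} \<in> chosen ?c" "a \<in> {1..l}" "b \<in> {1..l}" "a \<noteq> b"
      using chosenD(2)[of ?c, OF pos] by metis
    have new: "real (?c a + ?c b) \<le> real (new_size ?c j)" if "j = a \<or> j = b" for j
    proof -
      have eo: "edges_on l (chosen ?c)" by (rule edges_on_chosen[of ?c, OF pos])
      have "{a, b} \<subseteq> group ?c j"
        using that component_edge[OF eo self_in_component[OF ab(2)], of b] component_edge[OF eo self_in_component[OF ab(3)], of a]
          ab self_in_component[OF ab(2), of "chosen ?c"] self_in_component[OF ab(3), of "chosen ?c"]
        unfolding group_def by (auto simp: insert_commute)
      then have "(\<Sum>i\<in>{a, b}. ?c i) \<le> new_size ?c j"
        unfolding new_size_def by (intro sum_mono2) (auto simp: group_def)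
      then show ?thesis using ab by simp
    qed
    let ?U = "\<lambda>j. component n E (v j)"
    have disj: "?U a \<inter> ?U b = {}" using separated_index[OF E v True ab(2,3)] ab(4) by blast
    have part: "1 - real (?c j) / real (?c a + ?c b) \<le> (\<Sum>u\<in>?U j. ?d u)" if "j = a \<or> j = b" for j
    proof -
      have j: "j \<in> {1..l}" using that ab by auto
      have cj: "0 < ?c j" by (rule pos[OF j])
      have "(\<Sum>u\<in>?U j. 1 / real (?c j) - 1 / real (?c a + ?c b)) \<le> (\<Sum>u\<in>?U j. ?d u)"
      proof (rule sum_mono)
        fix u assume u: "u \<in> ?U j"
        have "csize n E u = ?c j" using component_cong[OF u] by simp
        moreover have "csize n (step n v E) u = new_size ?c j" by (rule csize_step_separated[OF E v True j u])
        moreover have "1 / real (new_size ?c j) \<le> 1 / real (?c a + ?c b)"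
          using new[OF that] pos[OF ab(2)] by (intro divide_left_mono) auto
        ultimately show "1 / real (?c j) - 1 / real (?c a + ?c b) \<le> ?d u" by simp
      qed
      moreover have "(\<Sum>u\<in>?U j. 1 / real (?c j) - 1 / real (?c a + ?c b)) = real (?c j) * (1 / real (?c j) - 1 / real (?c a + ?c b))"
        by (simp only: sum_constant o_apply)
      moreover have "r * (1 / r - 1 / r') = 1 - r / r'" if "0 < r" for r r' :: real
        using that by (simp add: right_diff_distrib)
      ultimately show ?thesis using cj by (simp only: of_nat_0_less_iff)
    qed
    have "0 < real (?c a + ?c b)" using pos[OF ab(2)] by simp
    then have "real (?c a) / real (?c a + ?c b) + real (?c b) / real (?c a + ?c b) = 1"
      by (simp add: add_divide_distrib[symmetric])
    then have "1 \<le> (\<Sum>u\<in>?U a. ?d u) + (\<Sum>u\<in>?U b. ?d u)" using part[of a] part[of b] by linarith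
    also have "\<dots> = (\<Sum>u\<in>?U a \<union> ?U b. ?d u)" by (rule sum.union_disjoint[symmetric]) (use disj in auto)
    also have "\<dots> \<le> (\<Sum>u\<in>{1..n}. ?d u)"
      by (rule sum_mono2) (use component_subset d0 in auto)
    finally show ?thesis using True by simp
  next
    case False then show ?thesis using d0 by (auto intro!: sum_nonneg)
  qed
  then show ?thesis by (simp add: num_components_def sum_subtractf)
qed

text \<open>The number of steps that pick some component twice and so may fail to merge anything.\<close>

definition failures :: "nat \<Rightarrow> (nat \<Rightarrow> nat) list \<Rightarrow> real" where
  "failures n h = (\<Sum>j<length h. of_bool (\<not> separated n (graph n (take j h)) (h ! j)))"

lemma failures_snoc: "failures n (h @ [v]) = failures n h + of_bool (\<not> separated n (graph n h) v)"
proof -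
  have "(\<Sum>j<length h. of_bool (\<not> separated n (graph n (take j (h @ [v]))) ((h @ [v]) ! j)))
    = (\<Sum>j<length h. of_bool (\<not> separated n (graph n (take j h)) (h ! j)) :: real)"
    by (intro sum.cong) (auto simp: nth_append)
  then show ?thesis by (simp add: failures_def)
qed

lemma num_components_le:
  "set h \<subseteq> tuples n \<Longrightarrow> num_components n (graph n h) \<le> real n - real (length h) + failures n h"
proof (induction h rule: rev_induct)
  case Nil then show ?case by (simp add: num_components_def failures_def)
next
  case (snoc v h)
  have "num_components n (step n v (graph n h)) \<le> num_components n (graph n h) - of_bool (separated n (graph n h) v)"
    using snoc.prems by (intro num_components_step edges_on_graph) auto
  then show ?case using snoc by (auto simp: failures_snoc of_bool_def split: if_splits)
qed

text \<open>The mean of the reciprocal sizes is at least the reciprocal of the mean size.\<close>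

lemma num_components_ge:
  assumes "susceptibility n E \<le> C" "0 < C" "0 < n"
  shows "real n / C \<le> num_components n E"
proof -
  have "(\<Sum>u\<in>{1..n}. 2 / C - real (csize n E u) / C\<^sup>2) \<le> num_components n E"
    unfolding num_components_def
  proof (rule sum_mono)
    fix u assume "u \<in> {1..n}"
    then have c: "0 < real (csize n E u)" by simp
    let ?c = "real (csize n E u)"
    have "1 / c * (1 - c / C)\<^sup>2 = 1 / c - 2 / C + c / C\<^sup>2" if "0 < c" for c :: real
      using that assms(2) unfolding power2_diff by (simp add: field_simps power2_eq_square)
    from this[OF c] have "1 / ?c - 2 / C + ?c / C\<^sup>2 \<ge> 0"
      using c by (metis divide_nonneg_pos mult_nonneg_nonneg zero_le_one zero_le_power2)
    then show "2 / C - ?c / C\<^sup>2 \<le> 1 / ?c" by simp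
  qed
  moreover have "(\<Sum>u\<in>{1..n}. 2 / C - real (csize n E u) / C\<^sup>2) = real n * (2 / C) - real n * susceptibility n E / C\<^sup>2"
    using assms by (simp add: sum_subtractf susceptibility_eq sum_divide_distrib[symmetric])
  moreover have "real n * susceptibility n E / C\<^sup>2 \<le> real n * C / C\<^sup>2"
    using assms by (intro divide_right_mono mult_left_mono) auto
  moreover have "real n * (2 / C) - real n * C / C\<^sup>2 = real n / C"
    using assms by (simp add: power2_eq_square field_simps)
  ultimately show ?thesis by linarith
qed

text \<open>After \<open>n\<close> steps the number of components is at most the number of failures. While \<open>S \<le> C\<close> a step
fails with probability at most \<open>l\<^sup>2 * C / n\<close>, so at most \<open>l\<^sup>2 * C\<close> failures are expected altogether, whereas
\<open>S \<le> C\<close> at the end would require \<open>n / C\<close> components.\<close>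

lemma bounded_susceptibility_at_1:
  assumes n: "0 < n" and C: "0 < C"
  shows "uniform_prob (tuples n) n (\<lambda>h. susceptibility n (graph n h) \<le> C) \<le> (real l)\<^sup>2 * C\<^sup>2 / n"
proof -
  define \<kappa> where "\<kappa> = (real l)\<^sup>2 * C / n"
  have \<kappa>: "0 \<le> \<kappa>" using C by (simp add: \<kappa>_def)
  \<comment> \<open>Failures so far plus the bound for those that are still to come.\<close>
  define W where "W h = failures n h + real (n - length h) * \<kappa>" for h
  let ?good = "\<lambda>h. susceptibility n (graph n h) \<le> C"
  have f0: "0 \<le> failures n h" for h by (simp add: failures_def sum_nonneg)
  have step: "(\<Sum>v\<in>tuples n. W (h @ [v])) / card (tuples n) \<le> 1 * W h"
    if h: "set h \<subseteq> tuples n" "length h < length [] + n" "?good h" for h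
  proof -
    have "tavg n (\<lambda>v. W (h @ [v])) = failures n h + tavg n (\<lambda>v. of_bool (\<not> separated n (graph n h) v)) + real (n - Suc (length h)) * \<kappa>"
      by (simp add: W_def failures_snoc tavg_add tavg_const[OF n])
    also have "tavg n (\<lambda>v. of_bool (\<not> separated n (graph n h) v)) \<le> (real l)\<^sup>2 * susceptibility n (graph n h) / n"
      by (rule tavg_not_separated[OF n])
    also have "\<dots> \<le> \<kappa>" unfolding \<kappa>_def using h(3) by (intro divide_right_mono mult_left_mono) auto
    also have "failures n h + \<kappa> + real (n - Suc (length h)) * \<kappa> = W h"
      using h(2) by (simp add: W_def of_nat_diff algebra_simps)
    finally show ?thesis by (simp add: tavg_def)
  qed
  have "uniform_prob (tuples n) n (\<lambda>h. susceptibility n (graph n h) \<le> C)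
    \<le> uniform_prob (tuples n) n (\<lambda>h. \<exists>i\<le>n. (\<forall>j<i. ?good ([] @ take j h)) \<and> real n / C \<le> W ([] @ take i h))"
  proof (rule uniform_prob_mono)
    fix h assume h: "h \<in> hists (tuples n) n" and S: "susceptibility n (graph n h) \<le> C"
    have "real n / C \<le> failures n h"
      using num_components_ge[OF S C n] num_components_le[of h n] h by simp
    then have "real n / C \<le> W (take n h)" using h by (simp add: W_def)
    moreover have "?good (take j h)" for j using susceptibility_take_le[of n j h] S by linarith
    ultimately show "\<exists>i\<le>n. (\<forall>j<i. ?good ([] @ take j h)) \<and> real n / C \<le> W ([] @ take i h)"
      by (intro exI[of _ n]) auto
  qed
  also have "\<dots> \<le> 1 ^ n * W [] / (real n / C)"
    by (rule maximal_inequality[OF finite_tuples tuples_nonempty[OF n] _ _ _ step])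
      (use n C f0 \<kappa> in \<open>auto simp: W_def\<close>)
  also have "\<dots> = (real l)\<^sup>2 * C\<^sup>2 / n"
    using n by (simp add: W_def failures_def \<kappa>_def power2_eq_square field_simps)
  finally show ?thesis .
qed

lemma not_weakly_subcritical_1: "\<not> weakly_subcritical 1"
  unfolding weakly_subcritical_def not_ex not_not
proof
  fix C :: real
  define C' where "C' = max C 1"
  have C': "0 < C'" "C \<le> C'" by (auto simp: C'_def)
  have "\<forall>\<^sub>F n in sequentially. uniform_prob (tuples n) (nat \<lfloor>1 * real n\<rfloor>) (\<lambda>h. susceptibility n (graph n h) \<le> C) \<le> (real l)\<^sup>2 * C'\<^sup>2 / n"
    using eventually_gt_at_top[of 0]
  proof eventually_elim
    case (elim n)
    have "uniform_prob (tuples n) n (\<lambda>h. susceptibility n (graph n h) \<le> C) \<le> uniform_prob (tuples n) n (\<lambda>h. susceptibility n (graph n h) \<le> C')"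
      using C' by (intro uniform_prob_mono) auto
    also have "\<dots> \<le> (real l)\<^sup>2 * C'\<^sup>2 / n" by (rule bounded_susceptibility_at_1) (use elim C' in auto)
    finally show ?case by simp
  qed
  moreover have "(\<lambda>n. (real l)\<^sup>2 * C'\<^sup>2 / real n) \<longlonglongrightarrow> 0" by real_asymp
  ultimately show "(\<lambda>n. uniform_prob (tuples n) (nat \<lfloor>1 * real n\<rfloor>) (\<lambda>h. susceptibility n (graph n h) \<le> C)) \<longlonglongrightarrow> 0"
    by (rule tendsto_zero_upper_bound) (rule uniform_prob_nonneg)
qed

end

section \<open>The infinite product measure and the main theorem\<close>

context size_rule_process
begin

text \<open>The first \<open>m\<close> rows of an outcome, each of them cut down to the indices \<open>{1..l}\<close> so that it is an
element of \<open>tuples n\<close> whenever its values lie in \<open>{1..n}\<close>.\<close>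

definition hist :: "nat \<Rightarrow> (nat \<times> nat \<Rightarrow> nat) \<Rightarrow> (nat \<Rightarrow> nat) list" where
  "hist m \<omega> = map (\<lambda>i. restrict (\<lambda>j. \<omega> (i, j)) {1..l}) [0..<m]"

definition in_range :: "nat \<Rightarrow> nat \<Rightarrow> (nat \<times> nat \<Rightarrow> nat) \<Rightarrow> bool" where
  "in_range n m \<omega> \<longleftrightarrow> (\<forall>i<m. \<forall>j\<in>{1..l}. \<omega> (i, j) \<in> {1..n})"

lemma step_restrict:
  assumes E: "edges_on n E" and v: "restrict v {1..l} \<in> tuples n"
  shows "step n v E = step n (restrict v {1..l}) E"
proof -
  let ?v = "restrict v {1..l}"
  have c: "chosen (csize n E \<circ> v) = chosen (csize n E \<circ> ?v)"
    unfolding chosen_def by (rule arg_cong[where f = R], rule map_cong) auto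
  have "{{v a, v b} | a b. {a, b} \<in> chosen (csize n E \<circ> ?v) \<and> v a \<noteq> v b}
    = {{?v a, ?v b} | a b. {a, b} \<in> chosen (csize n E \<circ> ?v) \<and> ?v a \<noteq> ?v b}"
  proof -
    have "v a = ?v a \<and> v b = ?v b" if "{a, b} \<in> chosen (csize n E \<circ> ?v)" for a b
      using chosen_subset[OF E v that] by simp
    then have "(e = {v a, v b} \<and> {a, b} \<in> chosen (csize n E \<circ> ?v) \<and> v a \<noteq> v b)
      = (e = {?v a, ?v b} \<and> {a, b} \<in> chosen (csize n E \<circ> ?v) \<and> ?v a \<noteq> ?v b)" for a b e
      by (cases "{a, b} \<in> chosen (csize n E \<circ> ?v)") (simp_all only: simp_thms)
    then show ?thesis by (simp only:)
  qed
  then show ?thesis unfolding step_eq c by (simp only:)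
qed

lemma hist_in_hists: "in_range n m \<omega> \<Longrightarrow> hist m \<omega> \<in> hists (tuples n) m"
  by (auto simp: hist_def in_range_def tuples_def)

lemma rule_graph_hist:
  assumes "in_range n m \<omega>" "i \<le> m"
  shows "rule_graph l R n \<omega> i = graph n (take i (hist m \<omega>))"
  using assms(2)
proof (induction i)
  case (Suc i)
  let ?v = "restrict (\<lambda>j. \<omega> (i, j)) {1..l}"
  have h: "hist m \<omega> \<in> hists (tuples n) m" by (rule hist_in_hists[OF assms(1)])
  have nth: "hist m \<omega> ! i = ?v" using Suc.prems by (simp add: hist_def)
  have v: "?v \<in> tuples n" using assms(1) Suc.prems by (auto simp: in_range_def tuples_def)
  have E: "edges_on n (graph n (take i (hist m \<omega>)))"
    using h set_take_subset[of i "hist m \<omega>"] by (intro edges_on_graph) auto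
  have "rule_graph l R n \<omega> (Suc i) = step n (\<lambda>j. \<omega> (i, j)) (graph n (take i (hist m \<omega>)))"
    using Suc by simp
  also have "\<dots> = step n ?v (graph n (take i (hist m \<omega>)))" by (rule step_restrict[OF E v])
  also have "\<dots> = graph n (take (Suc i) (hist m \<omega>))"
    using Suc.prems h by (simp add: take_Suc_conv_app_nth nth)
  finally show ?case .
qed simp

lemma rule_graph_cong:
  assumes "\<And>i' j. i' < i \<Longrightarrow> \<omega> (i', j) = \<omega>' (i', j)"
  shows "rule_graph l R n \<omega> i = rule_graph l R n \<omega>' i"
  using assms
proof (induction i)
  case (Suc i)
  have "rule_graph l R n \<omega> i = rule_graph l R n \<omega>' i" using Suc by simp
  moreover have "(\<lambda>j. \<omega> (i, j)) = (\<lambda>j. \<omega>' (i, j))" using Suc.prems by auto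
  ultimately show ?case by simp
qed simp

context
  fixes n m :: nat
  assumes n: "0 < n"
begin

lemma product_prob_space_choices: "product_prob_space (\<lambda>_ :: nat \<times> nat. measure_pmf (pmf_of_set {1..n}))"
  by (intro product_prob_spaceI prob_space_measure_pmf)

lemma space_choices: "space (choices l n) = PiE (UNIV \<times> {1..l}) (\<lambda>_. UNIV)"
  by (simp add: choices_def space_PiM)

text \<open>Cylinder sets. Those given by values in \<open>{1..n}\<close> have equal measure and correspond to the histories
of length \<open>m\<close>.\<close>

definition agreeing :: "(nat \<times> nat \<Rightarrow> nat) \<Rightarrow> (nat \<times> nat \<Rightarrow> nat) set" where
  "agreeing f = {\<omega> \<in> space (choices l n). \<forall>x\<in>{..<m} \<times> {1..l}. \<omega> x = f x}"

lemma agreeing_emb: "agreeing f = prod_emb (UNIV \<times> {1..l}) (\<lambda>_. measure_pmf (pmf_of_set {1..n})) ({..<m} \<times> {1..l})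
    (PiE ({..<m} \<times> {1..l}) (\<lambda>x. {f x}))"
  unfolding agreeing_def space_choices prod_emb_def
  by (rule set_eqI) (simp only: mem_Collect_eq Int_iff vimage_eq restrict_PiE_iff singleton_iff space_measure_pmf conj_commute)

lemma agreeing_sets: "agreeing f \<in> sets (choices l n)"
  unfolding agreeing_emb choices_def by (rule sets_PiM_I) auto

lemma measure_agreeing:
  assumes "\<And>x. x \<in> {..<m} \<times> {1..l} \<Longrightarrow> f x \<in> {1..n}"
  shows "measure (choices l n) (agreeing f) = 1 / real n ^ (l * m)"
proof -
  interpret P: product_prob_space "\<lambda>_ :: nat \<times> nat. measure_pmf (pmf_of_set {1..n})" "UNIV \<times> {1..l}"
    by (rule product_prob_space_choices)
  have "measure (choices l n) (agreeing f) = (\<Prod>x\<in>{..<m} \<times> {1..l}. measure (measure_pmf (pmf_of_set {1..n})) {f x})"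
    unfolding agreeing_emb choices_def by (rule P.measure_PiM_emb) auto
  also have "\<dots> = (\<Prod>x\<in>{..<m} \<times> {1..l}. 1 / real n)"
    using n assms by (intro prod.cong refl) (auto simp: measure_pmf_of_set)
  also have "\<dots> = 1 / real n ^ (l * m)" by (simp add: power_one_over mult.commute)
  finally show ?thesis .
qed

definition row_determined :: "((nat \<times> nat \<Rightarrow> nat) \<Rightarrow> bool) \<Rightarrow> bool" where
  "row_determined P \<longleftrightarrow> (\<forall>\<omega> \<omega>'. (\<forall>i<m. \<forall>j. \<omega> (i, j) = \<omega>' (i, j)) \<longrightarrow> P \<omega> = P \<omega>')"

text \<open>Outcomes may take arbitrary natural numbers as values, also those of probability \<open>0\<close>, so the event is
a countable union of cylinders and in general not a finite one.\<close>

lemma row_determined_sets: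
  assumes P: "row_determined P"
  shows "{\<omega> \<in> space (choices l n). P \<omega>} \<in> sets (choices l n)"
proof -
  let ?J = "{..<m} \<times> {1..l}"
  let ?F = "{f \<in> PiE ?J (\<lambda>_. UNIV). \<exists>\<omega>\<in>space (choices l n). P \<omega> \<and> restrict \<omega> ?J = f}"
  have "countable (PiE ?J (\<lambda>_. UNIV :: nat set))" by (rule countable_PiE) auto
  then have F: "countable ?F" by (rule countable_subset[rotated]) auto
  have "{\<omega> \<in> space (choices l n). P \<omega>} = (\<Union>f\<in>?F. agreeing f)"
  proof (intro equalityI subsetI)
    fix \<omega> assume "\<omega> \<in> {\<omega> \<in> space (choices l n). P \<omega>}"
    then have "\<omega> \<in> agreeing (restrict \<omega> ?J)" "restrict \<omega> ?J \<in> ?F" by (auto simp: agreeing_def)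
    then show "\<omega> \<in> (\<Union>f\<in>?F. agreeing f)" by blast
  next
    fix \<omega> assume "\<omega> \<in> (\<Union>f\<in>?F. agreeing f)"
    then obtain \<omega>' where \<omega>: "\<omega> \<in> space (choices l n)" "\<omega>' \<in> space (choices l n)" "P \<omega>'"
      and eq: "\<forall>x\<in>?J. \<omega> x = restrict \<omega>' ?J x" by (auto simp: agreeing_def)
    have "\<omega> (i, j) = \<omega>' (i, j)" if "i < m" for i j
    proof (cases "j \<in> {1..l}")
      case True then show ?thesis using bspec[OF eq, of "(i, j)"] that by simp
    next
      case False
      then have "(i, j) \<notin> UNIV \<times> {1..l}" by auto
      then show ?thesis
        using PiE_arb[OF \<omega>(1)[unfolded space_choices]] PiE_arb[OF \<omega>(2)[unfolded space_choices]] by simp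
    qed
    then have "P \<omega>" using P \<omega>(3) unfolding row_determined_def by blast
    then show "\<omega> \<in> {\<omega> \<in> space (choices l n). P \<omega>}" using \<omega> by simp
  qed
  also have "\<dots> \<in> sets (choices l n)" using F agreeing_sets by (intro sets.countable_UN') auto
  finally show ?thesis .
qed

lemma measure_choices_ge:
  assumes P: "row_determined P" and Q: "\<And>\<omega>. in_range n m \<omega> \<Longrightarrow> P \<omega> \<longleftrightarrow> Q (hist m \<omega>)"
  shows "uniform_prob (tuples n) m Q \<le> measure (choices l n) {\<omega> \<in> space (choices l n). P \<omega>}"
proof -
  interpret P: product_prob_space "\<lambda>_ :: nat \<times> nat. measure_pmf (pmf_of_set {1..n})" "UNIV \<times> {1..l}"
    by (rule product_prob_space_choices)
  interpret M: prob_space "choices l n" unfolding choices_def by (rule P.prob_space_axioms)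
  let ?J = "{..<m} \<times> {1..l}"
  let ?B = "{h \<in> hists (tuples n) m. Q h}"
  define cyl where "cyl h = agreeing (\<lambda>x. (h ! fst x) (snd x))" for h
  have fin: "finite ?B"
    by (rule finite_subset[OF _ finite_lists_length_eq[OF finite_tuples, of n m]]) auto
  have cyl_hist: "in_range n m \<omega> \<and> hist m \<omega> = h" if h: "h \<in> hists (tuples n) m" and \<omega>: "\<omega> \<in> cyl h" for h \<omega>
  proof -
    have eq: "\<omega> (i, j) = (h ! i) j" if "i < m" "j \<in> {1..l}" for i j
      using \<omega> that unfolding cyl_def agreeing_def by auto
    have hi: "h ! i \<in> tuples n" if "i < m" for i using h that by (auto simp: subset_iff)
    have "in_range n m \<omega>"
      unfolding in_range_def using eq hi tuplesD by metis
    moreover have "hist m \<omega> = h"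
    proof (rule nth_equalityI)
      show "length (hist m \<omega>) = length h" using h by (simp add: hist_def)
      fix i assume "i < length (hist m \<omega>)"
      then have i: "i < m" by (simp add: hist_def)
      have "restrict (\<lambda>j. \<omega> (i, j)) {1..l} = h ! i"
      proof (rule ext)
        fix j
        show "restrict (\<lambda>j. \<omega> (i, j)) {1..l} j = (h ! i) j"
          using eq[OF i, of j] PiE_arb[OF hi[OF i, unfolded tuples_def], of j] by (cases "j \<in> {1..l}") simp_all
      qed
      then show "hist m \<omega> ! i = h ! i" using i by (simp add: hist_def)
    qed
    ultimately show ?thesis ..
  qed
  have disj: "disjoint_family_on cyl ?B"
    unfolding disjoint_family_on_def using cyl_hist by blast
  have meas: "measure (choices l n) (cyl h) = 1 / real n ^ (l * m)" if h: "h \<in> ?B" for h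
    unfolding cyl_def
  proof (rule measure_agreeing)
    fix x assume x: "x \<in> ?J"
    then have "h ! fst x \<in> tuples n" using h by (auto simp: subset_iff)
    then show "(h ! fst x) (snd x) \<in> {1..n}" by (rule tuplesD) (use x in auto)
  qed
  have "uniform_prob (tuples n) m Q = (\<Sum>h\<in>?B. measure (choices l n) (cyl h))"
    by (simp add: uniform_prob_eq_card meas card_tuples power_mult)
  also have "\<dots> = measure (choices l n) (\<Union>h\<in>?B. cyl h)"
  proof (rule M.finite_measure_finite_Union[symmetric, OF fin _ disj])
    show "cyl ` ?B \<subseteq> sets (choices l n)" unfolding cyl_def using agreeing_sets by blast
  qed
  also have "\<dots> \<le> measure (choices l n) {\<omega> \<in> space (choices l n). P \<omega>}"
  proof (rule M.finite_measure_mono)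
    show "(\<Union>h\<in>?B. cyl h) \<subseteq> {\<omega> \<in> space (choices l n). P \<omega>}"
    proof
      fix \<omega> assume "\<omega> \<in> (\<Union>h\<in>?B. cyl h)"
      then obtain h where h: "h \<in> ?B" "\<omega> \<in> cyl h" by blast
      then have "in_range n m \<omega> \<and> hist m \<omega> = h" by (intro cyl_hist) auto
      then show "\<omega> \<in> {\<omega> \<in> space (choices l n). P \<omega>}" using h Q by (auto simp: cyl_def agreeing_def)
    qed
  qed (rule row_determined_sets[OF P])
  finally show ?thesis .
qed

text \<open>The cylinders of the histories satisfying \<open>Q\<close> give a lower bound for the measure; the same bound for
the complementary event makes it an equality.\<close>

lemma measure_choices:
  assumes P: "row_determined P" and Q: "\<And>\<omega>. in_range n m \<omega> \<Longrightarrow> P \<omega> \<longleftrightarrow> Q (hist m \<omega>)"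
  shows "measure (choices l n) {\<omega> \<in> space (choices l n). P \<omega>} = uniform_prob (tuples n) m Q"
proof (rule antisym)
  interpret P: product_prob_space "\<lambda>_ :: nat \<times> nat. measure_pmf (pmf_of_set {1..n})" "UNIV \<times> {1..l}"
    by (rule product_prob_space_choices)
  interpret M: prob_space "choices l n" unfolding choices_def by (rule P.prob_space_axioms)
  have nP: "row_determined (\<lambda>\<omega>. \<not> P \<omega>)" using P unfolding row_determined_def by simp
  have "1 - uniform_prob (tuples n) m Q = uniform_prob (tuples n) m (\<lambda>h. \<not> Q h)"
    by (rule uniform_prob_not[OF finite_tuples tuples_nonempty[OF n], symmetric])
  also have "\<dots> \<le> measure (choices l n) {\<omega> \<in> space (choices l n). \<not> P \<omega>}"
    by (rule measure_choices_ge[OF nP]) (use Q in auto)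
  also have "\<dots> = 1 - measure (choices l n) {\<omega> \<in> space (choices l n). P \<omega>}"
    using M.prob_neg[of P] row_determined_sets[OF P] by simp
  finally show "measure (choices l n) {\<omega> \<in> space (choices l n). P \<omega>} \<le> uniform_prob (tuples n) m Q" by simp
qed (rule measure_choices_ge[OF assms])

end

text \<open>By \<open>strongly_subcritical_iff\<close> the supremum is not attained.\<close>

definition t_b :: real where
  "t_b = Sup {t. 0 \<le> t \<and> strongly_subcritical t}"

lemma strongly_subcritical_le_1: "strongly_subcritical t \<Longrightarrow> t \<le> 1"
  using strongly_subcritical_antimono[of t 1] strong_weak not_weakly_subcritical_1 by (meson linear)

lemma strongly_subcritical_below:
  assumes "0 \<le> t" "t < 1 / (real l * (real l - 1))" shows "strongly_subcritical t"
proof -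
  have "0 < real l * (real l - 1)" using l2 by simp
  then have "t * real l * (real l - 1) < 1" using assms by (simp add: pos_less_divide_eq mult.assoc)
  then obtain a A where "typical a A t" using strongly_subcritical_initial[OF assms(1)] by blast
  then show ?thesis by (rule typical_strong)
qed

lemma t_b_set: "bdd_above {t. 0 \<le> t \<and> strongly_subcritical t}" "{t. 0 \<le> t \<and> strongly_subcritical t} \<noteq> {}"
proof -
  show "bdd_above {t. 0 \<le> t \<and> strongly_subcritical t}"
    by (rule bdd_aboveI[of _ 1]) (use strongly_subcritical_le_1 in auto)
  have "strongly_subcritical 0" using l2 by (intro strongly_subcritical_below) auto
  then show "{t. 0 \<le> t \<and> strongly_subcritical t} \<noteq> {}" by auto
qed

lemma t_b_bounds: "1 / (real l * (real l - 1)) \<le> t_b" "t_b \<le> 1"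
proof -
  show "t_b \<le> 1" unfolding t_b_def
    by (rule cSup_least[OF t_b_set(2)]) (use strongly_subcritical_le_1 in auto)
  have below: "t \<le> t_b" if "0 \<le> t" "t < 1 / (real l * (real l - 1))" for t
    unfolding t_b_def by (rule cSup_upper[OF _ t_b_set(1)]) (use strongly_subcritical_below that in auto)
  have "0 < 1 / (real l * (real l - 1))" using l2 by simp
  then show "1 / (real l * (real l - 1)) \<le> t_b"
  proof (rule dense_le_bounded)
    fix t assume "0 < t" "t < 1 / (real l * (real l - 1))"
    then show "t \<le> t_b" by (intro below) (rule less_imp_le)
  qed
qed

lemma strongly_subcritical_iff: "0 \<le> t \<Longrightarrow> strongly_subcritical t \<longleftrightarrow> t < t_b"
proof
  assume t: "0 \<le> t" and "strongly_subcritical t"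
  then obtain t' where t': "t < t'" "strongly_subcritical t'" using strong_typical(2) by blast
  then have "t' \<le> t_b" unfolding t_b_def by (intro cSup_upper[OF _ t_b_set(1)]) (use t in auto)
  then show "t < t_b" using t' by simp
next
  assume t: "0 \<le> t" and "t < t_b"
  then obtain t' where "t < t'" "strongly_subcritical t'"
    unfolding t_b_def less_cSup_iff[OF t_b_set(2,1)] by auto
  then show "strongly_subcritical t" using strongly_subcritical_antimono by simp
qed

lemma supercritical_tends_to_infinity:
  assumes t: "t_b \<le> t"
  shows "tends_to_infinity_in_prob (choices l)
       (\<lambda>n \<omega>. susceptibility n (rule_graph l R n \<omega> (nat \<lfloor>t * real n\<rfloor>)))"
  unfolding tends_to_infinity_in_prob_def
proof (intro allI impI)
  fix C :: real
  have "0 < 1 / (real l * (real l - 1))" using l2 by simp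
  then have t0: "0 \<le> t" using t_b_bounds t by linarith
  then have "\<not> weakly_subcritical t" using weak_strong strongly_subcritical_iff t by fastforce
  then have lim: "(\<lambda>n. uniform_prob (tuples n) (nat \<lfloor>t * real n\<rfloor>) (\<lambda>h. susceptibility n (graph n h) \<le> C)) \<longlonglongrightarrow> 0"
    unfolding weakly_subcritical_def by blast
  have eq: "measure (choices l n) {\<omega> \<in> space (choices l n). susceptibility n (rule_graph l R n \<omega> (nat \<lfloor>t * real n\<rfloor>)) \<le> C}
    = uniform_prob (tuples n) (nat \<lfloor>t * real n\<rfloor>) (\<lambda>h. susceptibility n (graph n h) \<le> C)" if n: "0 < n" for n
  proof (rule measure_choices[OF n])
    show "row_determined (nat \<lfloor>t * real n\<rfloor>) (\<lambda>\<omega>. susceptibility n (rule_graph l R n \<omega> (nat \<lfloor>t * real n\<rfloor>)) \<le> C)"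
      unfolding row_determined_def[OF n] using rule_graph_cong[of "nat \<lfloor>t * real n\<rfloor>"] by metis
    fix \<omega> assume r: "in_range n (nat \<lfloor>t * real n\<rfloor>) \<omega>"
    have "take (nat \<lfloor>t * real n\<rfloor>) (hist (nat \<lfloor>t * real n\<rfloor>) \<omega>) = hist (nat \<lfloor>t * real n\<rfloor>) \<omega>" by (simp add: hist_def)
    then show "susceptibility n (rule_graph l R n \<omega> (nat \<lfloor>t * real n\<rfloor>)) \<le> C
      \<longleftrightarrow> susceptibility n (graph n (hist (nat \<lfloor>t * real n\<rfloor>) \<omega>)) \<le> C"
      using rule_graph_hist[OF r order_refl] by simp
  qed
  have "\<forall>\<^sub>F n in sequentially. uniform_prob (tuples n) (nat \<lfloor>t * real n\<rfloor>) (\<lambda>h. susceptibility n (graph n h) \<le> C)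
    = measure (choices l n) {\<omega> \<in> space (choices l n). susceptibility n (rule_graph l R n \<omega> (nat \<lfloor>t * real n\<rfloor>)) \<le> C}"
    by (intro eventually_mono[OF eventually_gt_at_top[of "0::nat"]]) (rule eq[symmetric])
  from Lim_transform_eventually[OF lim this]
  show "(\<lambda>n. measure (choices l n) {\<omega> \<in> space (choices l n). susceptibility n (rule_graph l R n \<omega> (nat \<lfloor>t * real n\<rfloor>)) \<le> C}) \<longlonglongrightarrow> 0" .
qed

definition close_to_limit :: "real \<Rightarrow> real \<Rightarrow> nat \<Rightarrow> nat \<Rightarrow> edges \<Rightarrow> bool" where
  "close_to_limit a A n i E \<longleftrightarrow>
     (\<forall>k\<ge>1. \<bar>real (N_eq n E k) - rho k (real i / real n) * real n\<bar> \<le> ln (real n) powr 7 * real n powr (1/2)) \<and>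
     \<bar>susceptibility n E - (\<Sum>\<^sub>\<infinity>k\<in>{1..}. real k * rho k (real i / real n))\<bar> \<le> ln (real n) powr 7 * real n powr (- 1/2) \<and>
     (\<forall>k\<ge>1. real (N_ge n E k) \<le> A * exp (- a * real k) * real n)"

lemma run_ok_close_to_limit:
  assumes tp: "typical a A t"
  shows "\<forall>\<^sub>F n in sequentially. \<forall>h\<in>hists (tuples n) (nat \<lfloor>t * real n\<rfloor>). run_ok a A n (nat \<lfloor>t * real n\<rfloor>) h \<longrightarrow>
    (\<forall>i. real i \<le> t * real n \<longrightarrow> close_to_limit a A n i (graph n (take i h)))"
proof -
  have a: "0 < a" "0 < A" using typical_pos[OF tp] by auto
  show ?thesis
    using err_tendsto(3)[OF a, of "stab t a A" "4 * A / a\<^sup>2"] err_tendsto(4)[OF a, of "stab t a A"] eventually_large[OF a(1), of A]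
  proof eventually_elim
    case (elim n)
    let ?T = "nat \<lfloor>t * real n\<rfloor>"
    have n: "1 < n" using elim(3) by (simp add: large_def)
    have pw: "ln (real n) powr 7 * real n powr (1/2) = real n * (ln (real n) ^ 7 / sqrt (real n))"
      "ln (real n) powr 7 * real n powr (- 1/2) = ln (real n) ^ 7 / sqrt (real n)"
      using n by (simp_all add: powr_half_sqrt powr_minus_divide field_simps)
    show ?case
    proof (intro ballI impI allI)
      fix h i assume h: "h \<in> hists (tuples n) ?T" and ok: "run_ok a A n ?T h" and i: "real i \<le> t * real n"
      define s where "s = real i / real n"
      have s: "0 \<le> s" "s \<le> t" using i n by (auto simp: s_def field_simps)
      have si: "nat \<lfloor>s * real n\<rfloor> = i" using n by (simp add: s_def)
      have iT: "nat \<lfloor>s * real n\<rfloor> \<le> ?T" unfolding si using i by (simp add: le_nat_floor)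
      have len: "?T \<le> length h" using h by simp
      have N: "\<bar>real (N_eq n (graph n (take i h)) k) - rho k s * real n\<bar> \<le> ln (real n) powr 7 * real n powr (1/2)" if k: "1 \<le> k" for k
      proof -
        have "\<bar>hist_run n h i k - rho k s\<bar> \<le> ln (real n) ^ 7 / sqrt (real n)"
          using rho_close_single[OF tp s k elim(3) ok len iT] elim(2) unfolding si by linarith
        then have "real n * \<bar>hist_run n h i k - rho k s\<bar> \<le> real n * (ln (real n) ^ 7 / sqrt (real n))"
          by (intro mult_left_mono) auto
        moreover have "real n * \<bar>hist_run n h i k - rho k s\<bar> = \<bar>real (N_eq n (graph n (take i h)) k) - rho k s * real n\<bar>"
        proof -
          have "real n * \<bar>y / real n - r\<bar> = \<bar>y - r * real n\<bar>" for y r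
          proof -
            have "real n * \<bar>y / real n - r\<bar> = \<bar>real n * (y / real n - r)\<bar>" by (simp add: abs_mult)
            also have "real n * (y / real n - r) = y - r * real n" using n by (simp add: field_simps)
            finally show ?thesis .
          qed
          then show ?thesis by (simp only: hist_run_def freq_def)
        qed
        ultimately show ?thesis unfolding pw by simp
      qed
      have S: "\<bar>susceptibility n (graph n (take i h)) - (\<Sum>\<^sub>\<infinity>k\<in>{1..}. real k * rho k s)\<bar> \<le> ln (real n) powr 7 * real n powr (- 1/2)"
        using susceptibility_close[OF tp s elim(3) ok len iT] elim(1) unfolding si pw by linarith
      have T: "tails a A n (graph n (take i h))" using ok iT unfolding si by (simp add: run_ok_def)
      show "close_to_limit a A n i (graph n (take i h))"
        unfolding close_to_limit_def using N S T by (simp add: s_def tails_def)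
    qed
  qed
qed

lemma subcritical_approximation:
  assumes tp: "typical a A t" and t: "0 \<le> t"
  shows "\<exists>n0. \<forall>n\<ge>n0. 1 - real n powr (- 99) \<le> measure (choices l n) {\<omega> \<in> space (choices l n).
    \<forall>i. real i \<le> t * real n \<longrightarrow> close_to_limit a A n i (rule_graph l R n \<omega> i)}"
proof -
  obtain Q where ev: "\<forall>\<^sub>F n in sequentially. uniform_prob (tuples n) (nat \<lfloor>t * real n\<rfloor>)
     (\<lambda>h. \<not> run_ok a A n (nat \<lfloor>t * real n\<rfloor>) h) \<le> Q * real n powr (-100)"
    using tp unfolding typical_def by blast
  have "\<forall>\<^sub>F n in sequentially. Q * real n powr (-100) \<le> real n powr (-99)" by real_asymp
  with ev run_ok_close_to_limit[OF tp] eventually_gt_at_top[of 0]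
  have "\<forall>\<^sub>F n in sequentially. 1 - real n powr (- 99) \<le> measure (choices l n) {\<omega> \<in> space (choices l n).
    \<forall>i. real i \<le> t * real n \<longrightarrow> close_to_limit a A n i (rule_graph l R n \<omega> i)}"
  proof eventually_elim
    case (elim n)
    let ?T = "nat \<lfloor>t * real n\<rfloor>"
    let ?Q = "\<lambda>h. \<forall>i. real i \<le> t * real n \<longrightarrow> close_to_limit a A n i (graph n (take i h))"
    have n: "0 < n" using elim by simp
    have iT: "i \<le> ?T" if "real i \<le> t * real n" for i using that by (simp add: le_nat_floor)
    have "1 - real n powr (- 99) \<le> 1 - uniform_prob (tuples n) ?T (\<lambda>h. \<not> run_ok a A n ?T h)" using elim by linarith
    also have "\<dots> = uniform_prob (tuples n) ?T (\<lambda>h. \<not> \<not> run_ok a A n ?T h)"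
      by (rule uniform_prob_not[OF finite_tuples tuples_nonempty[OF n], symmetric])
    also have "\<dots> \<le> uniform_prob (tuples n) ?T ?Q"
      using elim(2) by (intro uniform_prob_mono) blast
    also have "\<dots> = measure (choices l n) {\<omega> \<in> space (choices l n).
      \<forall>i. real i \<le> t * real n \<longrightarrow> close_to_limit a A n i (rule_graph l R n \<omega> i)}"
    proof (rule measure_choices[OF n, symmetric])
      show "row_determined ?T (\<lambda>\<omega>. \<forall>i. real i \<le> t * real n \<longrightarrow> close_to_limit a A n i (rule_graph l R n \<omega> i))"
        unfolding row_determined_def[OF n]
      proof (intro allI impI)
        fix \<omega> \<omega>' :: "nat \<times> nat \<Rightarrow> nat" assume eq: "\<forall>i<?T. \<forall>j. \<omega> (i, j) = \<omega>' (i, j)"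
        have "rule_graph l R n \<omega> i = rule_graph l R n \<omega>' i" if "real i \<le> t * real n" for i
          using iT[OF that] eq by (intro rule_graph_cong) auto
        then show "(\<forall>i. real i \<le> t * real n \<longrightarrow> close_to_limit a A n i (rule_graph l R n \<omega> i))
          = (\<forall>i. real i \<le> t * real n \<longrightarrow> close_to_limit a A n i (rule_graph l R n \<omega>' i))" by auto
      qed
      fix \<omega> assume "in_range n ?T \<omega>"
      from rule_graph_hist[OF this] iT
      show "(\<forall>i. real i \<le> t * real n \<longrightarrow> close_to_limit a A n i (rule_graph l R n \<omega> i)) \<longleftrightarrow> ?Q (hist ?T \<omega>)" by auto
    qed
    finally show ?case .
  qed
  then show ?thesis unfolding eventually_sequentially .
qed

end

theorem theorem1:
  fixes l :: nat and R :: "nat list \<Rightarrow> nat set set"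
  assumes "2 \<le> l" and "size_rule l R"
  shows "\<exists>tb \<in> {1 / (real l * (real l - 1)) .. 1}. \<exists>\<rho> :: nat \<Rightarrow> real \<Rightarrow> real.
    (\<forall>k\<ge>1. \<forall>t \<in> {0..<tb}. \<rho> k t \<in> {0..1}) \<and>
    (\<forall>t\<ge>tb. tends_to_infinity_in_prob (choices l)
       (\<lambda>n \<omega>. susceptibility n (rule_graph l R n \<omega> (nat \<lfloor>t * real n\<rfloor>)))) \<and>
    (\<forall>t \<in> {0..<tb}. ((\<lambda>k. \<rho> k t) has_sum 1) {1..}) \<and>
    (\<forall>t \<in> {0..<tb}. \<exists>a>0. \<exists>A>0. \<exists>C>0.
       (\<forall>t' \<in> {0..t}. \<forall>k\<ge>1. \<rho> k t' \<le> A * exp (- a * real k)) \<and>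
       (\<exists>n0. \<forall>n\<ge>n0.
          measure (choices l n) {\<omega> \<in> space (choices l n).
            \<forall>i. real i \<le> t * real n \<longrightarrow>
              (\<forall>k\<ge>1. \<bar>real (N_eq n (rule_graph l R n \<omega> i) k) - \<rho> k (real i / real n) * real n\<bar>
                 \<le> ln (real n) powr C * real n powr (1/2)) \<and>
              \<bar>susceptibility n (rule_graph l R n \<omega> i)
                 - (\<Sum>\<^sub>\<infinity>k\<in>{1..}. real k * \<rho> k (real i / real n))\<bar>
                 \<le> ln (real n) powr C * real n powr (- 1/2) \<and>
              (\<forall>k\<ge>1. real (N_ge n (rule_graph l R n \<omega> i) k) \<le> A * exp (- a * real k) * real n)}
          \<ge> 1 - real n powr (- 99)))"
proof -
  interpret size_rule_process l R by unfold_locales (fact assms)+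
  have tp: "\<exists>a A. typical a A t" if "t \<in> {0..<t_b}" for t
    using strong_typical(1) strongly_subcritical_iff that by auto
  show ?thesis
  proof (intro bexI[of _ t_b] exI[of _ rho] conjI ballI allI impI)
    show "t_b \<in> {1 / (real l * (real l - 1)) .. 1}" using t_b_bounds by simp
  next
    fix k :: nat and t assume k: "1 \<le> k" and t: "t \<in> {0..<t_b}"
    obtain a A where "typical a A t" using tp[OF t] by blast
    from rho_bounds[OF this _ order_refl k] show "rho k t \<in> {0..1}" using t by simp
  next
    fix t assume "t_b \<le> t"
    then show "tends_to_infinity_in_prob (choices l)
       (\<lambda>n \<omega>. susceptibility n (rule_graph l R n \<omega> (nat \<lfloor>t * real n\<rfloor>)))"
      by (rule supercritical_tends_to_infinity)
  next
    fix t assume t: "t \<in> {0..<t_b}"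
    obtain a A where "typical a A t" using tp[OF t] by blast
    from rho_has_sum[OF this] show "((\<lambda>k. rho k t) has_sum 1) {1..}" using t by simp
  next
    fix t assume t: "t \<in> {0..<t_b}"
    then obtain a A where aA: "typical a A t" using tp by blast
    have t0: "0 \<le> t" using t by simp
    have pos: "0 < a" "0 < A" "(0::real) < 7" using typical_pos[OF aA] by auto
    show "\<exists>a>0. \<exists>A>0. \<exists>C>0.
       (\<forall>t' \<in> {0..t}. \<forall>k\<ge>1. rho k t' \<le> A * exp (- a * real k)) \<and>
       (\<exists>n0. \<forall>n\<ge>n0.
          measure (choices l n) {\<omega> \<in> space (choices l n).
            \<forall>i. real i \<le> t * real n \<longrightarrow>
              (\<forall>k\<ge>1. \<bar>real (N_eq n (rule_graph l R n \<omega> i) k) - rho k (real i / real n) * real n\<bar>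
                 \<le> ln (real n) powr C * real n powr (1/2)) \<and>
              \<bar>susceptibility n (rule_graph l R n \<omega> i)
                 - (\<Sum>\<^sub>\<infinity>k\<in>{1..}. real k * rho k (real i / real n))\<bar>
                 \<le> ln (real n) powr C * real n powr (- 1/2) \<and>
              (\<forall>k\<ge>1. real (N_ge n (rule_graph l R n \<omega> i) k) \<le> A * exp (- a * real k) * real n)}
          \<ge> 1 - real n powr (- 99))"
    proof (rule exI[of _ a], rule conjI[OF pos(1)], rule exI[of _ A], rule conjI[OF pos(2)],
        rule exI[of _ 7], rule conjI[OF pos(3)], rule conjI)
      show "\<forall>t'\<in>{0..t}. \<forall>k\<ge>1. rho k t' \<le> A * exp (- a * real k)"
        using rho_bounds(3)[OF aA] by auto
      show "\<exists>n0. \<forall>n\<ge>n0.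
          measure (choices l n) {\<omega> \<in> space (choices l n).
            \<forall>i. real i \<le> t * real n \<longrightarrow>
              (\<forall>k\<ge>1. \<bar>real (N_eq n (rule_graph l R n \<omega> i) k) - rho k (real i / real n) * real n\<bar>
                 \<le> ln (real n) powr 7 * real n powr (1/2)) \<and>
              \<bar>susceptibility n (rule_graph l R n \<omega> i)
                 - (\<Sum>\<^sub>\<infinity>k\<in>{1..}. real k * rho k (real i / real n))\<bar>
                 \<le> ln (real n) powr 7 * real n powr (- 1/2) \<and>
              (\<forall>k\<ge>1. real (N_ge n (rule_graph l R n \<omega> i) k) \<le> A * exp (- a * real k) * real n)}
          \<ge> 1 - real n powr (- 99)"
        using subcritical_approximation[OF aA t0] unfolding close_to_limit_def .
    qed
  qed
qed

end
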